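(* Let $m\in\{2,\dots,n\}$ and let $\eta<m-1$. Suppose that, for every $\Lambda\subset[n]$ with $n-|\Lambda|=m$ and every $\mathbf{y}\in\mathsf{X}_\Lambda$ with $\pi_\Lambda(\mathbf{y})>0$, there is an influence matrix $\Phi(\Lambda,\mathbf{y})$ associated with $(\Lambda,\mathbf{y})$ whose spectral radius satisfies $r(\Phi(\Lambda,\mathbf{y}))\le\eta$. Then $$\mathrm{Gap}(m,m-1)\ \ge\ \frac{m-1}{m}-\frac{\eta}{m}.$$ In particular, for every $l\in\{1,\dots,n-1\}$, if $\Pi$ is $(\eta_{l+1},\dots,\eta_n)$-spectrally independent, then $$\mathrm{Gap}(n,l)\ \ge\ \prod_{k=l+1}^n\left(\frac{k-1}{k}-\frac{\eta_k}{k}\right)=\frac{l}{n}\prod_{k=l+1}^n\left(1-\frac{\eta_k}{k-1}\right).$$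
   Context: Setting. Let $n\ge 2$ be an integer, $[n]=\{1,\dots,n\}$, and let $(\mathsf{X}_i,\mathcal{B}_i,\mu_i)$, $i\in[n]$, be $\sigma$-finite measure spaces in which singletons are measurable. Let $\mathbf{X}=(X_1,\dots,X_n)$ be a random element, $X_i$ taking values in $\mathsf{X}_i$, whose joint distribution $\Pi$ on $\mathsf{X}=\mathsf{X}_1\times\dots\times\mathsf{X}_n$ has density $\pi$ with respect to $\mu_1\times\dots\times\mu_n$; $\pi$ is a measurable function specified everywhere on $\mathsf{X}$. For $\Gamma\subset[n]$ write $-\Gamma=[n]\setminus\Gamma$; for nonempty $\Gamma$ let $\mathsf{X}_\Gamma=\prod_{i\in\Gamma}\mathsf{X}_i$, $\mu_\Gamma=\prod_{i\in\Gamma}\mu_i$, and let $\mathbf{X}_\Gamma$, $\mathbf{x}_\Gamma$ denote the subvectors of $\mathbf{X}$, $\mathbf{x}\in\mathsf{X}$ with indices in $\Gamma$ (in increasing order). The marginal density of $\mathbf{X}_\Gamma$ is $\pi_\Gamma(\mathbf{y})=\int_{\mathsf{X}_{-\Gamma}}\pi(\mathbf{x})\,\mu_{-\Gamma}(d\mathbf{x}_{-\Gamma})$ with $\mathbf{x}_\Gamma=\mathbf{y}$, and $\pi_{[n]}=\pi$. For disjoint nonempty $\Lambda,\Gamma\subset[n]$ and $\mathbf{y}\in\mathsf{X}_\Lambda$ with $\pi_\Lambda(\mathbf{y})>0$, the conditional density is $\pi_{\Gamma\mid\Lambda}(\mathbf{z}\mid\mathbf{y})=\pi_{\Lambda\cup\Gamma}(\mathbf{x}_{\Lambda\cup\Gamma})/\pi_\Lambda(\mathbf{y})$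 where $\mathbf{x}_\Lambda=\mathbf{y}$, $\mathbf{x}_\Gamma=\mathbf{z}$; if $\pi_\Lambda(\mathbf{y})=0$, $\pi_{\Gamma\mid\Lambda}(\cdot\mid\mathbf{y})$ is an arbitrary probability density on $\mathsf{X}_\Gamma$. If $\Lambda=\emptyset$, $\pi_{\Gamma\mid\Lambda}(\cdot\mid\mathbf{y})$ means $\pi_\Gamma(\cdot)$ (and conditions on $\mathbf{y}$, such as $\pi_\Lambda(\mathbf{y})>0$, are vacuous). Spectral gap. For a probability measure $\nu$, $L_0^2(\nu)$ is the Hilbert space of real square-integrable functions with $\int f\,d\nu=0$, with norm $\|\cdot\|_\nu$. A Markov kernel $K$ reversible with respect to $\nu$ acts on $L_0^2(\nu)$ by $Kf(x)=\int f(x')K(x,dx')$; $\|K\|_\nu=\sup_{f\in L_0^2(\nu),f\ne0}\|Kf\|_\nu/\|f\|_\nu$, and the spectral gap of $K$ is $1-\|K\|_\nu$. Gibbs samplers. For $\Lambda\subset[n]$ with $|\Lambda|\le n-1$, $\mathbf{y}\in\mathsf{X}_\Lambda$ and $l\in\{1,\dots,n-|\Lambda|\}$, the random-scan Gibbs sampler targeting $\pi_{-\Lambda\mid\Lambda}(\cdot\mid\mathbf{y})$ with block size $l$ is the Markov chain on $\mathsf{X}_{-\Lambda}$ that moves from $\mathbf{z}$ as follows: let $\mathbf{x}$ satisfy $\mathbf{x}_\Lambda=\mathbf{y}$, $\mathbf{x}_{-\Lambda}=\mathbf{z}$; choose $\Gamma\subset-\Lambda$ with $|\Gamma|=l$ uniformly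 at random; draw $\mathbf{w}\in\mathsf{X}_\Gamma$ from $\pi_{\Gamma\mid-\Gamma}(\cdot\mid\mathbf{x}_{-\Gamma})$; let $\mathbf{x}'_\Gamma=\mathbf{w}$, $\mathbf{x}'_{-\Gamma}=\mathbf{x}_{-\Gamma}$; the new state is $\mathbf{x}'_{-\Lambda}$. When $\pi_\Lambda(\mathbf{y})>0$ this chain is reversible with respect to $\pi_{-\Lambda\mid\Lambda}(\cdot\mid\mathbf{y})$; let $\mathrm{gap}(\Lambda,\mathbf{y},l)$ be its spectral gap. For $l\in\{1,\dots,n\}$ and $m\in\{l,\dots,n\}$, $$\mathrm{Gap}(m,l)=\min_{\Lambda\subset[n],\,|\Lambda|=n-m}\ \inf_{\mathbf{y}\in\mathsf{X}_\Lambda,\ \pi_\Lambda(\mathbf{y})>0}\mathrm{gap}(\Lambda,\mathbf{y},l).$$ In particular $\mathrm{Gap}(n,l)$ is the spectral gap of the Gibbs sampler targeting $\pi$ with block size $l$. Influence matrices. Let $\Lambda\subset[n]$ with $|\Lambda|\le n-2$ and $\mathbf{y}\in\mathsf{X}_\Lambda$ with $\pi_\Lambda(\mathbf{y})>0$. For $i,j\in-\Lambda$, $i\ne j$, and $x\in\mathsf{X}_i$, let $\Pi^j_{\Lambda,\mathbf{y},i,x}$ be the probability measure on $\mathsf{X}_j$ with density $\pi_{\{j\}\mid\Lambda\cup\{i\}}(\cdot\mid\mathbf{x}_{\Lambda\cup\{i\}})$, where $\mathbf{x}_\Lambda=\mathbf{y}$ and $\mathbf{x}_{\{i\}}=x$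 (the conditional law of $X_j$ given $X_i=x$, $\mathbf{X}_\Lambda=\mathbf{y}$). Write $\pi_{\{i\}\mid\Lambda}(dx\mid\mathbf{y})=\pi_{\{i\}\mid\Lambda}(x\mid\mathbf{y})\mu_i(dx)$. Suppose that for each $i\in-\Lambda$ there is a measurable function $d_{\Lambda,\mathbf{y},i}:\mathsf{X}_i\times\mathsf{X}_i\to[0,\infty)$, symmetric and with $d_{\Lambda,\mathbf{y},i}(x,x')=0$ iff $x=x'$, such that: (H1) for $i\in-\Lambda$, $\int_{\mathsf{X}_i}\big[\int_{\mathsf{X}_i}d_{\Lambda,\mathbf{y},i}(x,x')\,\pi_{\{i\}\mid\Lambda}(dx\mid\mathbf{y})\big]^2\pi_{\{i\}\mid\Lambda}(dx'\mid\mathbf{y})<\infty$; (H2) there is $k<\infty$ (possibly depending on $(\Lambda,\mathbf{y})$, but not on $i,j,x,x'$) such that, for all $i\neq j$ in $-\Lambda$ and $\pi_{\{i\}\mid\Lambda}(\cdot\mid\mathbf{y})$-almost every $x,x'\in\mathsf{X}_i$, $d_{\mathrm{TV}}(\Pi^j_{\Lambda,\mathbf{y},i,x},\Pi^j_{\Lambda,\mathbf{y},i,x'})\le k\,d_{\Lambda,\mathbf{y},i}(x,x')$, where $d_{\mathrm{TV}}(\nu_1,\nu_2)=\sup_A|\nu_1(A)-\nu_2(A)|$. A coupling kernel associated with $(\Lambda,\mathbf{y},i,j)$, $i\ne j$, is a Markov transition kernel $K_{i,j}$ from $\mathsf{X}_i\times\mathsf{X}_i$ to $\mathsf{X}_j\times\mathsf{X}_j$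 such that, for all $x,x'\in\mathsf{X}_i$, $K_{i,j}((x,x'),\cdot)$ is a coupling of $\Pi^j_{\Lambda,\mathbf{y},i,x}$ and $\Pi^j_{\Lambda,\mathbf{y},i,x'}$ (i.e. has these as first and second marginals). A contraction condition holds for $(\Lambda,\mathbf{y},i,j)$ with coefficient $\phi_{i,j}\in[0,\infty)$ if there is such a coupling kernel with $$\int_{\mathsf{X}_j\times\mathsf{X}_j}d_{\Lambda,\mathbf{y},j}(x'',x''')\,K_{i,j}((x,x'),d(x'',x'''))\le\phi_{i,j}\,d_{\Lambda,\mathbf{y},i}(x,x')$$ for $\pi_{\{i\}\mid\Lambda}(\cdot\mid\mathbf{y})$-almost every $x,x'\in\mathsf{X}_i$. An influence matrix $\Phi(\Lambda,\mathbf{y})$ associated with $(\Lambda,\mathbf{y})$ is an $(n-|\Lambda|)\times(n-|\Lambda|)$ matrix, indexed by $-\Lambda$, whose diagonal entries are $0$ and whose $(i,j)$ entry, $i\neq j$, is a coefficient $\phi_{i,j}$ with which the contraction condition holds for $(\Lambda,\mathbf{y},i,j)$, for some family of measurable functions $d_{\Lambda,\mathbf{y},i}:\mathsf{X}_i\times\mathsf{X}_i\to[0,\infty)$ ($i\in-\Lambda$; the same family for all entries), each symmetric and with $d_{\Lambda,\mathbf{y},i}(x,x')=0$ iff $x=x'$, satisfying (H1) and (H2). $r(\cdot)$ denotes spectral radius. Spectral independence. Given $l\in\{1,\dots,n-1\}$ and $(\eta_{l+1},\dots,\eta_n)\in\mathbb{R}^{n-l}$ with $\eta_m<m-1$ for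 each $m$, $\Pi$ is $(\eta_{l+1},\dots,\eta_n)$-spectrally independent if for every $m\in\{l+1,\dots,n\}$, $\Lambda\subset[n]$ with $|\Lambda|=n-m$, and $\mathbf{y}\in\mathsf{X}_\Lambda$ with $\pi_\Lambda(\mathbf{y})>0$, there is an influence matrix $\Phi(\Lambda,\mathbf{y})$ associated with $(\Lambda,\mathbf{y})$ with $r(\Phi(\Lambda,\mathbf{y}))\le\eta_m$. *)

theory Defs
  imports
    "HOL-Probability.Probability"
    "Jordan_Normal_Form.Spectral_Radius"
begin

text \<open>
  The values are taken in \<open>[0, \<infinity>]\<close>. The Lebesgue integral of a nonnegative function is insensitive
  to changes on null sets even where the integrand fails to be measurable; this matters below,
  because the conditional densities are arbitrary (possibly non-measurably so) where the
  conditioning density vanishes.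
\<close>

definition L2_norm :: "'b measure \<Rightarrow> ('b \<Rightarrow> real) \<Rightarrow> ennreal" where
  "L2_norm \<nu> f =
    (let s = (\<integral>\<^sup>+ x. ennreal ((f x)\<^sup>2) \<partial>\<nu>) in if s = \<top> then \<top> else ennreal (sqrt (enn2real s)))"

definition L2_zero :: "'b measure \<Rightarrow> ('b \<Rightarrow> real) set" where
  "L2_zero \<nu> =
    {f \<in> borel_measurable \<nu>. integrable \<nu> (\<lambda>x. (f x)\<^sup>2) \<and> (\<integral> x. f x \<partial>\<nu>) = 0}"

definition kernel_op :: "('b \<Rightarrow> 'b measure) \<Rightarrow> ('b \<Rightarrow> real) \<Rightarrow> 'b \<Rightarrow> real" where
  "kernel_op K f x = (\<integral> x'. f x' \<partial>K x)"

text \<open>The supremum is over \<open>[0, \<infinity>]\<close>, so the norm is 0 if the space is trivial.\<close>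

definition kernel_norm :: "'b measure \<Rightarrow> ('b \<Rightarrow> 'b measure) \<Rightarrow> ennreal" where
  "kernel_norm \<nu> K =
    (SUP f \<in> {f \<in> L2_zero \<nu>. L2_norm \<nu> f \<noteq> 0}. L2_norm \<nu> (kernel_op K f) / L2_norm \<nu> f)"

definition spectral_gap :: "'b measure \<Rightarrow> ('b \<Rightarrow> 'b measure) \<Rightarrow> ereal" where
  "spectral_gap \<nu> K = 1 - enn2ereal (kernel_norm \<nu> K)"

definition tv_dist :: "'b measure \<Rightarrow> 'b measure \<Rightarrow> real" where
  "tv_dist \<nu>1 \<nu>2 = (SUP A \<in> sets \<nu>1. \<bar>measure \<nu>1 A - measure \<nu>2 A\<bar>)"

text \<open>
  A property of almost every \<open>x, x'\<close>: it holds for all \<open>x, x'\<close> outside a single null set. This is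
  stronger than almost everywhere with respect to \<open>\<nu> \<Otimes>\<^sub>M \<nu>\<close>, which would not be enough here since
  a coupling may be carried by a null set of the product measure.
\<close>

definition ae_pairs :: "'b measure \<Rightarrow> ('b \<Rightarrow> 'b \<Rightarrow> bool) \<Rightarrow> bool" where
  "ae_pairs \<nu> P \<longleftrightarrow> (\<exists>N \<in> null_sets \<nu>. \<forall>x \<in> space \<nu> - N. \<forall>x' \<in> space \<nu> - N. P x x')"

definition coupling :: "('b \<times> 'b) measure \<Rightarrow> 'b measure \<Rightarrow> 'b measure \<Rightarrow> bool" where
  "coupling \<kappa> \<nu>1 \<nu>2 \<longleftrightarrow>
    sets \<kappa> = sets (\<nu>1 \<Otimes>\<^sub>M \<nu>2) \<and> distr \<kappa> \<nu>1 fst = \<nu>1 \<and> distr \<kappa> \<nu>2 snd = \<nu>2"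

text \<open>
  A real matrix indexed by a finite set \<open>S\<close> of naturals is a function of two indices; its rows and
  columns are enumerated in increasing order to obtain a matrix of the library.
\<close>

definition index_mat :: "nat set \<Rightarrow> (nat \<Rightarrow> nat \<Rightarrow> real) \<Rightarrow> real Matrix.mat" where
  "index_mat S \<Phi> = Matrix.mat (card S) (card S)
    (\<lambda>(a, b). \<Phi> (sorted_list_of_set S ! a) (sorted_list_of_set S ! b))"

definition matrix_radius :: "nat set \<Rightarrow> (nat \<Rightarrow> nat \<Rightarrow> real) \<Rightarrow> real" where
  "matrix_radius S \<Phi> =
    Spectral_Radius.spectral_radius (map_mat complex_of_real (index_mat S \<Phi>))"

text \<open>
  The coordinate spaces \<open>M i\<close> may differ, but share an ambient type. A point of the product
  over \<open>\<Gamma>\<close> is an extensional function on \<open>\<Gamma>\<close>. The law of \<open>X\<close> has density \<open>\<pi>\<close>, and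
  \<open>q \<Gamma> \<Lambda> y\<close> is the arbitrary probability density that serves as conditional density of
  \<open>X\<^sub>\<Gamma>\<close> given \<open>X\<^sub>\<Lambda> = y\<close> where the density of \<open>X\<^sub>\<Lambda>\<close> vanishes.
\<close>

locale gibbs_setting =
  fixes n :: nat
    and M :: "nat \<Rightarrow> 'a measure"
    and \<pi> :: "(nat \<Rightarrow> 'a) \<Rightarrow> real"
    and q :: "nat set \<Rightarrow> nat set \<Rightarrow> (nat \<Rightarrow> 'a) \<Rightarrow> (nat \<Rightarrow> 'a) \<Rightarrow> real"
  assumes n_ge_2: "n \<ge> 2"
    and sigma_finite: "\<And>i. i \<in> {1..n} \<Longrightarrow> sigma_finite_measure (M i)"
    and singletons: "\<And>i x. i \<in> {1..n} \<Longrightarrow> x \<in> space (M i) \<Longrightarrow> {x} \<in> sets (M i)"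
    and density_measurable: "\<pi> \<in> borel_measurable (PiM {1..n} M)"
    and density_nonneg: "\<And>x. x \<in> space (PiM {1..n} M) \<Longrightarrow> 0 \<le> \<pi> x"
    and density_prob: "prob_space (density (PiM {1..n} M) (\<lambda>x. ennreal (\<pi> x)))"
    and default_measurable: "\<And>\<Gamma> \<Lambda> y. \<lbrakk>\<Gamma> \<subseteq> {1..n}; \<Lambda> \<subseteq> {1..n}; \<Gamma> \<inter> \<Lambda> = {}; \<Gamma> \<noteq> {}; \<Lambda> \<noteq> {};
      y \<in> space (PiM \<Lambda> M)\<rbrakk> \<Longrightarrow> q \<Gamma> \<Lambda> y \<in> borel_measurable (PiM \<Gamma> M)"
    and default_nonneg: "\<And>\<Gamma> \<Lambda> y z. \<lbrakk>\<Gamma> \<subseteq> {1..n}; \<Lambda> \<subseteq> {1..n}; \<Gamma> \<inter> \<Lambda> = {}; \<Gamma> \<noteq> {}; \<Lambda> \<noteq> {};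
      y \<in> space (PiM \<Lambda> M); z \<in> space (PiM \<Gamma> M)\<rbrakk> \<Longrightarrow> 0 \<le> q \<Gamma> \<Lambda> y z"
    and default_prob: "\<And>\<Gamma> \<Lambda> y. \<lbrakk>\<Gamma> \<subseteq> {1..n}; \<Lambda> \<subseteq> {1..n}; \<Gamma> \<inter> \<Lambda> = {}; \<Gamma> \<noteq> {}; \<Lambda> \<noteq> {};
      y \<in> space (PiM \<Lambda> M)\<rbrakk> \<Longrightarrow> prob_space (density (PiM \<Gamma> M) (\<lambda>z. ennreal (q \<Gamma> \<Lambda> y z)))"
begin

abbreviation compl :: "nat set \<Rightarrow> nat set" where
  "compl \<Gamma> \<equiv> {1..n} - \<Gamma>"

text \<open>
  The marginal density of \<open>X\<^sub>\<Gamma>\<close>. The integral may diverge on a null set of points \<open>y\<close>; the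
  Bochner integral, hence the marginal density, is 0 there. For \<open>\<Gamma> = {}\<close> it is the constant 1.
\<close>

definition marg :: "nat set \<Rightarrow> (nat \<Rightarrow> 'a) \<Rightarrow> real" where
  "marg \<Gamma> y = (\<integral> z. \<pi> (merge \<Gamma> (compl \<Gamma>) (y, z)) \<partial>PiM (compl \<Gamma>) M)"

text \<open>The points at which one may condition; for \<open>\<Lambda> = {}\<close> there is exactly one.\<close>

definition pos_points :: "nat set \<Rightarrow> (nat \<Rightarrow> 'a) set" where
  "pos_points \<Lambda> = {y \<in> space (PiM \<Lambda> M). marg \<Lambda> y > 0}"

text \<open>The density of \<open>X\<^sub>\<Gamma>\<close> at \<open>z\<close> given \<open>X\<^sub>\<Lambda> = y\<close>; it is \<open>marg \<Gamma>\<close> if \<open>\<Lambda> = {}\<close>.\<close>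

definition cond :: "nat set \<Rightarrow> nat set \<Rightarrow> (nat \<Rightarrow> 'a) \<Rightarrow> (nat \<Rightarrow> 'a) \<Rightarrow> real" where
  "cond \<Gamma> \<Lambda> y z =
    (if marg \<Lambda> y > 0 then marg (\<Lambda> \<union> \<Gamma>) (merge \<Lambda> \<Gamma> (y, z)) / marg \<Lambda> y else q \<Gamma> \<Lambda> y z)"

definition cond_law :: "nat set \<Rightarrow> nat set \<Rightarrow> (nat \<Rightarrow> 'a) \<Rightarrow> (nat \<Rightarrow> 'a) measure" where
  "cond_law \<Gamma> \<Lambda> y = density (PiM \<Gamma> M) (\<lambda>z. ennreal (cond \<Gamma> \<Lambda> y z))"

text \<open>The conditional law of the single coordinate \<open>X\<^sub>i\<close>, as a measure on \<open>M i\<close>.\<close>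

definition coord_law :: "nat \<Rightarrow> nat set \<Rightarrow> (nat \<Rightarrow> 'a) \<Rightarrow> 'a measure" where
  "coord_law i \<Lambda> y = density (M i) (\<lambda>x. ennreal (cond {i} \<Lambda> y (\<lambda>k\<in>{i}. x)))"

definition gibbs_update ::
    "nat set \<Rightarrow> (nat \<Rightarrow> 'a) \<Rightarrow> nat set \<Rightarrow> (nat \<Rightarrow> 'a) \<Rightarrow> (nat \<Rightarrow> 'a) measure" where
  "gibbs_update \<Lambda> y \<Gamma> z =
    (let x = merge \<Lambda> (compl \<Lambda>) (y, z) in
      distr (cond_law \<Gamma> (compl \<Gamma>) (restrict x (compl \<Gamma>))) (PiM (compl \<Lambda>) M)
        (\<lambda>w. restrict (merge \<Gamma> (compl \<Gamma>) (w, x)) (compl \<Lambda>)))"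

definition gibbs_kernel ::
    "nat set \<Rightarrow> (nat \<Rightarrow> 'a) \<Rightarrow> nat \<Rightarrow> (nat \<Rightarrow> 'a) \<Rightarrow> (nat \<Rightarrow> 'a) measure" where
  "gibbs_kernel \<Lambda> y l z =
    uniform_count_measure {\<Gamma>. \<Gamma> \<subseteq> compl \<Lambda> \<and> card \<Gamma> = l} \<bind> (\<lambda>\<Gamma>. gibbs_update \<Lambda> y \<Gamma> z)"

definition gap :: "nat set \<Rightarrow> (nat \<Rightarrow> 'a) \<Rightarrow> nat \<Rightarrow> ereal" where
  "gap \<Lambda> y l = spectral_gap (cond_law (compl \<Lambda>) \<Lambda> y) (gibbs_kernel \<Lambda> y l)"

definition Gap :: "nat \<Rightarrow> nat \<Rightarrow> ereal" where
  "Gap m l = (MIN \<Lambda> \<in> {\<Lambda>. \<Lambda> \<subseteq> {1..n} \<and> card \<Lambda> = n - m}. INF y \<in> pos_points \<Lambda>. gap \<Lambda> y l)"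

text \<open>The conditional law of \<open>X\<^sub>j\<close> given \<open>X\<^sub>\<Lambda> = y\<close> and \<open>X\<^sub>i = x\<close>.\<close>

definition influenced_law ::
    "nat set \<Rightarrow> (nat \<Rightarrow> 'a) \<Rightarrow> nat \<Rightarrow> 'a \<Rightarrow> nat \<Rightarrow> 'a measure" where
  "influenced_law \<Lambda> y i x j = coord_law j (insert i \<Lambda>) (y(i := x))"

definition dist_family ::
    "nat set \<Rightarrow> (nat \<Rightarrow> 'a) \<Rightarrow> (nat \<Rightarrow> 'a \<Rightarrow> 'a \<Rightarrow> real) \<Rightarrow> bool" where
  "dist_family \<Lambda> y d \<longleftrightarrow>
    (\<forall>i \<in> compl \<Lambda>.
      case_prod (d i) \<in> borel_measurable (M i \<Otimes>\<^sub>M M i) \<and>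
      (\<forall>x \<in> space (M i). \<forall>x' \<in> space (M i).
        0 \<le> d i x x' \<and> d i x x' = d i x' x \<and> (d i x x' = 0 \<longleftrightarrow> x = x')) \<and>
      (\<integral>\<^sup>+ x'. (\<integral>\<^sup>+ x. ennreal (d i x x') \<partial>coord_law i \<Lambda> y)\<^sup>2 \<partial>coord_law i \<Lambda> y) < \<infinity>) \<and>
    (\<exists>k :: real. \<forall>i \<in> compl \<Lambda>. \<forall>j \<in> compl \<Lambda>. i \<noteq> j \<longrightarrow>
      ae_pairs (coord_law i \<Lambda> y) (\<lambda>x x'.
        tv_dist (influenced_law \<Lambda> y i x j) (influenced_law \<Lambda> y i x' j) \<le> k * d i x x'))"

definition coupling_kernel ::
    "nat set \<Rightarrow> (nat \<Rightarrow> 'a) \<Rightarrow> nat \<Rightarrow> nat \<Rightarrow> ('a \<times> 'a \<Rightarrow> ('a \<times> 'a) measure) \<Rightarrow> bool" where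
  "coupling_kernel \<Lambda> y i j K \<longleftrightarrow>
    K \<in> M i \<Otimes>\<^sub>M M i \<rightarrow>\<^sub>M prob_algebra (M j \<Otimes>\<^sub>M M j) \<and>
    (\<forall>x \<in> space (M i). \<forall>x' \<in> space (M i).
      coupling (K (x, x')) (influenced_law \<Lambda> y i x j) (influenced_law \<Lambda> y i x' j))"

definition contraction ::
    "nat set \<Rightarrow> (nat \<Rightarrow> 'a) \<Rightarrow> (nat \<Rightarrow> 'a \<Rightarrow> 'a \<Rightarrow> real) \<Rightarrow> nat \<Rightarrow> nat \<Rightarrow> real \<Rightarrow> bool" where
  "contraction \<Lambda> y d i j \<phi> \<longleftrightarrow>
    (\<exists>K. coupling_kernel \<Lambda> y i j K \<and>
      ae_pairs (coord_law i \<Lambda> y) (\<lambda>x x'.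
        (\<integral>\<^sup>+ p. ennreal (d j (fst p) (snd p)) \<partial>K (x, x')) \<le> ennreal (\<phi> * d i x x')))"

definition influence_matrix ::
    "nat set \<Rightarrow> (nat \<Rightarrow> 'a) \<Rightarrow> (nat \<Rightarrow> nat \<Rightarrow> real) \<Rightarrow> bool" where
  "influence_matrix \<Lambda> y \<Phi> \<longleftrightarrow>
    (\<exists>d. dist_family \<Lambda> y d \<and>
      (\<forall>i \<in> compl \<Lambda>. \<Phi> i i = 0) \<and>
      (\<forall>i \<in> compl \<Lambda>. \<forall>j \<in> compl \<Lambda>. i \<noteq> j \<longrightarrow> 0 \<le> \<Phi> i j \<and> contraction \<Lambda> y d i j (\<Phi> i j)))"

definition spectrally_independent :: "nat \<Rightarrow> (nat \<Rightarrow> real) \<Rightarrow> bool" where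
  "spectrally_independent l \<eta> \<longleftrightarrow>
    (\<forall>m \<in> {l+1..n}. \<forall>\<Lambda>. \<Lambda> \<subseteq> {1..n} \<and> card \<Lambda> = n - m \<longrightarrow>
      (\<forall>y \<in> pos_points \<Lambda>. \<exists>\<Phi>. influence_matrix \<Lambda> y \<Phi> \<and> matrix_radius (compl \<Lambda>) \<Phi> \<le> \<eta> m))"

end

end

theory Submission
  imports Defs
begin

text \<open>
  For a block \<open>\<Gamma>\<close> of coordinates let \<open>E\<^sub>\<Gamma>\<close> denote the conditional expectation given the coordinates
  outside \<open>\<Gamma>\<close>. Fix a set \<open>S\<close> of \<open>m\<close> free coordinates and a regular value of the others; \<open>\<nu>\<close> is the
  conditional law. The Gibbs sampler with block size \<open>l\<close> is the average \<open>P\<close> of the orthogonal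
  projections \<open>E\<^sub>\<Gamma>\<close> over the blocks \<open>\<Gamma> \<subseteq> S\<close> of size \<open>l\<close>. It is self-adjoint and nonnegative, so its
  spectral gap is at least \<open>\<gamma>\<close> as soon as the Poincare inequality
  \<open>\<gamma> Var f \<le> average of \<integral> (f\<^sup>2 - (E\<^sub>\<Gamma> f)\<^sup>2) d\<nu>\<close> holds. It suffices to prove that inequality for bounded
  \<open>f\<close>; truncation and Fatou's lemma give the contraction on all square-integrable functions
  (\<open>poincare_contraction\<close>, \<open>contraction_L2\<close>, \<open>gap_ge\<close>).
  
  Poincare constants multiply: if \<open>\<gamma>\<close> works for \<open>m - 1\<close> free coordinates and block size \<open>l\<close>, and \<open>g\<close>
  for \<open>m\<close> free coordinates and block size \<open>m - 1\<close>, then \<open>\<gamma> g\<close> works for \<open>m\<close> free coordinates and block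
  size \<open>l\<close>. Indeed a uniform block of size \<open>l\<close> of \<open>S\<close> may be drawn by first removing a uniform
  coordinate \<open>i\<close>, and the tower property lets one apply the first inequality conditionally on \<open>X\<^sub>i\<close>
  (\<open>poincare_step\<close>). This reduces everything to block size \<open>m - 1\<close>.
  
  For block size \<open>m - 1\<close> each update keeps one coordinate of \<open>S\<close>, so \<open>E\<^bsub>S-{i}\<^esub> f\<close> minus its mean is a function
  \<open>u\<^sub>i\<close> of \<open>X\<^sub>i\<close>. Consider families \<open>u = (u\<^sub>i)\<close> of centred functions of one coordinate, with
  \<open>\<parallel>u\<parallel>\<^sup>2 = \<Sum> \<integral> u\<^sub>i\<^sup>2\<close>, and the symmetric operator \<open>(A u)\<^sub>i(a) = \<Sum>\<^bsub>j \<noteq> i\<^esub> E[u\<^sub>j(X\<^sub>j) | X\<^sub>i = a]\<close>. Then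
  \<open>\<integral> (\<Sum> u\<^sub>i)\<^sup>2 = \<parallel>u\<parallel>\<^sup>2 + \<langle>u, A u\<rangle>\<close>, and the claim is that \<open>\<langle>u, A u\<rangle> \<le> \<eta> \<parallel>u\<parallel>\<^sup>2\<close>. For bounded \<open>u\<close> the
  total variation bound makes \<open>A u\<close> Lipschitz; the couplings show that a family with Lipschitz
  constants \<open>L\<close> is mapped to one with constants \<open>\<Phi> L\<close>; and Lipschitz centred functions are bounded in
  \<open>L\<^sup>2\<close> by the moment condition. Hence \<open>\<parallel>A\<^sup>t u\<parallel> \<le> C \<rho>\<^sup>t\<close> for every \<open>\<rho>\<close> above the spectral radius of \<open>\<Phi>\<close>.
  By symmetry of \<open>A\<close> the sequence \<open>\<parallel>A\<^sup>t u\<parallel>\<^sup>2 / \<rho>\<^bsup>2t\<^esup>\<close> is convex; being bounded it decreases, so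
  \<open>\<parallel>A u\<parallel> \<le> \<rho> \<parallel>u\<parallel>\<close> (\<open>influence_quadratic\<close>). Only bounded functions are needed, and no operator theory.
\<close>

section \<open>The conditional law of a block of coordinates\<close>

context gibbs_setting
begin

(* Otherwise the simplifier turns the index set {1..n} into {Suc 0..n}. *)
declare One_nat_def [simp del]

abbreviation full_space :: "(nat \<Rightarrow> 'a) measure" where
  "full_space \<equiv> PiM {1..n} M"

text \<open>
  The point \<open>x\<close> with its coordinates in \<open>\<Gamma>\<close> replaced by those of \<open>w\<close>.
\<close>

definition override :: "nat set \<Rightarrow> (nat \<Rightarrow> 'a) \<Rightarrow> (nat \<Rightarrow> 'a) \<Rightarrow> (nat \<Rightarrow> 'a)" where
  "override \<Gamma> w x = merge \<Gamma> (compl \<Gamma>) (w, x)"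

lemma override_apply: "override \<Gamma> w x k = (if k \<in> \<Gamma> then w k else if k \<in> {1..n} then x k else undefined)"
  by (simp add: override_def merge_def)

lemma override_space:
  assumes "\<Gamma> \<subseteq> {1..n}" "w \<in> space (PiM \<Gamma> M)" "x \<in> space full_space"
  shows "override \<Gamma> w x \<in> space full_space"
  using assms by (auto simp: space_PiM PiE_def Pi_def extensional_def override_apply subset_iff)

lemma override_measurable2:
  assumes "\<Gamma> \<subseteq> {1..n}"
  shows "(\<lambda>(x, w). override \<Gamma> w x) \<in> full_space \<Otimes>\<^sub>M PiM \<Gamma> M \<rightarrow>\<^sub>M full_space"
proof (rule measurable_PiM_single')
  fix i assume i: "i \<in> {1..n}"
  show "(\<lambda>p. (case p of (x, w) \<Rightarrow> override \<Gamma> w x) i) \<in> full_space \<Otimes>\<^sub>M PiM \<Gamma> M \<rightarrow>\<^sub>M M i"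
  proof (cases "i \<in> \<Gamma>")
    case True
    then show ?thesis by (simp add: override_apply split_beta')
  next
    case False
    with i show ?thesis by (simp add: override_apply split_beta')
  qed
next
  show "(\<lambda>p i. (case p of (x, w) \<Rightarrow> override \<Gamma> w x) i) \<in> space (full_space \<Otimes>\<^sub>M PiM \<Gamma> M) \<rightarrow> (\<Pi>\<^sub>E i\<in>{1..n}. space (M i))"
    using override_space[OF assms] by (auto simp: space_pair_measure space_PiM)
qed

lemma override_measurable:
  assumes "\<Gamma> \<subseteq> {1..n}" "x \<in> space full_space"
  shows "(\<lambda>w. override \<Gamma> w x) \<in> PiM \<Gamma> M \<rightarrow>\<^sub>M full_space"
  using measurable_compose[OF measurable_Pair1'[OF assms(2)] override_measurable2[OF assms(1)]] by simp

text \<open>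
  The locale for products of \<open>\<sigma>\<close>-finite measures asks for \<open>\<sigma>\<close>-finiteness at every index. \<open>M_total\<close> agrees
  with \<open>M\<close> on \<open>{1..n}\<close>, the only indices that matter, and is a one-point space elsewhere.
\<close>

definition M_total :: "nat \<Rightarrow> 'a measure" where
  "M_total i = (if i \<in> {1..n} then M i else count_space {undefined})"

lemma product_sigma_finite_M_total: "product_sigma_finite M_total"
proof (rule product_sigma_finite.intro)
  fix i show "sigma_finite_measure (M_total i)"
    using sigma_finite by (auto simp: M_total_def intro: sigma_finite_measure_count_space_finite)
qed

lemma PiM_M_total: "J \<subseteq> {1..n} \<Longrightarrow> PiM J M_total = PiM J M"
  by (rule PiM_cong) (auto simp: M_total_def)

lemma sigma_finite_PiM: "J \<subseteq> {1..n} \<Longrightarrow> sigma_finite_measure (PiM J M)"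
  using product_sigma_finite.sigma_finite[OF product_sigma_finite_M_total, of J]
  by (simp add: PiM_M_total finite_subset)

lemma nn_integral_PiM_Un:
  assumes "J \<inter> K = {}" "J \<subseteq> {1..n}" "K \<subseteq> {1..n}" "f \<in> borel_measurable (PiM (J \<union> K) M)"
  shows "(\<integral>\<^sup>+ x. f x \<partial>PiM (J \<union> K) M) = (\<integral>\<^sup>+ x. \<integral>\<^sup>+ y. f (merge J K (x, y)) \<partial>PiM K M \<partial>PiM J M)"
  using product_sigma_finite.product_nn_integral_fold[OF product_sigma_finite_M_total, of J K f] assms
  by (simp add: PiM_M_total finite_subset[OF _ finite_atLeastAtMost[of 1 n]])

lemma nn_integral_PiM_singleton:
  assumes "i \<in> {1..n}" "f \<in> borel_measurable (M i)"
  shows "(\<integral>\<^sup>+ x. f (x i) \<partial>PiM {i} M) = (\<integral>\<^sup>+ x. f x \<partial>M i)"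
  using product_sigma_finite.product_nn_integral_singleton[OF product_sigma_finite_M_total, of f i] assms
  by (simp add: PiM_M_total M_total_def)

lemma nn_integral_PiM_empty: "(\<integral>\<^sup>+ x. f x \<partial>PiM {} M) = f (\<lambda>k. undefined)"
  by (simp add: PiM_empty nn_integral_count_space_finite)

lemma density_measurable_override:
  assumes "\<Gamma> \<subseteq> {1..n}" "x \<in> space full_space"
  shows "(\<lambda>w. \<pi> (override \<Gamma> w x)) \<in> borel_measurable (PiM \<Gamma> M)"
  using measurable_compose[OF override_measurable[OF assms] density_measurable] .

text \<open>
  The integral of the density over the block \<open>\<Gamma>\<close>, the other coordinates being those of \<open>x\<close>. It is the
  marginal density of the coordinates outside \<open>\<Gamma>\<close>, except that it is \<open>\<infinity>\<close>, not \<open>0\<close>, where the integral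
  diverges.
\<close>

definition block_mass :: "nat set \<Rightarrow> (nat \<Rightarrow> 'a) \<Rightarrow> ennreal" where
  "block_mass \<Gamma> x = (\<integral>\<^sup>+ w. ennreal (\<pi> (override \<Gamma> w x)) \<partial>PiM \<Gamma> M)"

text \<open>
  The points at which one may condition on the coordinates outside \<open>\<Gamma>\<close>.
\<close>

definition regular :: "nat set \<Rightarrow> (nat \<Rightarrow> 'a) set" where
  "regular \<Gamma> = {x \<in> space full_space. 0 < block_mass \<Gamma> x \<and> block_mass \<Gamma> x < \<infinity>}"

text \<open>
  The conditional law of the full vector given the coordinates outside \<open>\<Gamma>\<close>, as a kernel on the full
  product space. At points that are not regular it is the Dirac mass instead of the arbitrary default
  density; this makes it measurable everywhere, and it changes nothing almost surely.
\<close>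

definition cond_ker :: "nat set \<Rightarrow> (nat \<Rightarrow> 'a) \<Rightarrow> (nat \<Rightarrow> 'a) measure" where
  "cond_ker \<Gamma> x = (if x \<in> regular \<Gamma>
     then distr (density (PiM \<Gamma> M) (\<lambda>w. ennreal (\<pi> (override \<Gamma> w x)) / block_mass \<Gamma> x)) full_space (\<lambda>w. override \<Gamma> w x)
     else return full_space x)"

lemma regularD: "x \<in> regular \<Gamma> \<Longrightarrow> x \<in> space full_space" "x \<in> regular \<Gamma> \<Longrightarrow> 0 < block_mass \<Gamma> x"
  "x \<in> regular \<Gamma> \<Longrightarrow> block_mass \<Gamma> x < \<infinity>" "x \<in> regular \<Gamma> \<Longrightarrow> block_mass \<Gamma> x \<noteq> 0" "x \<in> regular \<Gamma> \<Longrightarrow> block_mass \<Gamma> x \<noteq> \<top>"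
  by (auto simp: regular_def)

lemma borel_measurable_nn_override:
  assumes "\<Gamma> \<subseteq> {1..n}" "f \<in> borel_measurable full_space"
  shows "(\<lambda>x. \<integral>\<^sup>+ w. f (override \<Gamma> w x) \<partial>PiM \<Gamma> M) \<in> borel_measurable full_space"
proof -
  interpret sigma_finite_measure "PiM \<Gamma> M" using sigma_finite_PiM[OF assms(1)] .
  show ?thesis
    by (rule borel_measurable_nn_integral)
      (use measurable_compose[OF override_measurable2[OF assms(1)] assms(2)] in \<open>simp add: split_beta'\<close>)
qed

lemma block_mass_measurable: "\<Gamma> \<subseteq> {1..n} \<Longrightarrow> block_mass \<Gamma> \<in> borel_measurable full_space"
  unfolding block_mass_def using density_measurable by (intro borel_measurable_nn_override) auto

lemma regular_sets: "\<Gamma> \<subseteq> {1..n} \<Longrightarrow> regular \<Gamma> \<in> sets full_space"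
  unfolding regular_def using block_mass_measurable[measurable] by measurable

lemma sets_cond_ker [simp]: "sets (cond_ker \<Gamma> x) = sets full_space"
  by (simp add: cond_ker_def)

lemma space_cond_ker [simp]: "space (cond_ker \<Gamma> x) = space full_space"
  by (simp add: cond_ker_def)

lemma nn_integral_cond_ker:
  assumes G: "\<Gamma> \<subseteq> {1..n}" and x: "x \<in> regular \<Gamma>" and f[measurable]: "f \<in> borel_measurable full_space"
  shows "(\<integral>\<^sup>+ z. f z \<partial>cond_ker \<Gamma> x) = (\<integral>\<^sup>+ w. f (override \<Gamma> w x) * ennreal (\<pi> (override \<Gamma> w x)) \<partial>PiM \<Gamma> M) / block_mass \<Gamma> x"
proof -
  note [measurable] = override_measurable[OF G regularD(1)[OF x]] density_measurable_override[OF G regularD(1)[OF x]]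
  have "(\<integral>\<^sup>+ z. f z \<partial>cond_ker \<Gamma> x) = (\<integral>\<^sup>+ w. (ennreal (\<pi> (override \<Gamma> w x)) / block_mass \<Gamma> x) * f (override \<Gamma> w x) \<partial>PiM \<Gamma> M)"
    using x by (simp add: cond_ker_def nn_integral_distr nn_integral_density)
  also have "\<dots> = (\<integral>\<^sup>+ w. (f (override \<Gamma> w x) * ennreal (\<pi> (override \<Gamma> w x))) / block_mass \<Gamma> x \<partial>PiM \<Gamma> M)"
    by (intro nn_integral_cong) (simp add: ennreal_times_divide mult.commute)
  also have "\<dots> = (\<integral>\<^sup>+ w. f (override \<Gamma> w x) * ennreal (\<pi> (override \<Gamma> w x)) \<partial>PiM \<Gamma> M) / block_mass \<Gamma> x"
    by (intro nn_integral_divide) simp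
  finally show ?thesis .
qed

lemma emeasure_cond_ker_space:
  assumes G: "\<Gamma> \<subseteq> {1..n}" and x: "x \<in> space full_space"
  shows "emeasure (cond_ker \<Gamma> x) (space full_space) = 1"
proof (cases "x \<in> regular \<Gamma>")
  case True
  have "emeasure (cond_ker \<Gamma> x) (space full_space) = (\<integral>\<^sup>+ z. 1 \<partial>cond_ker \<Gamma> x)"
    by simp
  also have "\<dots> = block_mass \<Gamma> x / block_mass \<Gamma> x"
    by (subst nn_integral_cond_ker[OF G True]) (auto simp: block_mass_def)
  also have "\<dots> = 1"
    using regularD[OF True] by (simp add: ennreal_divide_self)
  finally show ?thesis .
next
  case False
  then show ?thesis using x by (simp add: cond_ker_def)
qed

lemma prob_space_cond_ker: "\<Gamma> \<subseteq> {1..n} \<Longrightarrow> x \<in> space full_space \<Longrightarrow> prob_space (cond_ker \<Gamma> x)"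
  by (rule prob_spaceI) (simp add: emeasure_cond_ker_space)

lemma cond_ker_measurable:
  assumes G: "\<Gamma> \<subseteq> {1..n}"
  shows "cond_ker \<Gamma> \<in> full_space \<rightarrow>\<^sub>M subprob_algebra full_space"
proof (rule measurable_subprob_algebra)
  show "subprob_space (cond_ker \<Gamma> x)" if "x \<in> space full_space" for x
    using prob_space_cond_ker[OF G that] by (rule prob_space_imp_subprob_space)
  show "sets (cond_ker \<Gamma> x) = sets full_space" for x by simp
  fix A assume A[measurable]: "A \<in> sets full_space"
  note [measurable] = block_mass_measurable[OF G] regular_sets[OF G] density_measurable
  have [measurable]: "(\<lambda>x. \<integral>\<^sup>+ w. indicator A (override \<Gamma> w x) * ennreal (\<pi> (override \<Gamma> w x)) \<partial>PiM \<Gamma> M)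
      \<in> borel_measurable full_space"
    by (rule borel_measurable_nn_override[OF G, of "\<lambda>z. indicator A z * ennreal (\<pi> z)"]) measurable
  have eq: "emeasure (cond_ker \<Gamma> x) A = (if x \<in> regular \<Gamma>
      then (\<integral>\<^sup>+ w. indicator A (override \<Gamma> w x) * ennreal (\<pi> (override \<Gamma> w x)) \<partial>PiM \<Gamma> M) / block_mass \<Gamma> x else indicator A x)"
    if "x \<in> space full_space" for x
  proof (cases "x \<in> regular \<Gamma>")
    case True
    have "emeasure (cond_ker \<Gamma> x) A = (\<integral>\<^sup>+ z. indicator A z \<partial>cond_ker \<Gamma> x)" by simp
    with True show ?thesis by (simp add: nn_integral_cond_ker[OF G True] del: nn_integral_indicator)
  next
    case False
    then show ?thesis using that by (simp add: cond_ker_def)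
  qed
  show "(\<lambda>x. emeasure (cond_ker \<Gamma> x) A) \<in> borel_measurable full_space"
    by (subst measurable_cong[OF eq]) measurable
qed

lemma override_override:
  assumes "S \<subseteq> {1..n}" "\<Gamma> \<subseteq> S"
  shows "override S (merge (S - \<Gamma>) \<Gamma> (t, g)) x = override \<Gamma> g (override (S - \<Gamma>) t x)"
  using assms by (auto simp: fun_eq_iff override_apply merge_def subset_iff)

text \<open>
  Integrating over the block \<open>S\<close> by integrating over \<open>\<Gamma> \<subseteq> S\<close> first.
\<close>

lemma nn_integral_split:
  assumes S: "S \<subseteq> {1..n}" and G: "\<Gamma> \<subseteq> S" and x: "x \<in> space full_space"
    and f: "f \<in> borel_measurable full_space"
  shows "(\<integral>\<^sup>+ w. f (override S w x) \<partial>PiM S M)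
    = (\<integral>\<^sup>+ t. \<integral>\<^sup>+ g. f (override \<Gamma> g (override (S - \<Gamma>) t x)) \<partial>PiM \<Gamma> M \<partial>PiM (S - \<Gamma>) M)"
proof -
  have S': "S = (S - \<Gamma>) \<union> \<Gamma>" using G by auto
  have "(\<lambda>w. f (override S w x)) \<in> borel_measurable (PiM S M)"
    using measurable_compose[OF override_measurable[OF S x] f] .
  then have "(\<integral>\<^sup>+ w. f (override S w x) \<partial>PiM ((S - \<Gamma>) \<union> \<Gamma>) M)
     = (\<integral>\<^sup>+ t. \<integral>\<^sup>+ g. f (override S (merge (S - \<Gamma>) \<Gamma> (t, g)) x) \<partial>PiM \<Gamma> M \<partial>PiM (S - \<Gamma>) M)"
    using S G by (intro nn_integral_PiM_Un) (auto simp: Un_absorb2)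
  then show ?thesis
    unfolding override_override[OF S G] using S' by simp
qed

lemma block_mass_split:
  assumes S: "S \<subseteq> {1..n}" and G: "\<Gamma> \<subseteq> S" and x: "x \<in> space full_space"
  shows "block_mass S x = (\<integral>\<^sup>+ t. block_mass \<Gamma> (override (S - \<Gamma>) t x) \<partial>PiM (S - \<Gamma>) M)"
  unfolding block_mass_def
  by (rule nn_integral_split[OF S G x]) (use density_measurable in simp)

lemma AE_block_mass_finite:
  assumes S: "S \<subseteq> {1..n}" and G: "\<Gamma> \<subseteq> S" and x: "x \<in> regular S"
  shows "AE t in PiM (S - \<Gamma>) M. block_mass \<Gamma> (override (S - \<Gamma>) t x) \<noteq> \<infinity>"
proof (rule nn_integral_PInf_AE)
  show "(\<lambda>t. block_mass \<Gamma> (override (S - \<Gamma>) t x)) \<in> borel_measurable (PiM (S - \<Gamma>) M)"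
    using measurable_compose[OF override_measurable block_mass_measurable] S G regularD(1)[OF x]
    by (metis Diff_subset order_trans)
  show "(\<integral>\<^sup>+ t. block_mass \<Gamma> (override (S - \<Gamma>) t x) \<partial>PiM (S - \<Gamma>) M) \<noteq> \<infinity>"
    using block_mass_split[OF S G regularD(1)[OF x]] regularD[OF x] by simp
qed

lemma override_same: "override \<Gamma> g (override \<Gamma> g' x) = override \<Gamma> g x"
  by (auto simp: fun_eq_iff override_apply)

lemma block_mass_override: "block_mass \<Gamma> (override \<Gamma> g x) = block_mass \<Gamma> x"
  by (simp add: block_mass_def override_same)

lemma cond_ker_override:
  assumes "\<Gamma> \<subseteq> {1..n}" "x \<in> regular \<Gamma>" "g \<in> space (PiM \<Gamma> M)"
  shows "cond_ker \<Gamma> (override \<Gamma> g x) = cond_ker \<Gamma> x" "override \<Gamma> g x \<in> regular \<Gamma>"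
proof -
  show "override \<Gamma> g x \<in> regular \<Gamma>"
    using assms regularD[OF assms(2)] by (auto simp: regular_def block_mass_override override_space)
  then show "cond_ker \<Gamma> (override \<Gamma> g x) = cond_ker \<Gamma> x"
    using assms by (simp add: cond_ker_def block_mass_override override_same)
qed

text \<open>
  The conditional law depends only on the coordinates outside the block.
\<close>

lemma regular_cong:
  assumes "x \<in> regular \<Gamma>" "x' \<in> space full_space" "\<And>k. k \<in> compl \<Gamma> \<Longrightarrow> x' k = x k"
  shows "x' \<in> regular \<Gamma>" "cond_ker \<Gamma> x' = cond_ker \<Gamma> x"
proof -
  have *: "override \<Gamma> g x' = override \<Gamma> g x" for g
    using assms(3) by (auto simp: fun_eq_iff override_apply)
  show "x' \<in> regular \<Gamma>" using assms by (auto simp: regular_def block_mass_def *)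
  then show "cond_ker \<Gamma> x' = cond_ker \<Gamma> x" using assms by (simp add: cond_ker_def block_mass_def *)
qed

text \<open>
  The tower property: resampling \<open>\<Gamma> \<subseteq> S\<close> leaves the conditional law of the block \<open>S\<close> invariant.
\<close>

lemma nn_integral_cond_ker_cond_ker:
  assumes S: "S \<subseteq> {1..n}" and G: "\<Gamma> \<subseteq> S" and x: "x \<in> regular S"
    and f[measurable]: "f \<in> borel_measurable full_space"
  shows "(\<integral>\<^sup>+ z. (\<integral>\<^sup>+ z'. f z' \<partial>cond_ker \<Gamma> z) \<partial>cond_ker S x) = (\<integral>\<^sup>+ z. f z \<partial>cond_ker S x)"
proof -
  note [measurable] = density_measurable
  have xs: "x \<in> space full_space" using regularD(1)[OF x] .
  have GI: "\<Gamma> \<subseteq> {1..n}" using S G by auto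
  let ?H = "\<lambda>z. \<integral>\<^sup>+ z'. f z' \<partial>cond_ker \<Gamma> z"
  have H[measurable]: "?H \<in> borel_measurable full_space"
    using measurable_compose[OF cond_ker_measurable[OF GI] nn_integral_measurable_subprob_algebra[OF f]] .
  have "(\<integral>\<^sup>+ w. ?H (override S w x) * ennreal (\<pi> (override S w x)) \<partial>PiM S M)
     = (\<integral>\<^sup>+ t. \<integral>\<^sup>+ g. ?H (override \<Gamma> g (override (S - \<Gamma>) t x)) * ennreal (\<pi> (override \<Gamma> g (override (S - \<Gamma>) t x)))
         \<partial>PiM \<Gamma> M \<partial>PiM (S - \<Gamma>) M)"
    by (rule nn_integral_split[OF S G xs]) measurable
  also have "\<dots> = (\<integral>\<^sup>+ t. \<integral>\<^sup>+ g. f (override \<Gamma> g (override (S - \<Gamma>) t x)) * ennreal (\<pi> (override \<Gamma> g (override (S - \<Gamma>) t x)))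
         \<partial>PiM \<Gamma> M \<partial>PiM (S - \<Gamma>) M)"
  proof (rule nn_integral_cong_AE)
    show "AE t in PiM (S - \<Gamma>) M.
       (\<integral>\<^sup>+ g. ?H (override \<Gamma> g (override (S - \<Gamma>) t x)) * ennreal (\<pi> (override \<Gamma> g (override (S - \<Gamma>) t x))) \<partial>PiM \<Gamma> M)
       = (\<integral>\<^sup>+ g. f (override \<Gamma> g (override (S - \<Gamma>) t x)) * ennreal (\<pi> (override \<Gamma> g (override (S - \<Gamma>) t x))) \<partial>PiM \<Gamma> M)"
      using AE_block_mass_finite[OF S G x] AE_space
    proof eventually_elim
      case (elim t)
      let ?y = "override (S - \<Gamma>) t x"
      have y: "?y \<in> space full_space"
        using S elim xs by (intro override_space) auto
      note [measurable] = override_measurable[OF GI y]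
      show ?case
      \<comment> \<open>If the mass vanishes then so does \<open>\<pi>\<close> almost everywhere on the fibre, hence both sides.\<close>
      proof (cases "block_mass \<Gamma> ?y = 0")
        case True
        then have "AE g in PiM \<Gamma> M. ennreal (\<pi> (override \<Gamma> g ?y)) = 0"
          unfolding block_mass_def by (subst (asm) nn_integral_0_iff_AE) (auto)
        then show ?thesis
          by (intro nn_integral_cong_AE) auto
      next
        case False
        with elim y have r: "?y \<in> regular \<Gamma>" by (auto simp: regular_def zero_less_iff_neq_zero less_top)
        have "(\<integral>\<^sup>+ g. ?H (override \<Gamma> g ?y) * ennreal (\<pi> (override \<Gamma> g ?y)) \<partial>PiM \<Gamma> M)
          = (\<integral>\<^sup>+ g. ?H ?y * ennreal (\<pi> (override \<Gamma> g ?y)) \<partial>PiM \<Gamma> M)"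
          by (intro nn_integral_cong) (simp add: cond_ker_override[OF GI r])
        also have "\<dots> = ?H ?y * block_mass \<Gamma> ?y"
          unfolding block_mass_def by (intro nn_integral_cmult) measurable
        also have "\<dots> = (\<integral>\<^sup>+ g. f (override \<Gamma> g ?y) * ennreal (\<pi> (override \<Gamma> g ?y)) \<partial>PiM \<Gamma> M)"
          using regularD[OF r] by (simp add: nn_integral_cond_ker[OF GI r f] ennreal_divide_times
            mult_divide_eq_ennreal)
        finally show ?thesis .
      qed
    qed
  qed
  also have "\<dots> = (\<integral>\<^sup>+ w. f (override S w x) * ennreal (\<pi> (override S w x)) \<partial>PiM S M)"
    by (rule nn_integral_split[OF S G xs, symmetric]) measurable
  finally show ?thesis
    by (simp add: nn_integral_cond_ker[OF S x f] nn_integral_cond_ker[OF S x H])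
qed

text \<open>
  Almost every point drawn with the block \<open>S\<close> resampled is regular for each subblock.
\<close>

lemma AE_cond_ker_regular:
  assumes S: "S \<subseteq> {1..n}" and G: "\<Gamma> \<subseteq> S" and x: "x \<in> regular S"
  shows "AE z in cond_ker S x. z \<in> regular \<Gamma>"
proof -
  note [measurable] = density_measurable
  have xs: "x \<in> space full_space" using regularD(1)[OF x] .
  have GI: "\<Gamma> \<subseteq> {1..n}" using S G by auto
  note [measurable] = regular_sets[OF GI]
  let ?f = "\<lambda>z. indicator (space full_space - regular \<Gamma>) z :: ennreal"
  have "(\<integral>\<^sup>+ w. ?f (override S w x) * ennreal (\<pi> (override S w x)) \<partial>PiM S M)
     = (\<integral>\<^sup>+ t. \<integral>\<^sup>+ g. ?f (override \<Gamma> g (override (S - \<Gamma>) t x)) * ennreal (\<pi> (override \<Gamma> g (override (S - \<Gamma>) t x)))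
         \<partial>PiM \<Gamma> M \<partial>PiM (S - \<Gamma>) M)"
    by (rule nn_integral_split[OF S G xs]) measurable
  also have "\<dots> = (\<integral>\<^sup>+ t. 0 \<partial>PiM (S - \<Gamma>) M)"
  proof (rule nn_integral_cong_AE)
    show "AE t in PiM (S - \<Gamma>) M.
       (\<integral>\<^sup>+ g. ?f (override \<Gamma> g (override (S - \<Gamma>) t x)) * ennreal (\<pi> (override \<Gamma> g (override (S - \<Gamma>) t x))) \<partial>PiM \<Gamma> M) = 0"
      using AE_block_mass_finite[OF S G x] AE_space
    proof eventually_elim
      case (elim t)
      let ?y = "override (S - \<Gamma>) t x"
      have y: "?y \<in> space full_space"
        using S elim xs by (intro override_space) auto
      note [measurable] = override_measurable[OF GI y]
      show ?case
      proof (cases "block_mass \<Gamma> ?y = 0")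
        case True
        then have "AE g in PiM \<Gamma> M. ennreal (\<pi> (override \<Gamma> g ?y)) = 0"
          unfolding block_mass_def by (subst (asm) nn_integral_0_iff_AE) (auto)
        then have "(\<integral>\<^sup>+ g. ?f (override \<Gamma> g ?y) * ennreal (\<pi> (override \<Gamma> g ?y)) \<partial>PiM \<Gamma> M) = (\<integral>\<^sup>+ g. 0 \<partial>PiM \<Gamma> M)"
          by (intro nn_integral_cong_AE) auto
        then show ?thesis by simp
      next
        case False
        with elim y have r: "?y \<in> regular \<Gamma>" by (auto simp: regular_def zero_less_iff_neq_zero less_top)
        have "(\<integral>\<^sup>+ g. ?f (override \<Gamma> g ?y) * ennreal (\<pi> (override \<Gamma> g ?y)) \<partial>PiM \<Gamma> M) = (\<integral>\<^sup>+ g. 0 \<partial>PiM \<Gamma> M)"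
          by (intro nn_integral_cong) (simp add: cond_ker_override[OF GI r])
        then show ?thesis by simp
      qed
    qed
  qed
  finally have "(\<integral>\<^sup>+ z. ?f z \<partial>cond_ker S x) = 0"
    using regular_sets[OF GI] by (subst nn_integral_cond_ker[OF S x]) simp_all
  then have "emeasure (cond_ker S x) (space full_space - regular \<Gamma>) = 0"
    using regular_sets[OF GI] by simp
  then show ?thesis
    using regular_sets[OF GI] by (subst AE_iff_measurable[of "space full_space - regular \<Gamma>"]) auto
qed

lemma AE_cond_ker_off:
  assumes S: "S \<subseteq> {1..n}" and x: "x \<in> regular S" 
    and P: "\<And>w. w \<in> space (PiM S M) \<Longrightarrow> P (override S w x)" and mP: "Measurable.pred full_space P"
  shows "AE z in cond_ker S x. P z"
proof -
  let ?N = "density (PiM S M) (\<lambda>w. ennreal (\<pi> (override S w x)) / block_mass S x)"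
  have m: "(\<lambda>w. override S w x) \<in> ?N \<rightarrow>\<^sub>M full_space"
    using override_measurable[OF S regularD(1)[OF x]] by simp
  have "AE w in ?N. P (override S w x)"
    by (rule AE_I2) (simp add: P)
  moreover have "{z \<in> space full_space. P z} \<in> sets full_space"
    using mP by (simp add: pred_def)
  ultimately have "AE z in distr ?N full_space (\<lambda>w. override S w x). P z"
    using AE_distr_iff[OF m, of P] by simp
  moreover have "cond_ker S x = distr ?N full_space (\<lambda>w. override S w x)"
    using x by (simp add: cond_ker_def)
  ultimately show ?thesis by (simp only:)
qed

section \<open>Conditional expectations of bounded functions\<close>

text \<open>
  Bounded measurable functions on the full product space.
\<close>

definition bdd_meas :: "((nat \<Rightarrow> 'a) \<Rightarrow> real) \<Rightarrow> bool" where
  "bdd_meas F \<longleftrightarrow> F \<in> borel_measurable full_space \<and> (\<exists>B. \<forall>x \<in> space full_space. \<bar>F x\<bar> \<le> B)"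

lemma bdd_measI: "F \<in> borel_measurable full_space \<Longrightarrow> (\<And>x. x \<in> space full_space \<Longrightarrow> \<bar>F x\<bar> \<le> B) \<Longrightarrow> bdd_meas F"
  by (auto simp: bdd_meas_def)

lemma bdd_measD: "bdd_meas F \<Longrightarrow> F \<in> borel_measurable full_space"
  by (simp add: bdd_meas_def)

lemma bdd_meas_bound:
  assumes "bdd_meas F" obtains B where "B \<ge> 0" "\<And>x. x \<in> space full_space \<Longrightarrow> \<bar>F x\<bar> \<le> B"
proof -
  from assms obtain B where "\<forall>x \<in> space full_space. \<bar>F x\<bar> \<le> B" by (auto simp: bdd_meas_def)
  then show ?thesis by (intro that[of "max B 0"]) (auto simp: le_max_iff_disj)
qed

lemma bdd_meas_const: "bdd_meas (\<lambda>_. c)"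
  by (rule bdd_measI[of _ "\<bar>c\<bar>"]) auto

lemma bdd_meas_add: assumes "bdd_meas F" "bdd_meas G" shows "bdd_meas (\<lambda>x. F x + G x)"
proof -
  obtain A B where "\<And>x. x \<in> space full_space \<Longrightarrow> \<bar>F x\<bar> \<le> A" "\<And>x. x \<in> space full_space \<Longrightarrow> \<bar>G x\<bar> \<le> B"
    using assms bdd_meas_bound by metis
  then have "\<bar>F x + G x\<bar> \<le> A + B" if "x \<in> space full_space" for x
    using that by (meson abs_triangle_ineq add_mono order_trans)
  then show ?thesis
    using assms[THEN bdd_measD] by (intro bdd_measI[of _ "A + B"]) auto
qed

lemma bdd_meas_mult: assumes "bdd_meas F" "bdd_meas G" shows "bdd_meas (\<lambda>x. F x * G x)"
proof -
  obtain A B where *: "A \<ge> 0" "\<And>x. x \<in> space full_space \<Longrightarrow> \<bar>F x\<bar> \<le> A" "\<And>x. x \<in> space full_space \<Longrightarrow> \<bar>G x\<bar> \<le> B"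
    using assms bdd_meas_bound by metis
  then have "\<bar>F x * G x\<bar> \<le> A * B" if "x \<in> space full_space" for x
    using that by (auto simp: abs_mult intro!: mult_mono)
  then show ?thesis
    using assms[THEN bdd_measD] by (intro bdd_measI[of _ "A * B"]) auto
qed

lemma bdd_meas_power2: "bdd_meas F \<Longrightarrow> bdd_meas (\<lambda>x. (F x)\<^sup>2)"
  unfolding power2_eq_square by (rule bdd_meas_mult)

lemma bdd_meas_diff: "bdd_meas F \<Longrightarrow> bdd_meas G \<Longrightarrow> bdd_meas (\<lambda>x. F x - G x)"
  using bdd_meas_add[of F "\<lambda>x. -1 * G x"] bdd_meas_mult[OF bdd_meas_const, of G "-1"] by simp

lemma bdd_meas_divide: "bdd_meas F \<Longrightarrow> bdd_meas (\<lambda>x. F x / c)"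
  using bdd_meas_mult[OF bdd_meas_const, of F "1 / c"] by simp

lemma bdd_meas_sum: "(\<And>i. i \<in> A \<Longrightarrow> bdd_meas (f i)) \<Longrightarrow> bdd_meas (\<lambda>x. \<Sum>i\<in>A. f i x)"
  by (induction A rule: infinite_finite_induct) (auto intro: bdd_meas_const bdd_meas_add)

lemmas bdd_meas_intros = bdd_meas_const bdd_meas_add bdd_meas_mult bdd_meas_power2 bdd_meas_diff bdd_meas_divide bdd_meas_sum

text \<open>
  \<open>cexp \<Gamma> F x\<close> is the conditional expectation \<open>E\<^sub>\<Gamma> F\<close> at \<open>x\<close>. For \<open>x\<close> regular for \<open>S\<close>, the same notation
  \<open>cexp S F x\<close> is also the integral of \<open>F\<close> against the conditional law of the block \<open>S\<close>, and is used in
  this way throughout.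
\<close>

definition cexp :: "nat set \<Rightarrow> ((nat \<Rightarrow> 'a) \<Rightarrow> real) \<Rightarrow> (nat \<Rightarrow> 'a) \<Rightarrow> real" where
  "cexp \<Gamma> F x = (\<integral> z. F z \<partial>cond_ker \<Gamma> x)"

lemma integrable_cond_ker:
  assumes "\<Gamma> \<subseteq> {1..n}" "x \<in> space full_space" "bdd_meas F"
  shows "integrable (cond_ker \<Gamma> x) F"
proof -
  interpret prob_space "cond_ker \<Gamma> x" using prob_space_cond_ker[OF assms(1,2)] .
  obtain B where B: "\<And>z. z \<in> space full_space \<Longrightarrow> \<bar>F z\<bar> \<le> B" using bdd_meas_bound[OF assms(3)] by metis
  show ?thesis
    by (rule integrable_const_bound[of _ B])
      (use B bdd_measD[OF assms(3)] in \<open>auto simp: measurable_cong_sets[OF sets_cond_ker refl]\<close>)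
qed

lemma cexp_abs_le:
  assumes "\<Gamma> \<subseteq> {1..n}" "x \<in> space full_space" "\<And>z. z \<in> space full_space \<Longrightarrow> \<bar>F z\<bar> \<le> B" "bdd_meas F"
  shows "\<bar>cexp \<Gamma> F x\<bar> \<le> B"
proof -
  interpret prob_space "cond_ker \<Gamma> x" using prob_space_cond_ker[OF assms(1,2)] .
  have "\<bar>cexp \<Gamma> F x\<bar> \<le> (\<integral> z. \<bar>F z\<bar> \<partial>cond_ker \<Gamma> x)"
    unfolding cexp_def by (rule integral_abs_bound)
  also have "\<dots> \<le> (\<integral> z. B \<partial>cond_ker \<Gamma> x)"
    using integrable_cond_ker[OF assms(1,2,4)] assms(3) by (intro integral_mono) auto
  also have "\<dots> = B" by (simp add: prob_space del: space_cond_ker)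
  finally show ?thesis .
qed

lemma cexp_measurable:
  assumes "\<Gamma> \<subseteq> {1..n}" "F \<in> borel_measurable full_space"
  shows "cexp \<Gamma> F \<in> borel_measurable full_space"
  unfolding cexp_def
  using measurable_compose[OF cond_ker_measurable[OF assms(1)] integral_measurable_subprob_algebra[OF assms(2)]] .

lemma bdd_meas_cexp: assumes "\<Gamma> \<subseteq> {1..n}" "bdd_meas F" shows "bdd_meas (cexp \<Gamma> F)"
proof -
  obtain B where B: "\<And>z. z \<in> space full_space \<Longrightarrow> \<bar>F z\<bar> \<le> B" using bdd_meas_bound[OF assms(2)] by metis
  then show ?thesis
    using cexp_abs_le[OF assms(1) _ B assms(2)] cexp_measurable[OF assms(1) bdd_measD[OF assms(2)]]
    by (intro bdd_measI[of _ B]) auto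
qed

lemma cexp_const:
  assumes "\<Gamma> \<subseteq> {1..n}" "x \<in> space full_space" shows "cexp \<Gamma> (\<lambda>_. c) x = c"
proof -
  interpret prob_space "cond_ker \<Gamma> x" using prob_space_cond_ker[OF assms] .
  show ?thesis by (simp add: cexp_def prob_space del: space_cond_ker)
qed

lemma cexp_add:
  assumes "\<Gamma> \<subseteq> {1..n}" "x \<in> space full_space" "bdd_meas F" "bdd_meas G"
  shows "cexp \<Gamma> (\<lambda>z. F z + G z) x = cexp \<Gamma> F x + cexp \<Gamma> G x"
  unfolding cexp_def using integrable_cond_ker[OF assms(1,2)] assms(3,4) by (intro Bochner_Integration.integral_add) auto

lemma cexp_diff:
  assumes "\<Gamma> \<subseteq> {1..n}" "x \<in> space full_space" "bdd_meas F" "bdd_meas G"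
  shows "cexp \<Gamma> (\<lambda>z. F z - G z) x = cexp \<Gamma> F x - cexp \<Gamma> G x"
  unfolding cexp_def using integrable_cond_ker[OF assms(1,2)] assms(3,4) by (intro Bochner_Integration.integral_diff) auto

lemma cexp_cmult: "cexp \<Gamma> (\<lambda>z. c * F z) x = c * cexp \<Gamma> F x"
  by (simp add: cexp_def)

lemma cexp_sum:
  assumes "\<Gamma> \<subseteq> {1..n}" "x \<in> space full_space" "\<And>i. i \<in> A \<Longrightarrow> bdd_meas (f i)"
  shows "cexp \<Gamma> (\<lambda>z. \<Sum>i\<in>A. f i z) x = (\<Sum>i\<in>A. cexp \<Gamma> (f i) x)"
  unfolding cexp_def using integrable_cond_ker[OF assms(1,2)] assms(3) by (intro Bochner_Integration.integral_sum) auto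

lemma cexp_mono_AE:
  assumes "\<Gamma> \<subseteq> {1..n}" "x \<in> space full_space" "bdd_meas F" "bdd_meas G" "AE z in cond_ker \<Gamma> x. F z \<le> G z"
  shows "cexp \<Gamma> F x \<le> cexp \<Gamma> G x"
  unfolding cexp_def using integrable_cond_ker[OF assms(1,2)] assms(3-) by (intro integral_mono_AE) auto

lemma cexp_cong_AE:
  assumes "bdd_meas F" "bdd_meas G" "AE z in cond_ker \<Gamma> x. F z = G z"
  shows "cexp \<Gamma> F x = cexp \<Gamma> G x"
  unfolding cexp_def using assms bdd_measD[OF assms(1)] bdd_measD[OF assms(2)]
  by (intro integral_cong_AE) (auto simp: measurable_cong_sets[OF sets_cond_ker refl])

lemma cexp_nonneg: "(\<And>z. z \<in> space full_space \<Longrightarrow> 0 \<le> F z) \<Longrightarrow> 0 \<le> cexp \<Gamma> F x"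
  unfolding cexp_def by (rule integral_nonneg_AE) (auto intro: AE_I2)

lemma nn_integral_cond_ker_bdd_meas:
  assumes "\<Gamma> \<subseteq> {1..n}" "x \<in> space full_space" "bdd_meas F" "\<And>z. z \<in> space full_space \<Longrightarrow> 0 \<le> F z"
  shows "(\<integral>\<^sup>+ z. ennreal (F z) \<partial>cond_ker \<Gamma> x) = ennreal (cexp \<Gamma> F x)"
  unfolding cexp_def using integrable_cond_ker[OF assms(1-3)] assms(4)
  by (intro nn_integral_eq_integral) (auto intro: AE_I2)

lemma cexp_tower:
  assumes S: "S \<subseteq> {1..n}" and G: "\<Gamma> \<subseteq> S" and x: "x \<in> regular S" and F: "bdd_meas F"
  shows "cexp S (cexp \<Gamma> F) x = cexp S F x"
proof -
  have GI: "\<Gamma> \<subseteq> {1..n}" using S G by auto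
  have xs: "x \<in> space full_space" using regularD(1)[OF x] .
  have nonneg: "cexp S (cexp \<Gamma> H) x = cexp S H x" if H: "bdd_meas H" "\<And>z. z \<in> space full_space \<Longrightarrow> 0 \<le> H z" for H
  proof -
    have "ennreal (cexp S (cexp \<Gamma> H) x) = (\<integral>\<^sup>+ z. ennreal (cexp \<Gamma> H z) \<partial>cond_ker S x)"
      using H by (intro nn_integral_cond_ker_bdd_meas[symmetric] S xs bdd_meas_cexp GI cexp_nonneg)
    also have "\<dots> = (\<integral>\<^sup>+ z. (\<integral>\<^sup>+ z'. ennreal (H z') \<partial>cond_ker \<Gamma> z) \<partial>cond_ker S x)"
      by (intro nn_integral_cong nn_integral_cond_ker_bdd_meas[symmetric] GI H) (auto intro: H)
    also have "\<dots> = (\<integral>\<^sup>+ z. ennreal (H z) \<partial>cond_ker S x)"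
      using bdd_measD[OF H(1)] by (intro nn_integral_cond_ker_cond_ker[OF S G x]) auto
    also have "\<dots> = ennreal (cexp S H x)"
      by (intro nn_integral_cond_ker_bdd_meas S xs H)
    finally show ?thesis
      using H(2) by (subst (asm) ennreal_inj) (auto intro!: cexp_nonneg)
  qed
  obtain B where B: "\<And>z. z \<in> space full_space \<Longrightarrow> \<bar>F z\<bar> \<le> B" using bdd_meas_bound[OF F] by metis
  have "cexp S (cexp \<Gamma> (\<lambda>z. F z + B)) x = cexp S (\<lambda>z. F z + B) x"
    by (rule nonneg) (auto intro: bdd_meas_intros F dest: B)
  moreover have "cexp S (cexp \<Gamma> (\<lambda>z. F z + B)) x = cexp S (\<lambda>z. cexp \<Gamma> F z + B) x"
    unfolding cexp_def[of S] by (intro Bochner_Integration.integral_cong refl)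
      (simp add: cexp_add[OF GI _ F bdd_meas_const] cexp_const[OF GI])
  ultimately show ?thesis
    using F by (simp add: cexp_add[OF S xs] bdd_meas_cexp[OF GI] bdd_meas_const)
qed

lemma cexp_pull_out:
  assumes G: "\<Gamma> \<subseteq> {1..n}" and x: "x \<in> regular \<Gamma>" and F: "bdd_meas F" "bdd_meas H"
    and inv: "\<And>w. w \<in> space (PiM \<Gamma> M) \<Longrightarrow> H (override \<Gamma> w x) = H x"
  shows "cexp \<Gamma> (\<lambda>z. H z * F z) x = H x * cexp \<Gamma> F x"
proof -
  note [measurable] = bdd_measD[OF F(2)]
  have "AE z in cond_ker \<Gamma> x. H z = H x"
    by (rule AE_cond_ker_off[OF G x]) (simp add: inv, measurable)
  then have "cexp \<Gamma> (\<lambda>z. H z * F z) x = cexp \<Gamma> (\<lambda>z. H x * F z) x"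
    by (intro cexp_cong_AE bdd_meas_intros bdd_meas_cexp G F) auto
  then show ?thesis by (simp add: cexp_cmult)
qed

lemma cexp_pull:
  assumes G: "\<Gamma> \<subseteq> {1..n}" and x: "x \<in> regular \<Gamma>" and F: "bdd_meas F" "bdd_meas H"
  shows "cexp \<Gamma> (\<lambda>z. F z * cexp \<Gamma> H z) x = cexp \<Gamma> F x * cexp \<Gamma> H x"
  using cexp_pull_out[OF G x F(1) bdd_meas_cexp[OF G F(2)]]
  by (simp add: cexp_def[of \<Gamma> H] cond_ker_override[OF G x] mult.commute)

text \<open>
  The operator \<open>E\<^sub>\<Gamma>\<close> is an orthogonal projection with respect to the conditional law of a larger block.
\<close>

lemma cexp_selfadj:
  assumes S: "S \<subseteq> {1..n}" and G: "\<Gamma> \<subseteq> S" and x: "x \<in> regular S" and F: "bdd_meas F" "bdd_meas H"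
  shows "cexp S (\<lambda>z. F z * cexp \<Gamma> H z) x = cexp S (\<lambda>z. cexp \<Gamma> F z * cexp \<Gamma> H z) x"
proof -
  have GI: "\<Gamma> \<subseteq> {1..n}" using S G by auto
  have "cexp S (\<lambda>z. F z * cexp \<Gamma> H z) x = cexp S (cexp \<Gamma> (\<lambda>z. F z * cexp \<Gamma> H z)) x"
    by (intro cexp_tower[symmetric] S G x bdd_meas_intros bdd_meas_cexp GI F)
  also have "\<dots> = cexp S (\<lambda>z. cexp \<Gamma> F z * cexp \<Gamma> H z) x"
  proof (intro cexp_cong_AE bdd_meas_intros bdd_meas_cexp GI F)
    show "AE z in cond_ker S x. cexp \<Gamma> (\<lambda>z. F z * cexp \<Gamma> H z) z = cexp \<Gamma> F z * cexp \<Gamma> H z"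
      using AE_cond_ker_regular[OF S G x] by eventually_elim (rule cexp_pull[OF GI _ F])
  qed
  finally show ?thesis .
qed

lemma cexp_cong_space: "(\<And>z. z \<in> space full_space \<Longrightarrow> F z = H z) \<Longrightarrow> cexp \<Gamma> F x = cexp \<Gamma> H x"
  unfolding cexp_def by (intro Bochner_Integration.integral_cong) auto

section \<open>Poincare inequalities for block updates\<close>

definition blocks :: "nat set \<Rightarrow> nat \<Rightarrow> nat set set" where
  "blocks S l = {\<Gamma>. \<Gamma> \<subseteq> S \<and> card \<Gamma> = l}"

text \<open>
  The Poincare inequality with constant \<open>\<gamma>\<close>, uniformly over all sets \<open>S\<close> of \<open>m\<close> free coordinates and all
  regular conditions: \<open>\<gamma>\<close> times the conditional variance of \<open>F\<close> is at most the average over the blocks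
  \<open>\<Gamma>\<close> of size \<open>l\<close> of \<open>E\<^sub>S (F\<^sup>2 - (E\<^sub>\<Gamma> F)\<^sup>2)\<close>. The number of blocks is multiplied out.
\<close>

definition poincare :: "nat \<Rightarrow> nat \<Rightarrow> real \<Rightarrow> bool" where
  "poincare m l \<gamma> \<longleftrightarrow> (\<forall>S x F. S \<subseteq> {1..n} \<and> card S = m \<and> x \<in> regular S \<and> bdd_meas F \<longrightarrow>
     \<gamma> * (cexp S (\<lambda>z. (F z)\<^sup>2) x - (cexp S F x)\<^sup>2) * real (m choose l)
      \<le> (\<Sum>\<Gamma>\<in>blocks S l. cexp S (\<lambda>z. (F z)\<^sup>2 - (cexp \<Gamma> F z)\<^sup>2) x))"

lemma finite_blocks: "finite S \<Longrightarrow> finite (blocks S l)"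
  by (simp add: blocks_def)

lemma card_blocks: "finite S \<Longrightarrow> card (blocks S l) = card S choose l"
  by (simp add: blocks_def n_subsets)

text \<open>
  A uniform block of size \<open>l\<close> is a uniform block of size \<open>l\<close> of \<open>S\<close> minus a uniform coordinate.
\<close>

lemma sum_blocks_remove:
  fixes a :: "nat set \<Rightarrow> real"
  assumes S: "finite S" and l: "l \<le> card S"
  shows "(\<Sum>i\<in>S. \<Sum>\<Gamma>\<in>blocks (S - {i}) l. a \<Gamma>) = real (card S - l) * (\<Sum>\<Gamma>\<in>blocks S l. a \<Gamma>)"
proof -
  have "(\<Sum>i\<in>S. \<Sum>\<Gamma>\<in>blocks (S - {i}) l. a \<Gamma>) = (\<Sum>i\<in>S. \<Sum>\<Gamma>\<in>{\<Gamma>\<in>blocks S l. i \<notin> \<Gamma>}. a \<Gamma>)"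
    by (intro sum.cong refl) (auto simp: blocks_def)
  also have "\<dots> = (\<Sum>\<Gamma>\<in>blocks S l. \<Sum>i\<in>{i\<in>S. i \<notin> \<Gamma>}. a \<Gamma>)"
    using S by (intro sum.swap_restrict) (auto simp: finite_blocks)
  also have "\<dots> = (\<Sum>\<Gamma>\<in>blocks S l. real (card S - l) * a \<Gamma>)"
  proof (intro sum.cong refl)
    fix \<Gamma> assume "\<Gamma> \<in> blocks S l"
    then have "\<Gamma> \<subseteq> S" "card \<Gamma> = l" by (auto simp: blocks_def)
    moreover have "{i\<in>S. i \<notin> \<Gamma>} = S - \<Gamma>" by auto
    ultimately show "(\<Sum>i\<in>{i\<in>S. i \<notin> \<Gamma>}. a \<Gamma>) = real (card S - l) * a \<Gamma>"
      using S by (simp add: card_Diff_subset finite_subset)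
  qed
  finally show ?thesis by (simp add: sum_distrib_left)
qed

lemma blocks_card_minus_1:
  assumes "finite S" "S \<noteq> {}"
  shows "(\<Sum>\<Gamma>\<in>blocks S (card S - 1). a \<Gamma>) = (\<Sum>i\<in>S. a (S - {i}))"
proof -
  have "inj_on (\<lambda>i. S - {i}) S" by (auto simp: inj_on_def)
  moreover have "blocks S (card S - 1) = (\<lambda>i. S - {i}) ` S"
  proof (rule subset_antisym; rule subsetI)
    fix \<Gamma> assume "\<Gamma> \<in> blocks S (card S - 1)"
    then have G: "\<Gamma> \<subseteq> S" "card \<Gamma> = card S - 1" by (auto simp: blocks_def)
    have "card S > 0" using assms by (simp add: card_gt_0_iff)
    then have "card (S - \<Gamma>) = 1"
      using G assms by (simp add: card_Diff_subset finite_subset)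
    then obtain i where "S - \<Gamma> = {i}" by (rule card_1_singletonE)
    then have "i \<in> S" "\<Gamma> = S - {i}" using G by auto
    then show "\<Gamma> \<in> (\<lambda>i. S - {i}) ` S" by auto
  next
    fix \<Gamma> assume "\<Gamma> \<in> (\<lambda>i. S - {i}) ` S"
    then show "\<Gamma> \<in> blocks S (card S - 1)" using assms by (auto simp: blocks_def)
  qed
  ultimately show ?thesis by (simp add: sum.reindex)
qed

lemma finite_index_subset: "S \<subseteq> {1..n} \<Longrightarrow> finite S"
  by (rule finite_subset) auto

text \<open>
  With a single block one update reaches equilibrium.
\<close>

lemma poincare_refl: "poincare l l 1"
  unfolding poincare_def
proof (intro allI impI, elim conjE)
  fix S x F assume S: "S \<subseteq> {1..n}" "card S = l" and x: "x \<in> regular S" and F: "bdd_meas F"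
  have fS: "finite S" using finite_index_subset[OF S(1)] .
  have "blocks S l = {S}" using S fS by (auto simp: blocks_def dest: card_subset_eq)
  moreover have "cexp S (\<lambda>z. (cexp S F z)\<^sup>2) x = (cexp S F x)\<^sup>2"
    using cexp_pull[OF S(1) x bdd_meas_cexp[OF S(1) F] F] cexp_tower[OF S(1) order_refl x F]
    by (simp add: power2_eq_square)
  ultimately show "1 * (cexp S (\<lambda>z. (F z)\<^sup>2) x - (cexp S F x)\<^sup>2) * real (l choose l)
      \<le> (\<Sum>\<Gamma>\<in>blocks S l. cexp S (\<lambda>z. (F z)\<^sup>2 - (cexp \<Gamma> F z)\<^sup>2) x)"
    using F regularD(1)[OF x] S by (simp add: cexp_diff bdd_meas_intros bdd_meas_cexp)
qed

text \<open>
  Poincare constants multiply. The inequality for \<open>S - {i}\<close> is applied conditionally on \<open>X\<^sub>i\<close> and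
  integrated; the sum over \<open>i\<close> is then the right-hand side of the inequality for block size \<open>m - 1\<close>.
\<close>

lemma poincare_step:
  assumes 1: "poincare (m - 1) l \<gamma>" and 2: "poincare m (m - 1) g" and \<gamma>: "0 \<le> \<gamma>"
    and l: "l < m"
  shows "poincare m l (\<gamma> * g)"
  unfolding poincare_def
proof (intro allI impI, elim conjE)
  fix S x F assume S: "S \<subseteq> {1..n}" and m: "card S = m" and x: "x \<in> regular S" and F: "bdd_meas F"
  have fS: "finite S" using finite_index_subset[OF S(1)] .
  have S0: "S \<noteq> {}" using m l by auto
  have xs: "x \<in> space full_space" using regularD(1)[OF x] .
  define D where "D \<Gamma> z = (F z)\<^sup>2 - (cexp \<Gamma> F z)\<^sup>2" for \<Gamma> z
  define V where "V = cexp S (\<lambda>z. (F z)\<^sup>2) x - (cexp S F x)\<^sup>2"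
  have D: "bdd_meas (D \<Gamma>)" if "\<Gamma> \<subseteq> S" for \<Gamma>
    unfolding D_def using that S by (intro bdd_meas_intros bdd_meas_cexp F) auto
  have inner: "\<gamma> * real ((m - 1) choose l) * cexp S (D (S - {i})) x
      \<le> (\<Sum>\<Gamma>\<in>blocks (S - {i}) l. cexp S (D \<Gamma>) x)" if i: "i \<in> S" for i
  proof -
    let ?T = "S - {i}"
    have T: "?T \<subseteq> {1..n}" "?T \<subseteq> S" using S by auto
    have cT: "card ?T = m - 1" using m i fS by simp
    have Db: "bdd_meas (D \<Gamma>)" if "\<Gamma> \<in> blocks ?T l" for \<Gamma> using that D by (auto simp: blocks_def)
    have "\<gamma> * real ((m - 1) choose l) * cexp S (D ?T) x
       = \<gamma> * real ((m - 1) choose l) * cexp S (\<lambda>z. cexp ?T (\<lambda>z. (F z)\<^sup>2) z - (cexp ?T F z)\<^sup>2) x"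
      using F T S unfolding D_def
      by (simp add: cexp_diff[OF S xs] bdd_meas_intros bdd_meas_cexp cexp_tower[OF S T(2) x])
    also have "\<dots> = cexp S (\<lambda>z. \<gamma> * real ((m - 1) choose l) * (cexp ?T (\<lambda>z. (F z)\<^sup>2) z - (cexp ?T F z)\<^sup>2)) x"
      by (simp only: cexp_cmult)
    also have "\<dots> \<le> cexp S (\<lambda>z. \<Sum>\<Gamma>\<in>blocks ?T l. cexp ?T (D \<Gamma>) z) x"
    proof (intro cexp_mono_AE S xs bdd_meas_intros bdd_meas_cexp T F Db)
      show "AE z in cond_ker S x. \<gamma> * real ((m - 1) choose l) * (cexp ?T (\<lambda>z. (F z)\<^sup>2) z - (cexp ?T F z)\<^sup>2)
          \<le> (\<Sum>\<Gamma>\<in>blocks ?T l. cexp ?T (D \<Gamma>) z)"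
        using AE_cond_ker_regular[OF S T(2) x]
      proof eventually_elim
        case (elim z)
        then show ?case
          using 1 T cT F unfolding poincare_def D_def by (simp add: mult_ac)
      qed
    qed
    also have "\<dots> = (\<Sum>\<Gamma>\<in>blocks ?T l. cexp S (cexp ?T (D \<Gamma>)) x)"
      by (intro cexp_sum S xs bdd_meas_cexp T Db)
    also have "\<dots> = (\<Sum>\<Gamma>\<in>blocks ?T l. cexp S (D \<Gamma>) x)"
      by (intro sum.cong refl cexp_tower S T x Db)
    finally show ?thesis .
  qed
  have choose: "real (m - l) * real (m choose l) = real m * real ((m - 1) choose l)"
    using l binomial_absorb_comp[of m l] by (metis of_nat_mult mult.commute)
  have "g * V * real m \<le> (\<Sum>i\<in>S. cexp S (D (S - {i})) x)"
    using 2 S m x F blocks_card_minus_1[OF fS S0, of "\<lambda>\<Gamma>. cexp S (D \<Gamma>) x"] l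
    unfolding poincare_def V_def D_def
    by (auto simp: choose_one binomial_symmetric[of "m - 1" m] dest!: spec[of _ S] spec[of _ x] spec[of _ F])
  then have "\<gamma> * real ((m - 1) choose l) * (g * V * real m)
     \<le> \<gamma> * real ((m - 1) choose l) * (\<Sum>i\<in>S. cexp S (D (S - {i})) x)"
    using \<gamma> by (intro mult_left_mono) auto
  also have "\<dots> = (\<Sum>i\<in>S. \<gamma> * real ((m - 1) choose l) * cexp S (D (S - {i})) x)"
    by (simp add: sum_distrib_left)
  also have "\<dots> \<le> (\<Sum>i\<in>S. \<Sum>\<Gamma>\<in>blocks (S - {i}) l. cexp S (D \<Gamma>) x)"
    by (intro sum_mono inner)
  also have "\<dots> = real (m - l) * (\<Sum>\<Gamma>\<in>blocks S l. cexp S (D \<Gamma>) x)"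
    using sum_blocks_remove[OF fS] l m by simp
  finally have "\<gamma> * g * V * (real m * real ((m - 1) choose l)) \<le> real (m - l) * (\<Sum>\<Gamma>\<in>blocks S l. cexp S (D \<Gamma>) x)"
    by (simp add: mult_ac)
  then have "real (m - l) * (\<gamma> * g * V * real (m choose l)) \<le> real (m - l) * (\<Sum>\<Gamma>\<in>blocks S l. cexp S (D \<Gamma>) x)"
    unfolding choose[symmetric] by (simp add: mult_ac)
  then show "\<gamma> * g * (cexp S (\<lambda>z. (F z)\<^sup>2) x - (cexp S F x)\<^sup>2) * real (m choose l)
      \<le> (\<Sum>\<Gamma>\<in>blocks S l. cexp S (\<lambda>z. (F z)\<^sup>2 - (cexp \<Gamma> F z)\<^sup>2) x)"
    using l unfolding D_def V_def by simp
qed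

end

section \<open>From the Poincare inequality to the spectral gap\<close>

lemma weighted_am_gm:
  fixes a b s :: real
  assumes "s > 0"
  shows "2 * (a * b) \<le> s * a\<^sup>2 + (1 / s) * b\<^sup>2"
proof -
  have "0 \<le> (s * a - b)\<^sup>2 / s" using assms by simp
  also have "\<dots> = s * a\<^sup>2 + (1 / s) * b\<^sup>2 - 2 * (a * b)"
    using assms by (simp add: field_simps power2_eq_square)
  finally show ?thesis by simp
qed

text \<open>
  The integral of a possibly unbounded function against a uniform mixture of finitely many laws.
\<close>

lemma integral_bind_uniform_count:
  fixes f :: "'b \<Rightarrow> real"
  assumes B: "finite B" "B \<noteq> {}" and N: "\<And>b. b \<in> B \<Longrightarrow> prob_space (K b)" "\<And>b. b \<in> B \<Longrightarrow> sets (K b) = sets N"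
    and f: "\<And>b. b \<in> B \<Longrightarrow> integrable (K b) f"
  shows "(\<integral> z. f z \<partial>(uniform_count_measure B \<bind> K)) = (\<Sum>b\<in>B. \<integral> z. f z \<partial>K b) / real (card B)"
proof -
  let ?U = "uniform_count_measure B"
  have K: "K \<in> ?U \<rightarrow>\<^sub>M subprob_algebra N"
    unfolding measurable_cong_sets[OF sets_uniform_count_measure_count_space refl] measurable_count_space_eq1
    using N by (auto simp: space_subprob_algebra intro: prob_space_imp_subprob_space)
  obtain b where b: "b \<in> B" using B by auto
  have fN: "f \<in> borel_measurable N"
    using borel_measurable_integrable[OF f[OF b]] N(2)[OF b] by (simp cong: measurable_cong_sets)
  have sB: "sets (?U \<bind> K) = sets N"
    using B N by (intro sets_bind[where N=N]) (auto simp: space_uniform_count_measure)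
  have nonneg: "integrable (?U \<bind> K) g \<and> (\<integral> z. g z \<partial>(?U \<bind> K)) = (\<Sum>b\<in>B. \<integral> z. g z \<partial>K b) / real (card B)"
    if g: "g \<in> borel_measurable N" "\<And>z. 0 \<le> g z" "\<And>b. b \<in> B \<Longrightarrow> integrable (K b) g" for g :: "'b \<Rightarrow> real"
  proof -
    have "(\<integral>\<^sup>+ z. ennreal (g z) \<partial>(?U \<bind> K)) = (\<integral>\<^sup>+ b. \<integral>\<^sup>+ z. ennreal (g z) \<partial>K b \<partial>?U)"
      using g(1) by (intro nn_integral_bind[OF _ K]) auto
    also have "\<dots> = (\<Sum>b\<in>B. ennreal (1 / real (card B)) * (\<integral>\<^sup>+ z. ennreal (g z) \<partial>K b))"
      using B unfolding uniform_count_measure_def by (simp add: nn_integral_point_measure_finite)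
    also have "\<dots> = (\<Sum>b\<in>B. ennreal (1 / real (card B)) * ennreal (\<integral> z. g z \<partial>K b))"
      using g by (intro sum.cong refl arg_cong2[where f="(*)"] nn_integral_eq_integral) auto
    also have "\<dots> = (\<Sum>b\<in>B. ennreal ((1 / real (card B)) * (\<integral> z. g z \<partial>K b)))"
      using g(2) by (intro sum.cong refl ennreal_mult[symmetric]) auto
    also have "\<dots> = ennreal (\<Sum>b\<in>B. (1 / real (card B)) * (\<integral> z. g z \<partial>K b))"
      using g(2) by (intro sum_ennreal) auto
    also have "(\<Sum>b\<in>B. (1 / real (card B)) * (\<integral> z. g z \<partial>K b)) = (\<Sum>b\<in>B. \<integral> z. g z \<partial>K b) / real (card B)"
      by (simp add: sum_divide_distrib)
    finally have "(\<integral>\<^sup>+ z. ennreal (g z) \<partial>(?U \<bind> K)) = ennreal ((\<Sum>b\<in>B. \<integral> z. g z \<partial>K b) / real (card B))" .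
    then show ?thesis
      using g by (subst (asm) nn_integral_eq_integrable)
       (auto simp: measurable_cong_sets[OF sB refl] intro!: divide_nonneg_nonneg sum_nonneg)
  qed
  have p: "integrable (?U \<bind> K) (\<lambda>z. max 0 (f z)) \<and>
      (\<integral> z. max 0 (f z) \<partial>(?U \<bind> K)) = (\<Sum>b\<in>B. \<integral> z. max 0 (f z) \<partial>K b) / real (card B)"
    using f fN by (intro nonneg) auto
  have m: "integrable (?U \<bind> K) (\<lambda>z. max 0 (- f z)) \<and>
      (\<integral> z. max 0 (- f z) \<partial>(?U \<bind> K)) = (\<Sum>b\<in>B. \<integral> z. max 0 (- f z) \<partial>K b) / real (card B)"
    using f fN by (intro nonneg) auto
  have fe: "f = (\<lambda>z. max 0 (f z) - max 0 (- f z))" by (auto simp: max_def)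
  have fb: "(\<integral> z. f z \<partial>K b) = (\<integral> z. max 0 (f z) \<partial>K b) - (\<integral> z. max 0 (- f z) \<partial>K b)" if "b \<in> B" for b
    using f[OF that] by (subst fe, subst Bochner_Integration.integral_diff) auto
  have "(\<integral> z. f z \<partial>(?U \<bind> K)) = (\<integral> z. max 0 (f z) \<partial>(?U \<bind> K)) - (\<integral> z. max 0 (- f z) \<partial>(?U \<bind> K))"
    using p m by (subst fe, subst Bochner_Integration.integral_diff) auto
  also have "\<dots> = (\<Sum>b\<in>B. \<integral> z. f z \<partial>K b) / real (card B)"
    using p m by (simp add: fb sum_subtractf diff_divide_distrib)
  finally show ?thesis .
qed

context gibbs_setting
begin

text \<open>
  The action of the Gibbs sampler with block size \<open>l\<close> on a function of the full vector.
\<close>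

definition gibbs_avg :: "nat set \<Rightarrow> nat \<Rightarrow> ((nat \<Rightarrow> 'a) \<Rightarrow> real) \<Rightarrow> (nat \<Rightarrow> 'a) \<Rightarrow> real" where
  "gibbs_avg S l F z = (\<Sum>\<Gamma>\<in>blocks S l. cexp \<Gamma> F z) / real (card S choose l)"

lemma bdd_meas_gibbs_avg: "S \<subseteq> {1..n} \<Longrightarrow> bdd_meas F \<Longrightarrow> bdd_meas (gibbs_avg S l F)"
  unfolding gibbs_avg_def by (intro bdd_meas_intros bdd_meas_cexp) (auto simp: blocks_def)

text \<open>
  The Poincare inequality bounds the quadratic form \<open>\<langle>F, P F\<rangle>\<close> of the Gibbs sampler \<open>P\<close> by
  \<open>c \<parallel>F\<parallel>\<^sup>2\<close> with \<open>c = 1 - \<gamma>\<close> on centred functions. As \<open>P\<close> is self-adjoint and nonnegative, this bounds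
  \<open>\<parallel>P F\<parallel>\<close> by \<open>c \<parallel>F\<parallel>\<close>.
\<close>

lemma poincare_contraction:
  assumes P: "poincare m l \<gamma>" and \<gamma>: "\<gamma> \<le> 1" and S: "S \<subseteq> {1..n}" "card S = m" and l: "l \<le> m"
    and x: "x \<in> regular S" and F: "bdd_meas F"
  shows "cexp S (\<lambda>z. (gibbs_avg S l F z - cexp S F x)\<^sup>2) x \<le> (1 - \<gamma>)\<^sup>2 * cexp S (\<lambda>z. (F z)\<^sup>2) x"
proof -
  have xs: "x \<in> space full_space" using regularD(1)[OF x] .
  note E = cexp_diff[OF S(1) xs] cexp_sum[OF S(1) xs] cexp_const[OF S(1) xs] cexp_cmult
  define \<mu> where "\<mu> = cexp S F x"
  define c where "c = 1 - \<gamma>"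
  define C where "C = real (m choose l)"
  define H where "H z = F z - \<mu>" for z
  define Q where "Q = gibbs_avg S l H"
  have C: "C > 0" using l by (simp add: C_def)
  have c: "c \<ge> 0" using \<gamma> by (simp add: c_def)
  have blk: "\<Gamma> \<subseteq> {1..n}" "\<Gamma> \<subseteq> S" if "\<Gamma> \<in> blocks S l" for \<Gamma> using that S by (auto simp: blocks_def)
  have H: "bdd_meas H" unfolding H_def by (intro bdd_meas_intros F)
  have Q: "bdd_meas Q" unfolding Q_def by (intro bdd_meas_gibbs_avg S H)
  have mH: "cexp S H x = 0"
    unfolding H_def using F by (simp add: E bdd_meas_intros \<mu>_def)
  have CQ: "C * Q z = (\<Sum>\<Gamma>\<in>blocks S l. cexp \<Gamma> H z)" for z
    using C S by (simp add: Q_def gibbs_avg_def C_def)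
  have mQ: "cexp S Q x = 0"
  proof -
    have "C * cexp S Q x = cexp S (\<lambda>z. \<Sum>\<Gamma>\<in>blocks S l. cexp \<Gamma> H z) x"
      by (simp add: CQ flip: cexp_cmult)
    also have "\<dots> = (\<Sum>\<Gamma>\<in>blocks S l. cexp S (cexp \<Gamma> H) x)"
      by (intro cexp_sum S xs bdd_meas_cexp blk H)
    also have "\<dots> = (\<Sum>\<Gamma>\<in>blocks S l. cexp S H x)"
      by (intro sum.cong refl cexp_tower S blk x H)
    finally show ?thesis using C mH by simp
  qed
  \<comment> \<open>\<open>Bf f\<close> is the number of blocks times \<open>\<langle>f, P f\<rangle>\<close>.\<close>
  define Bf where "Bf f = (\<Sum>\<Gamma>\<in>blocks S l. cexp S (\<lambda>z. (cexp \<Gamma> f z)\<^sup>2) x)" for f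
  have Bf: "Bf f \<le> c * C * cexp S (\<lambda>z. (f z)\<^sup>2) x" if f: "bdd_meas f" "cexp S f x = 0" for f
  proof -
    have "\<gamma> * cexp S (\<lambda>z. (f z)\<^sup>2) x * C \<le> (\<Sum>\<Gamma>\<in>blocks S l. cexp S (\<lambda>z. (f z)\<^sup>2 - (cexp \<Gamma> f z)\<^sup>2) x)"
      using P[unfolded poincare_def, rule_format, of S x f] S x f unfolding C_def by simp
    also have "\<dots> = (\<Sum>\<Gamma>\<in>blocks S l. cexp S (\<lambda>z. (f z)\<^sup>2) x - cexp S (\<lambda>z. (cexp \<Gamma> f z)\<^sup>2) x)"
      by (intro sum.cong refl cexp_diff S xs bdd_meas_intros bdd_meas_cexp blk f)
    also have "\<dots> = C * cexp S (\<lambda>z. (f z)\<^sup>2) x - Bf f"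
      using S by (simp add: sum_subtractf Bf_def card_blocks finite_index_subset C_def)
    finally show ?thesis by (simp add: c_def algebra_simps)
  qed
  \<comment> \<open>\<open>Q = P H\<close>, so that \<open>\<parallel>Q\<parallel>\<^sup>2 = \<langle>Q, P H\<rangle>\<close>, to which the arithmetic-geometric inequality is applied.\<close>
  have key: "2 * C * cexp S (\<lambda>z. (Q z)\<^sup>2) x \<le> s * Bf Q + Bf H / s" if s: "s > 0" for s
  proof -
    have "C * cexp S (\<lambda>z. (Q z)\<^sup>2) x = cexp S (\<lambda>z. \<Sum>\<Gamma>\<in>blocks S l. Q z * cexp \<Gamma> H z) x"
    proof (subst cexp_cmult[symmetric], rule cexp_cong_space)
      fix z
      have "(\<Sum>\<Gamma>\<in>blocks S l. Q z * cexp \<Gamma> H z) = Q z * (C * Q z)"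
        unfolding CQ by (rule sum_distrib_left[symmetric])
      then show "C * (Q z)\<^sup>2 = (\<Sum>\<Gamma>\<in>blocks S l. Q z * cexp \<Gamma> H z)"
        by (simp add: power2_eq_square)
    qed
    also have "\<dots> = (\<Sum>\<Gamma>\<in>blocks S l. cexp S (\<lambda>z. Q z * cexp \<Gamma> H z) x)"
      by (intro cexp_sum S xs bdd_meas_intros bdd_meas_cexp blk H Q)
    also have "\<dots> = (\<Sum>\<Gamma>\<in>blocks S l. cexp S (\<lambda>z. cexp \<Gamma> Q z * cexp \<Gamma> H z) x)"
      by (intro sum.cong refl cexp_selfadj S xs blk H Q x)
    finally have "2 * C * cexp S (\<lambda>z. (Q z)\<^sup>2) x = (\<Sum>\<Gamma>\<in>blocks S l. 2 * cexp S (\<lambda>z. cexp \<Gamma> Q z * cexp \<Gamma> H z) x)"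
      unfolding sum_distrib_left[symmetric] by simp
    also have "\<dots> = (\<Sum>\<Gamma>\<in>blocks S l. cexp S (\<lambda>z. 2 * (cexp \<Gamma> Q z * cexp \<Gamma> H z)) x)"
      by (simp only: cexp_cmult)
    also have "\<dots> \<le> (\<Sum>\<Gamma>\<in>blocks S l. cexp S (\<lambda>z. s * (cexp \<Gamma> Q z)\<^sup>2 + (1/s) * (cexp \<Gamma> H z)\<^sup>2) x)"
      using s by (intro sum_mono cexp_mono_AE S xs bdd_meas_intros bdd_meas_cexp blk H Q AE_I2 weighted_am_gm)
    also have "\<dots> = (\<Sum>\<Gamma>\<in>blocks S l. s * cexp S (\<lambda>z. (cexp \<Gamma> Q z)\<^sup>2) x + (1/s) * cexp S (\<lambda>z. (cexp \<Gamma> H z)\<^sup>2) x)"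
      by (intro sum.cong refl, subst cexp_add[OF S(1) xs])
        (auto simp only: cexp_cmult intro!: bdd_meas_intros bdd_meas_cexp blk H Q)
    also have "\<dots> = s * Bf Q + Bf H / s"
      by (simp add: Bf_def sum.distrib sum_distrib_left sum_divide_distrib)
    finally show ?thesis .
  qed
  define q where "q = cexp S (\<lambda>z. (Q z)\<^sup>2) x"
  define h where "h = cexp S (\<lambda>z. (H z)\<^sup>2) x"
  have q0: "q \<ge> 0" and h0: "h \<ge> 0" unfolding q_def h_def by (auto intro: cexp_nonneg)
  have "q \<le> c\<^sup>2 * h"
  proof (cases "c = 0")
    case True
    then have "2 * C * q \<le> 0"
      using key[of 1] Bf[OF Q mQ] Bf[OF H mH] by (simp add: q_def)
    then show ?thesis using C True by (simp add: mult_le_0_iff)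
  next
    case False
    then have cp: "c > 0" using c by simp
    \<comment> \<open>The weight \<open>1 / c\<close> makes the term in \<open>Q\<close> absorbable on the left.\<close>
    have "2 * C * q \<le> (1/c) * Bf Q + Bf H / (1/c)"
      unfolding q_def using cp by (intro key) auto
    also have "\<dots> \<le> (1/c) * (c * C * q) + (c * C * h) / (1/c)"
      unfolding q_def h_def using cp Bf[OF Q mQ] Bf[OF H mH]
      by (intro add_mono mult_left_mono divide_right_mono) auto
    also have "\<dots> = C * (q + c\<^sup>2 * h)"
      using cp by (simp add: field_simps power2_eq_square)
    finally have "C * q \<le> C * (c\<^sup>2 * h)" by (simp add: algebra_simps)
    then show ?thesis using C by simp
  qed
  moreover have "q = cexp S (\<lambda>z. (gibbs_avg S l F z - cexp S F x)\<^sup>2) x"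
    unfolding q_def
  proof (rule cexp_cong_space)
    fix z assume z: "z \<in> space full_space"
    have "C * Q z = (\<Sum>\<Gamma>\<in>blocks S l. cexp \<Gamma> F z - \<mu>)"
      unfolding CQ H_def using z by (intro sum.cong refl) (simp add: cexp_diff cexp_const blk F bdd_meas_const)
    also have "\<dots> = C * (gibbs_avg S l F z - \<mu>)"
      using S C by (simp add: sum_subtractf card_blocks finite_index_subset C_def gibbs_avg_def algebra_simps)
    finally show "(Q z)\<^sup>2 = (gibbs_avg S l F z - cexp S F x)\<^sup>2" using C by (simp add: \<mu>_def)
  qed
  moreover have "h \<le> cexp S (\<lambda>z. (F z)\<^sup>2) x"
  proof -
    have "h = cexp S (\<lambda>z. ((F z)\<^sup>2 - 2 * \<mu> * F z) - (- \<mu>\<^sup>2)) x"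
      unfolding h_def H_def by (intro cexp_cong_space) (simp add: power2_eq_square algebra_simps)
    also have "\<dots> = cexp S (\<lambda>z. (F z)\<^sup>2) x - 2 * \<mu> * \<mu> + \<mu>\<^sup>2"
      using F by (simp only: cexp_diff[OF S(1) xs] bdd_meas_intros E \<mu>_def[symmetric])
    finally show ?thesis by (simp add: power2_eq_square)
  qed
  then have "c\<^sup>2 * h \<le> c\<^sup>2 * cexp S (\<lambda>z. (F z)\<^sup>2) x" by (intro mult_left_mono) auto
  ultimately show ?thesis by (simp add: c_def)
qed

lemma AE_integrable_cond_ker:
  fixes f :: "(nat \<Rightarrow> 'a) \<Rightarrow> real"
  assumes S: "S \<subseteq> {1..n}" and G: "\<Gamma> \<subseteq> S" and x: "x \<in> regular S" and f: "integrable (cond_ker S x) f"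
  shows "AE z in cond_ker S x. integrable (cond_ker \<Gamma> z) f"
proof -
  have GI: "\<Gamma> \<subseteq> {1..n}" using S G by auto
  have fm[measurable]: "f \<in> borel_measurable full_space"
    using borel_measurable_integrable[OF f] by (simp add: measurable_cong_sets[OF sets_cond_ker refl])
  have "(\<integral>\<^sup>+ z. (\<integral>\<^sup>+ z'. ennreal (norm (f z')) \<partial>cond_ker \<Gamma> z) \<partial>cond_ker S x) = (\<integral>\<^sup>+ z. ennreal (norm (f z)) \<partial>cond_ker S x)"
    by (rule nn_integral_cond_ker_cond_ker[OF S G x]) measurable
  also have "\<dots> < \<infinity>" using integrableD(2)[OF integrable_norm[OF f]] by (simp add: less_top)
  finally have *: "(\<integral>\<^sup>+ z. (\<integral>\<^sup>+ z'. ennreal (norm (f z')) \<partial>cond_ker \<Gamma> z) \<partial>cond_ker S x) \<noteq> \<infinity>" by simp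
  have "(\<lambda>z. \<integral>\<^sup>+ z'. ennreal (norm (f z')) \<partial>cond_ker \<Gamma> z) \<in> borel_measurable full_space"
    by (rule measurable_compose[OF cond_ker_measurable[OF GI] nn_integral_measurable_subprob_algebra]) measurable
  then have "AE z in cond_ker S x. (\<integral>\<^sup>+ z'. ennreal (norm (f z')) \<partial>cond_ker \<Gamma> z) \<noteq> \<infinity>"
    by (intro nn_integral_PInf_AE[OF _ *]) (simp add: measurable_cong_sets[OF sets_cond_ker refl])
  then show ?thesis
    by eventually_elim (auto intro!: integrableI_bounded simp: measurable_cong_sets[OF sets_cond_ker refl] less_top)
qed

lemma trunc_abs: "\<bar>max (- real k) (min (real k) a)\<bar> \<le> \<bar>a\<bar>" "\<bar>max (- real k) (min (real k) a)\<bar> \<le> real k"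
  by (auto simp: max_def min_def)

lemma trunc_lim: "(\<lambda>k. max (- real k) (min (real k) a)) \<longlonglongrightarrow> a"
proof (rule tendsto_eventually)
  show "\<forall>\<^sub>F k in sequentially. max (- real k) (min (real k) a) = a"
    using eventually_ge_at_top[of "nat \<lceil>\<bar>a\<bar>\<rceil>"]
    by eventually_elim (auto simp: max_def min_def; linarith)
qed

text \<open>
  The contraction extends to square-integrable functions: the truncations of \<open>f\<close> have smaller norm, the
  Gibbs averages of the truncations converge almost surely to that of \<open>f\<close>, and Fatou's lemma applies.
\<close>

lemma contraction_L2:
  assumes P: "poincare m l \<gamma>" and \<gamma>: "\<gamma> \<le> 1" and S: "S \<subseteq> {1..n}" "card S = m" and l: "l \<le> m"
    and x: "x \<in> regular S" and f[measurable]: "f \<in> borel_measurable full_space"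
    and sq: "(\<integral>\<^sup>+ z. ennreal ((f z)\<^sup>2) \<partial>cond_ker S x) < \<infinity>" and mean: "(\<integral> z. f z \<partial>cond_ker S x) = 0"
  shows "AE z in cond_ker S x. \<forall>\<Gamma>\<in>blocks S l. z \<in> regular \<Gamma> \<and> integrable (cond_ker \<Gamma> z) f"
    and "(\<integral>\<^sup>+ z. ennreal ((gibbs_avg S l f z)\<^sup>2) \<partial>cond_ker S x) \<le> ennreal ((1 - \<gamma>)\<^sup>2) * (\<integral>\<^sup>+ z. ennreal ((f z)\<^sup>2) \<partial>cond_ker S x)"
proof -
  have xs: "x \<in> space full_space" using regularD(1)[OF x] .
  interpret prob_space "cond_ker S x" using prob_space_cond_ker[OF S(1) xs] .
  have fm: "f \<in> borel_measurable (cond_ker S x)" by (simp add: measurable_cong_sets[OF sets_cond_ker refl])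
  have fin: "finite (blocks S l)" using finite_blocks[OF finite_index_subset[OF S(1)]] .
  have blk: "\<Gamma> \<subseteq> {1..n}" "\<Gamma> \<subseteq> S" if "\<Gamma> \<in> blocks S l" for \<Gamma> using that S by (auto simp: blocks_def)
  have sqi: "integrable (cond_ker S x) (\<lambda>z. (f z)\<^sup>2)"
    using sq fm by (intro integrableI_bounded) auto
  have fi: "integrable (cond_ker S x) f"
    using square_integrable_imp_integrable[OF fm sqi] .
  show AE1: "AE z in cond_ker S x. \<forall>\<Gamma>\<in>blocks S l. z \<in> regular \<Gamma> \<and> integrable (cond_ker \<Gamma> z) f"
    using AE_cond_ker_regular[OF S(1) blk(2) x] AE_integrable_cond_ker[OF S(1) blk(2) x fi]
    by (intro AE_finite_allI[OF fin] AE_conjI) auto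
  define F where "F k z = max (- real k) (min (real k) (f z))" for k z
  have F: "bdd_meas (F k)" for k
    unfolding F_def by (rule bdd_measI[of _ "real k"]; (rule trunc_abs)?) measurable
  have Ff: "\<bar>F k z\<bar> \<le> \<bar>f z\<bar>" for k z unfolding F_def by (rule trunc_abs)
  have lim: "(\<lambda>k. cexp \<Gamma> (F k) z) \<longlonglongrightarrow> cexp \<Gamma> f z" if "integrable (cond_ker \<Gamma> z) f" for \<Gamma> z
    unfolding cexp_def
  proof (rule integral_dominated_convergence[where w="\<lambda>z. \<bar>f z\<bar>"])
    show "f \<in> borel_measurable (cond_ker \<Gamma> z)" "\<And>k. F k \<in> borel_measurable (cond_ker \<Gamma> z)"
      using bdd_measD[OF F] by (simp_all add: measurable_cong_sets[OF sets_cond_ker refl])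
    show "integrable (cond_ker \<Gamma> z) (\<lambda>z. \<bar>f z\<bar>)" using that by simp
    show "AE z in cond_ker \<Gamma> z. (\<lambda>k. F k z) \<longlonglongrightarrow> f z" unfolding F_def by (intro AE_I2 trunc_lim)
    show "AE z in cond_ker \<Gamma> z. norm (F k z) \<le> \<bar>f z\<bar>" for k using Ff by simp
  qed
  have lim0: "(\<lambda>k. cexp S (F k) x) \<longlonglongrightarrow> 0"
    using lim[OF fi] mean by (simp add: cexp_def)
  define u where "u k z = ennreal ((gibbs_avg S l (F k) z - cexp S (F k) x)\<^sup>2)" for k z
  have u: "u k \<in> borel_measurable (cond_ker S x)" for k
    unfolding u_def using bdd_measD[OF bdd_meas_gibbs_avg[OF S(1) F]] by (simp add: measurable_cong_sets[OF sets_cond_ker refl])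
  have "AE z in cond_ker S x. ennreal ((gibbs_avg S l f z)\<^sup>2) = liminf (\<lambda>k. u k z)"
    using AE1
  proof eventually_elim
    case (elim z)
    have "(\<lambda>k. gibbs_avg S l (F k) z - cexp S (F k) x) \<longlonglongrightarrow> gibbs_avg S l f z - 0"
      unfolding gibbs_avg_def using elim lim S l
      by (intro tendsto_diff lim0 tendsto_divide tendsto_sum tendsto_const) auto
    then have "(\<lambda>k. u k z) \<longlonglongrightarrow> ennreal ((gibbs_avg S l f z)\<^sup>2)"
      unfolding u_def by (intro tendsto_ennrealI tendsto_power) simp
    then show ?case by (intro lim_imp_Liminf[symmetric]) auto
  qed
  then have "(\<integral>\<^sup>+ z. ennreal ((gibbs_avg S l f z)\<^sup>2) \<partial>cond_ker S x) = (\<integral>\<^sup>+ z. liminf (\<lambda>k. u k z) \<partial>cond_ker S x)"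
    by (rule nn_integral_cong_AE)
  also have "\<dots> \<le> liminf (\<lambda>k. integral\<^sup>N (cond_ker S x) (u k))"
    by (rule nn_integral_liminf[OF u])
  also have "\<dots> \<le> ennreal ((1 - \<gamma>)\<^sup>2) * (\<integral>\<^sup>+ z. ennreal ((f z)\<^sup>2) \<partial>cond_ker S x)"
  proof (intro Liminf_le always_eventually allI)
    fix k
    have "integral\<^sup>N (cond_ker S x) (u k) = ennreal (cexp S (\<lambda>z. (gibbs_avg S l (F k) z - cexp S (F k) x)\<^sup>2) x)"
      unfolding u_def by (intro nn_integral_cond_ker_bdd_meas S xs bdd_meas_intros bdd_meas_gibbs_avg F) auto
    also have "\<dots> \<le> ennreal ((1 - \<gamma>)\<^sup>2 * cexp S (\<lambda>z. (F k z)\<^sup>2) x)"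
      by (intro ennreal_leI poincare_contraction[OF P \<gamma> S l x F])
    also have "\<dots> = ennreal ((1 - \<gamma>)\<^sup>2) * ennreal (cexp S (\<lambda>z. (F k z)\<^sup>2) x)"
      by (intro ennreal_mult cexp_nonneg) auto
    also have "ennreal (cexp S (\<lambda>z. (F k z)\<^sup>2) x) = (\<integral>\<^sup>+ z. ennreal ((F k z)\<^sup>2) \<partial>cond_ker S x)"
      by (intro nn_integral_cond_ker_bdd_meas[symmetric] S xs bdd_meas_intros F) auto
    also have "ennreal ((1 - \<gamma>)\<^sup>2) * \<dots> \<le> ennreal ((1 - \<gamma>)\<^sup>2) * (\<integral>\<^sup>+ z. ennreal ((f z)\<^sup>2) \<partial>cond_ker S x)"
      using Ff by (intro mult_left_mono nn_integral_mono ennreal_leI) (auto simp: abs_le_square_iff)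
    finally show "integral\<^sup>N (cond_ker S x) (u k) \<le> ennreal ((1 - \<gamma>)\<^sup>2) * (\<integral>\<^sup>+ z. ennreal ((f z)\<^sup>2) \<partial>cond_ker S x)" .
  qed simp
  finally show "(\<integral>\<^sup>+ z. ennreal ((gibbs_avg S l f z)\<^sup>2) \<partial>cond_ker S x) \<le> ennreal ((1 - \<gamma>)\<^sup>2) * (\<integral>\<^sup>+ z. ennreal ((f z)\<^sup>2) \<partial>cond_ker S x)" .
qed

lemma compl_compl: "\<Gamma> \<subseteq> {1..n} \<Longrightarrow> compl (compl \<Gamma>) = \<Gamma>" by auto

text \<open>
  The marginal density is a Bochner integral, hence \<open>0\<close> where the integral diverges, as is the real part
  of the block mass. So regularity says exactly that the marginal density is positive.
\<close>

lemma marg_eq_block_mass: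
  assumes G: "\<Gamma> \<subseteq> {1..n}" and x: "x \<in> space full_space"
  shows "marg (compl \<Gamma>) (restrict x (compl \<Gamma>)) = enn2real (block_mass \<Gamma> x)"
proof -
  have "merge (compl \<Gamma>) \<Gamma> (restrict x (compl \<Gamma>), w) = override \<Gamma> w x" for w
    using G by (auto simp: fun_eq_iff override_apply merge_def)
  then have "marg (compl \<Gamma>) (restrict x (compl \<Gamma>)) = (\<integral> w. \<pi> (override \<Gamma> w x) \<partial>PiM \<Gamma> M)"
    by (simp add: marg_def compl_compl[OF G])
  also have "\<dots> = enn2real (block_mass \<Gamma> x)"
    unfolding block_mass_def
    by (intro integral_eq_nn_integral density_measurable_override G x AE_I2 density_nonneg override_space)
  finally show ?thesis .
qed

lemma regular_iff_marg:
  assumes G: "\<Gamma> \<subseteq> {1..n}" and x: "x \<in> space full_space"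
  shows "x \<in> regular \<Gamma> \<longleftrightarrow> marg (compl \<Gamma>) (restrict x (compl \<Gamma>)) > 0"
  unfolding marg_eq_block_mass[OF assms] regular_def using x by (auto simp: enn2real_positive_iff)

lemma marg_full: 
  assumes x: "x \<in> space full_space"
  shows "marg {1..n} x = \<pi> x"
proof -
  have "restrict x {1..n} = x" using x by (auto simp: space_PiM PiE_def extensional_restrict)
  moreover have "override {} w x = x" for w
    using x by (auto simp: override_apply fun_eq_iff space_PiM PiE_def extensional_def)
  ultimately have "block_mass {} x = ennreal (\<pi> x)"
    unfolding block_mass_def nn_integral_PiM_empty by simp
  with \<open>restrict x {1..n} = x\<close> show ?thesis
    using marg_eq_block_mass[of "{}" x] x density_nonneg[OF x] by simp
qed

lemma cond_law_eq:
  assumes G: "\<Gamma> \<subseteq> {1..n}" and x: "x \<in> regular \<Gamma>"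
  shows "cond_law \<Gamma> (compl \<Gamma>) (restrict x (compl \<Gamma>)) = density (PiM \<Gamma> M) (\<lambda>w. ennreal (\<pi> (override \<Gamma> w x)) / block_mass \<Gamma> x)"
  unfolding cond_law_def
proof (rule density_cong)
  note xs = regularD(1)[OF x]
  have "cond \<Gamma> (compl \<Gamma>) (restrict x (compl \<Gamma>)) w = \<pi> (override \<Gamma> w x) / enn2real (block_mass \<Gamma> x)"
    if "w \<in> space (PiM \<Gamma> M)" for w
  proof -
    have "merge (compl \<Gamma>) \<Gamma> (restrict x (compl \<Gamma>), w) = override \<Gamma> w x"
      using G by (auto simp: fun_eq_iff override_apply merge_def)
    moreover have "compl \<Gamma> \<union> \<Gamma> = {1..n}" using G by auto
    moreover have "marg (compl \<Gamma>) (restrict x (compl \<Gamma>)) > 0" using regular_iff_marg[OF G xs] x by simp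
    ultimately show ?thesis
      using marg_full[OF override_space[OF G that xs]] by (simp add: cond_def marg_eq_block_mass[OF G xs])
  qed
  note eq = this
  have eq': "ennreal (cond \<Gamma> (compl \<Gamma>) (restrict x (compl \<Gamma>)) w) = ennreal (\<pi> (override \<Gamma> w x)) / block_mass \<Gamma> x"
    if "w \<in> space (PiM \<Gamma> M)" for w
  proof -
    obtain d where "block_mass \<Gamma> x = ennreal d" "d > 0"
      using regularD[OF x] by (cases "block_mass \<Gamma> x") auto
    then show ?thesis
      using density_nonneg[OF override_space[OF G that xs]] by (simp add: eq[OF that] divide_ennreal)
  qed
  show m: "(\<lambda>w. ennreal (\<pi> (override \<Gamma> w x)) / block_mass \<Gamma> x) \<in> borel_measurable (PiM \<Gamma> M)"
    using density_measurable_override[OF G xs] by simp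
  show "(\<lambda>w. ennreal (cond \<Gamma> (compl \<Gamma>) (restrict x (compl \<Gamma>)) w)) \<in> borel_measurable (PiM \<Gamma> M)"
    by (subst measurable_cong[OF eq']) (auto intro: m)
  show "AE w in PiM \<Gamma> M. ennreal (cond \<Gamma> (compl \<Gamma>) (restrict x (compl \<Gamma>)) w) = ennreal (\<pi> (override \<Gamma> w x)) / block_mass \<Gamma> x"
    by (intro AE_I2 eq')
qed

lemma cond_ker_eq_distr:
  assumes G: "\<Gamma> \<subseteq> {1..n}" and x: "x \<in> regular \<Gamma>"
  shows "cond_ker \<Gamma> x = distr (cond_law \<Gamma> (compl \<Gamma>) (restrict x (compl \<Gamma>))) full_space (\<lambda>w. override \<Gamma> w x)"
  using x by (simp add: cond_law_eq[OF assms] cond_ker_def)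

lemma restrict_measurable: "S \<subseteq> {1..n} \<Longrightarrow> (\<lambda>x. restrict x S) \<in> full_space \<rightarrow>\<^sub>M PiM S M"
  by (rule measurable_restrict_subset)

text \<open>
  The chain on the coordinates outside \<open>\<Lambda>\<close> is transported to the full product space by filling in the
  coordinates \<open>y\<close>. There the update of a block is the kernel \<open>cond_ker\<close> at almost every point, so that
  the arbitrary default densities play no role.
\<close>

lemma gap_ge:
  assumes P: "poincare m l \<gamma>" and \<gamma>: "\<gamma> \<le> 1" and L: "\<Lambda> \<subseteq> {1..n}" and m: "card (compl \<Lambda>) = m" and l: "l \<le> m"
    and y: "y \<in> pos_points \<Lambda>"
  shows "gap \<Lambda> y l \<ge> ereal \<gamma>"
proof -
  define S where "S = compl \<Lambda>"
  have S: "S \<subseteq> {1..n}" and cS: "card S = m" and compS: "compl S = \<Lambda>" and disj: "S \<inter> \<Lambda> = {}" "\<Lambda> \<inter> S = {}"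
    using L m by (auto simp: S_def)
  have ys: "y \<in> space (PiM \<Lambda> M)" and my: "marg \<Lambda> y > 0" using y by (auto simp: pos_points_def)
  define j where "j z = merge \<Lambda> S (y, z)" for z
  have j_apply: "j z k = (if k \<in> \<Lambda> then y k else if k \<in> S then z k else undefined)" for z k
    by (simp add: j_def merge_def)
  have "space full_space \<noteq> {}"
    using prob_space.not_empty[OF density_prob] by simp
  then obtain x1 where x1: "x1 \<in> space full_space" by blast
  define x0 where "x0 = j x1"
  have "\<Lambda> \<union> S = {1..n}" using L by (auto simp: S_def)
  have x0s: "x0 \<in> space full_space"
    using x1 ys L S \<open>\<Lambda> \<union> S = {1..n}\<close> by (auto simp: space_PiM PiE_def Pi_def extensional_def x0_def j_apply)
  have rx0: "restrict x0 \<Lambda> = y"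
    using ys by (auto simp: space_PiM PiE_def x0_def j_apply fun_eq_iff extensional_def)
  have x0: "x0 \<in> regular S"
    using regular_iff_marg[OF S x0s] my by (simp add: compS rx0)
  have j_override: "j z = override S z x0" for z
    using L disj by (auto simp: fun_eq_iff override_apply j_apply x0_def S_def)
  have jm: "j \<in> PiM S M \<rightarrow>\<^sub>M full_space"
    using override_measurable[OF S x0s] by (simp add: j_override[abs_def])
  have js: "j z \<in> space full_space" if "z \<in> space (PiM S M)" for z
    using override_space[OF S that x0s] by (simp add: j_override)
  have res_j: "restrict (j z) S = z" if "z \<in> space (PiM S M)" for z
    using that disj by (auto simp: space_PiM PiE_def extensional_def j_apply fun_eq_iff)
  define \<nu> where "\<nu> = cond_law S \<Lambda> y"
  have sets\<nu>: "sets \<nu> = sets (PiM S M)" "space \<nu> = space (PiM S M)"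
    by (auto simp: \<nu>_def cond_law_def)
  have jm\<nu>: "j \<in> \<nu> \<rightarrow>\<^sub>M full_space" using jm by (simp add: measurable_cong_sets[OF sets\<nu>(1) refl])
  have cond_ker_x0: "cond_ker S x0 = distr \<nu> full_space j"
    using cond_ker_eq_distr[OF S x0] by (simp add: compS rx0 \<nu>_def j_override[abs_def])
  define c where "c = 1 - \<gamma>"
  have c: "c \<ge> 0" using \<gamma> by (simp add: c_def)
  have blk: "\<Gamma> \<subseteq> {1..n}" "\<Gamma> \<subseteq> S" if "\<Gamma> \<in> blocks S l" for \<Gamma> using that S by (auto simp: blocks_def)
  have fin: "finite (blocks S l)" using finite_blocks[OF finite_index_subset[OF S]] .
  have card: "card (blocks S l) = m choose l" using card_blocks[OF finite_index_subset[OF S]] cS by simp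
  have ne: "blocks S l \<noteq> {}" using card l by (metis binomial_eq_0_iff card.empty not_less)
  have update: "gibbs_update \<Lambda> y \<Gamma> z = distr (cond_ker \<Gamma> (j z)) (PiM S M) (\<lambda>x. restrict x S)"
    if "j z \<in> regular \<Gamma>" "\<Gamma> \<subseteq> S" for \<Gamma> z
  proof -
    have G: "\<Gamma> \<subseteq> {1..n}" using that S by auto
    have m: "(\<lambda>w. override \<Gamma> w (j z)) \<in> cond_law \<Gamma> (compl \<Gamma>) (restrict (j z) (compl \<Gamma>)) \<rightarrow>\<^sub>M full_space"
      using override_measurable[OF G regularD(1)[OF that(1)]] by (simp add: cond_law_def)
    show ?thesis
      unfolding cond_ker_eq_distr[OF G that(1)] distr_distr[OF restrict_measurable[OF S] m]
      by (simp add: gibbs_update_def Let_def comp_def override_def j_def S_def)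
  qed
  have "kernel_norm \<nu> (gibbs_kernel \<Lambda> y l) \<le> ennreal c"
    unfolding kernel_norm_def
  proof (rule SUP_least, clarify)
    fix f assume f: "f \<in> L2_zero \<nu>" and nz: "L2_norm \<nu> f \<noteq> 0"
    have fm: "f \<in> borel_measurable \<nu>" and fsq: "integrable \<nu> (\<lambda>x. (f x)\<^sup>2)" and mean: "(\<integral> x. f x \<partial>\<nu>) = 0"
      using f by (auto simp: L2_zero_def)
    have fmS: "f \<in> borel_measurable (PiM S M)" using fm by (simp add: measurable_cong_sets[OF sets\<nu>(1) refl])
    define g where "g x = f (restrict x S)" for x
    have gm[measurable]: "g \<in> borel_measurable full_space"
      unfolding g_def using measurable_compose[OF restrict_measurable[OF S] fmS] .
    have gj: "g (j z) = f z" if "z \<in> space \<nu>" for z using that by (simp add: g_def res_j sets\<nu>)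
    define s where "s = (\<integral>\<^sup>+ x. ennreal ((f x)\<^sup>2) \<partial>\<nu>)"
    have s: "s < \<infinity>" using fsq by (simp add: integrable_iff_bounded s_def)
    have sg: "(\<integral>\<^sup>+ z. ennreal ((g z)\<^sup>2) \<partial>cond_ker S x0) = s"
      unfolding cond_ker_x0 s_def by (subst nn_integral_distr[OF jm\<nu>]) (auto intro!: nn_integral_cong simp: gj)
    have mg: "(\<integral> z. g z \<partial>cond_ker S x0) = 0"
      unfolding cond_ker_x0 mean[symmetric]
      by (subst integral_distr[OF jm\<nu> gm]) (intro Bochner_Integration.integral_cong refl gj)
    note L2 = contraction_L2[OF P \<gamma> S cS l x0 gm _ mg, unfolded sg, OF s]
    have "AE z in \<nu>. \<forall>\<Gamma>\<in>blocks S l. j z \<in> regular \<Gamma> \<and> integrable (cond_ker \<Gamma> (j z)) g"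
      using L2(1) unfolding cond_ker_x0 by (rule AE_distrD[OF jm\<nu>])
    then have "AE z in \<nu>. kernel_op (gibbs_kernel \<Lambda> y l) f z = gibbs_avg S l g (j z)"
    proof eventually_elim
      case (elim z)
      have "kernel_op (gibbs_kernel \<Lambda> y l) f z =
          (\<integral> w. f w \<partial>(uniform_count_measure (blocks S l) \<bind> (\<lambda>\<Gamma>. gibbs_update \<Lambda> y \<Gamma> z)))"
        by (simp add: kernel_op_def gibbs_kernel_def blocks_def S_def)
      also have "\<dots> = (\<Sum>\<Gamma>\<in>blocks S l. \<integral> w. f w \<partial>gibbs_update \<Lambda> y \<Gamma> z) / real (card (blocks S l))"
      proof (rule integral_bind_uniform_count[OF fin ne, where N="PiM S M"])
        fix \<Gamma> assume G: "\<Gamma> \<in> blocks S l"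
        then have r: "j z \<in> regular \<Gamma>" and i: "integrable (cond_ker \<Gamma> (j z)) g" using elim by auto
        interpret prob_space "cond_ker \<Gamma> (j z)" using prob_space_cond_ker[OF blk(1)[OF G] regularD(1)[OF r]] .
        have rm: "(\<lambda>x. restrict x S) \<in> cond_ker \<Gamma> (j z) \<rightarrow>\<^sub>M PiM S M"
          using restrict_measurable[OF S] by (simp add: measurable_cong_sets[OF sets_cond_ker refl])
        show "prob_space (gibbs_update \<Lambda> y \<Gamma> z)"
          unfolding update[OF r blk(2)[OF G]] by (rule prob_space_distr[OF rm])
        show "sets (gibbs_update \<Lambda> y \<Gamma> z) = sets (PiM S M)"
          unfolding update[OF r blk(2)[OF G]] by simp
        show "integrable (gibbs_update \<Lambda> y \<Gamma> z) f"
          unfolding update[OF r blk(2)[OF G]] integrable_distr_eq[OF rm fmS] using i unfolding g_def[abs_def] .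
      qed
      also have "\<dots> = gibbs_avg S l g (j z)"
        unfolding gibbs_avg_def card cS
      proof (intro arg_cong2[where f="(/)"] sum.cong refl)
        fix \<Gamma> assume G: "\<Gamma> \<in> blocks S l"
        then have r: "j z \<in> regular \<Gamma>" using elim by auto
        have rm: "(\<lambda>x. restrict x S) \<in> cond_ker \<Gamma> (j z) \<rightarrow>\<^sub>M PiM S M"
          using restrict_measurable[OF S] by (simp add: measurable_cong_sets[OF sets_cond_ker refl])
        show "(\<integral> w. f w \<partial>gibbs_update \<Lambda> y \<Gamma> z) = cexp \<Gamma> g (j z)"
          unfolding update[OF r blk(2)[OF G]] integral_distr[OF rm fmS] cexp_def g_def ..
      qed
      finally show ?case .
    qed
    then have "AE z in \<nu>. ennreal ((kernel_op (gibbs_kernel \<Lambda> y l) f z)\<^sup>2) = ennreal ((gibbs_avg S l g (j z))\<^sup>2)"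
      by eventually_elim simp
    then have "(\<integral>\<^sup>+ z. ennreal ((kernel_op (gibbs_kernel \<Lambda> y l) f z)\<^sup>2) \<partial>\<nu>) = (\<integral>\<^sup>+ z. ennreal ((gibbs_avg S l g (j z))\<^sup>2) \<partial>\<nu>)"
      by (rule nn_integral_cong_AE)
    also have "\<dots> = (\<integral>\<^sup>+ z. ennreal ((gibbs_avg S l g z)\<^sup>2) \<partial>cond_ker S x0)"
    proof -
      have "gibbs_avg S l g \<in> borel_measurable full_space"
        unfolding gibbs_avg_def using cexp_measurable[OF blk(1) gm] by simp
      then show ?thesis unfolding cond_ker_x0 by (subst nn_integral_distr[OF jm\<nu>]) auto
    qed
    also have "\<dots> \<le> ennreal (c\<^sup>2) * s" using L2(2) by (simp add: c_def)
    finally have le: "(\<integral>\<^sup>+ z. ennreal ((kernel_op (gibbs_kernel \<Lambda> y l) f z)\<^sup>2) \<partial>\<nu>) \<le> ennreal (c\<^sup>2) * s" .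
    define r where "r = enn2real s"
    have r: "s = ennreal r" "r \<ge> 0" using s by (auto simp: r_def)
    define t where "t = (\<integral>\<^sup>+ z. ennreal ((kernel_op (gibbs_kernel \<Lambda> y l) f z)\<^sup>2) \<partial>\<nu>)"
    have t: "t \<le> ennreal (c\<^sup>2 * r)" using le r by (simp add: t_def ennreal_mult)
    then have "t < \<top>" by (rule order.strict_trans1) simp
    then have "L2_norm \<nu> (kernel_op (gibbs_kernel \<Lambda> y l) f) = ennreal (sqrt (enn2real t))"
      by (simp add: L2_norm_def Let_def t_def)
    also have "\<dots> \<le> ennreal (sqrt (c\<^sup>2 * r))"
      using t r by (intro ennreal_leI real_sqrt_le_mono enn2real_leI) auto
    also have "\<dots> = ennreal (sqrt r) * ennreal c"
      using c r by (simp add: real_sqrt_mult ennreal_mult mult.commute)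
    also have "ennreal (sqrt r) = L2_norm \<nu> f"
      using s r by (simp add: L2_norm_def Let_def flip: s_def)
    finally show "L2_norm \<nu> (kernel_op (gibbs_kernel \<Lambda> y l) f) / L2_norm \<nu> f \<le> ennreal c"
      using nz by (intro divide_le_posI_ennreal) (auto simp: zero_less_iff_neq_zero)
  qed
  then have "enn2ereal (kernel_norm \<nu> (gibbs_kernel \<Lambda> y l)) \<le> ereal c"
    using c by (metis enn2ereal_ennreal less_eq_ennreal.rep_eq)
  then have "1 - ereal c \<le> 1 - enn2ereal (kernel_norm \<nu> (gibbs_kernel \<Lambda> y l))"
    by (intro ereal_minus_mono) auto
  then show ?thesis
    by (simp add: gap_def spectral_gap_def \<nu>_def S_def c_def one_ereal_def)
qed

lemma Gap_ge:
  assumes P: "poincare m l \<gamma>" and \<gamma>: "\<gamma> \<le> 1" and m: "m \<le> n" and l: "l \<le> m"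
  shows "Gap m l \<ge> ereal \<gamma>"
proof -
  let ?A = "{\<Lambda>. \<Lambda> \<subseteq> {1..n} \<and> card \<Lambda> = n - m}"
  have "finite ?A" by (rule finite_subset[of _ "Pow {1..n}"]) auto
  moreover have "{1..n - m} \<in> ?A" by auto
  then have "?A \<noteq> {}" by blast
  moreover have "ereal \<gamma> \<le> (INF y \<in> pos_points \<Lambda>. gap \<Lambda> y l)" if "\<Lambda> \<in> ?A" for \<Lambda>
    using that m finite_index_subset[of \<Lambda>] by (intro INF_greatest gap_ge[OF P \<gamma> _ _ l]) (auto simp: card_Diff_subset)
  ultimately show ?thesis
    unfolding Gap_def by (subst Min_ge_iff) auto
qed

end

section \<open>Laws of single coordinates\<close>

text \<open>
  Integrals of a bounded function against two laws differ by at most twice the bound times the total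
  variation distance. Both laws have densities here, so the set where one density exceeds the other
  replaces the Hahn decomposition.
\<close>

lemma tv_integral_bound:
  fixes v :: "'b \<Rightarrow> real"
  assumes f[measurable]: "f \<in> borel_measurable N" "g \<in> borel_measurable N" and v[measurable]: "v \<in> borel_measurable N"
    and f0: "\<And>x. 0 \<le> f x" "\<And>x. 0 \<le> g x"
    and p: "prob_space (density N (\<lambda>x. ennreal (f x)))" "prob_space (density N (\<lambda>x. ennreal (g x)))"
    and B: "\<And>x. x \<in> space N \<Longrightarrow> \<bar>v x\<bar> \<le> B"
  defines "\<nu>1 \<equiv> density N (\<lambda>x. ennreal (f x))" and "\<nu>2 \<equiv> density N (\<lambda>x. ennreal (g x))"
  shows "\<bar>(\<integral> x. v x \<partial>\<nu>1) - (\<integral> x. v x \<partial>\<nu>2)\<bar> \<le> 2 * B * tv_dist \<nu>1 \<nu>2"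
proof -
  interpret p1: prob_space \<nu>1 unfolding \<nu>1_def by (rule p)
  interpret p2: prob_space \<nu>2 unfolding \<nu>2_def by (rule p)
  have mdens: "measure (density N (\<lambda>x. ennreal (h x))) A = (\<integral> x. h x * indicator A x \<partial>N)"
    if "h \<in> borel_measurable N" "\<And>x. 0 \<le> h x" "A \<in> sets N" for h :: "'b \<Rightarrow> real" and A
    using that by (subst integral_eq_nn_integral)
      (auto simp: measure_def emeasure_density intro!: arg_cong[where f=enn2real] nn_integral_cong split: split_indicator)
  have idens: "integrable N h" if "h \<in> borel_measurable N" "\<And>x. 0 \<le> h x" "prob_space (density N (\<lambda>x. ennreal (h x)))" for h :: "'b \<Rightarrow> real"
  proof (rule integrableI_nonneg)
    have "emeasure (density N (\<lambda>x. ennreal (h x))) (space N) = (\<integral>\<^sup>+ x. ennreal (h x) * indicator (space N) x \<partial>N)"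
      using that(1) by (intro emeasure_density) auto
    also have "\<dots> = (\<integral>\<^sup>+ x. ennreal (h x) \<partial>N)"
      by (rule nn_integral_cong) simp
    finally have "(\<integral>\<^sup>+ x. ennreal (h x) \<partial>N) = emeasure (density N (\<lambda>x. ennreal (h x))) (space N)" ..
    also have "\<dots> = 1" using prob_space.emeasure_space_1[OF that(3)] by simp
    finally show "(\<integral>\<^sup>+ x. ennreal (h x) \<partial>N) < \<infinity>" by simp
  qed (use that in auto)
  have fi: "integrable N f" and gi: "integrable N g" using idens[OF f(1) f0(1) p(1)] idens[OF f(2) f0(2) p(2)] by this+
  have bdd: "\<bar>measure \<nu>1 A - measure \<nu>2 A\<bar> \<le> tv_dist \<nu>1 \<nu>2" if "A \<in> sets N" for A
    unfolding tv_dist_def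
  proof (rule cSUP_upper)
    show "A \<in> sets \<nu>1" using that by (simp add: \<nu>1_def)
    have "\<bar>measure \<nu>1 A - measure \<nu>2 A\<bar> \<le> 1" for A
      using p1.prob_le_1[of A] p2.prob_le_1[of A] measure_nonneg[of \<nu>1 A] measure_nonneg[of \<nu>2 A] by linarith
    then show "bdd_above ((\<lambda>A. \<bar>measure \<nu>1 A - measure \<nu>2 A\<bar>) ` sets \<nu>1)" by (intro bdd_aboveI2[of _ _ 1])
  qed
  define A where "A = {x \<in> space N. g x < f x}"
  have A[measurable]: "A \<in> sets N" unfolding A_def by measurable
  have I: "integrable N (\<lambda>x. h x * indicator C x)" if "integrable N h" "C \<in> sets N" for h :: "'b \<Rightarrow> real" and C
    using integrable_mult_indicator[OF that(2,1)] by (simp add: mult.commute)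
  have "space N \<noteq> {}" using p1.not_empty by (simp add: \<nu>1_def)
  then have B0: "B \<ge> 0" using B by (meson abs_ge_zero ex_in_conv order_trans)
  have vf: "integrable N (\<lambda>x. f x * v x)"
    by (rule Bochner_Integration.integrable_bound[OF integrable_mult_left[OF fi, of B]])
      (use B f0 B0 in \<open>auto simp: abs_mult intro!: AE_I2 mult_left_mono\<close>)
  have vg: "integrable N (\<lambda>x. g x * v x)"
    by (rule Bochner_Integration.integrable_bound[OF integrable_mult_left[OF gi, of B]])
      (use B f0 B0 in \<open>auto simp: abs_mult intro!: AE_I2 mult_left_mono\<close>)
  have "(\<integral> x. v x \<partial>\<nu>1) - (\<integral> x. v x \<partial>\<nu>2) = (\<integral> x. f x * v x \<partial>N) - (\<integral> x. g x * v x \<partial>N)"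
    unfolding \<nu>1_def \<nu>2_def using f0 by (simp add: integral_real_density)
  also have "\<dots> = (\<integral> x. f x * v x - g x * v x \<partial>N)"
    using vf vg by simp
  finally have "\<bar>(\<integral> x. v x \<partial>\<nu>1) - (\<integral> x. v x \<partial>\<nu>2)\<bar> \<le> (\<integral> x. \<bar>f x * v x - g x * v x\<bar> \<partial>N)"
    by (simp only:) (rule integral_abs_bound)
  also have "\<dots> \<le> (\<integral> x. B * \<bar>f x - g x\<bar> \<partial>N)"
  proof (rule integral_mono)
    show "\<bar>f x * v x - g x * v x\<bar> \<le> B * \<bar>f x - g x\<bar>" if "x \<in> space N" for x
      using mult_right_mono[OF B[OF that], of "\<bar>f x - g x\<bar>"]
      by (simp add: abs_mult[symmetric] right_diff_distrib mult.commute)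
  qed (use vf vg fi gi in auto)
  finally have *: "\<bar>(\<integral> x. v x \<partial>\<nu>1) - (\<integral> x. v x \<partial>\<nu>2)\<bar> \<le> B * (\<integral> x. \<bar>f x - g x\<bar> \<partial>N)" by simp
  have "(\<integral> x. \<bar>f x - g x\<bar> \<partial>N) = (\<integral> x. (f x * indicator A x - g x * indicator A x) 
      + (g x * indicator (space N - A) x - f x * indicator (space N - A) x) \<partial>N)"
    by (intro Bochner_Integration.integral_cong) (auto simp: A_def split: split_indicator)
  also have "\<dots> = (measure \<nu>1 A - measure \<nu>2 A) + (measure \<nu>2 (space N - A) - measure \<nu>1 (space N - A))"
    unfolding \<nu>1_def \<nu>2_def using f0 I fi gi by (simp add: mdens)
  also have "\<dots> \<le> tv_dist \<nu>1 \<nu>2 + tv_dist \<nu>1 \<nu>2"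
    using bdd[of A] bdd[of "space N - A"] by (intro add_mono) (auto simp: abs_le_iff)
  finally have "B * (\<integral> x. \<bar>f x - g x\<bar> \<partial>N) \<le> B * (tv_dist \<nu>1 \<nu>2 + tv_dist \<nu>1 \<nu>2)"
    using B0 by (rule mult_left_mono)
  with * show ?thesis by (simp add: algebra_simps)
qed

context gibbs_setting
begin

lemma upd_measurable:
  assumes j: "j \<in> {1..n}" and x: "x \<in> space full_space"
  shows "(\<lambda>a. x(j := a)) \<in> M j \<rightarrow>\<^sub>M full_space"
proof (rule measurable_PiM_single')
  fix i assume i: "i \<in> {1..n}"
  have "x i \<in> space (M i)" using x i by (auto simp: space_PiM)
  then show "(\<lambda>a. (x(j := a)) i) \<in> M j \<rightarrow>\<^sub>M M i"
    by (cases "i = j") auto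
next
  show "(\<lambda>a. x(j := a)) \<in> space (M j) \<rightarrow> (\<Pi>\<^sub>E i\<in>{1..n}. space (M i))"
    using x j by (auto simp: space_PiM PiE_def Pi_def extensional_def)
qed

lemma upd_space: "j \<in> {1..n} \<Longrightarrow> x \<in> space full_space \<Longrightarrow> a \<in> space (M j) \<Longrightarrow> x(j := a) \<in> space full_space"
  using measurable_space[OF upd_measurable] .

lemma coord_measurable: "j \<in> {1..n} \<Longrightarrow> (\<lambda>z. z j) \<in> full_space \<rightarrow>\<^sub>M M j"
  by (rule measurable_component_singleton)

lemma override_single:
  assumes "j \<in> {1..n}" "x \<in> space full_space"
  shows "override {j} t x = x(j := t j)"
  using assms by (auto simp: fun_eq_iff override_apply space_PiM PiE_def extensional_def)

text \<open>
  Integrating a function of the coordinate \<open>j\<close> over the block \<open>S\<close>, the other coordinates of \<open>S\<close> first.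
\<close>

lemma nn_integral_coord:
  assumes S: "S \<subseteq> {1..n}" and j: "j \<in> S" and x: "x \<in> space full_space" and h: "h \<in> borel_measurable (M j)"
  shows "(\<integral>\<^sup>+ w. h (w j) * ennreal (\<pi> (override S w x)) \<partial>PiM S M)
     = (\<integral>\<^sup>+ a. h a * block_mass (S - {j}) (x(j := a)) \<partial>M j)"
proof -
  let ?T = "S - {j}"
  have jI: "j \<in> {1..n}" and T: "?T \<subseteq> {1..n}" "?T \<subseteq> S" and ST: "S - ?T = {j}" using S j by auto
  note [measurable] = density_measurable measurable_compose[OF coord_measurable[OF jI] h]
  have "(\<integral>\<^sup>+ w. h (w j) * ennreal (\<pi> (override S w x)) \<partial>PiM S M) 
      = (\<integral>\<^sup>+ w. h (override S w x j) * ennreal (\<pi> (override S w x)) \<partial>PiM S M)"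
    using j by (simp add: override_apply)
  also have "\<dots> = (\<integral>\<^sup>+ t. \<integral>\<^sup>+ g. h (override ?T g (override {j} t x) j) * ennreal (\<pi> (override ?T g (override {j} t x))) \<partial>PiM ?T M \<partial>PiM {j} M)"
    using nn_integral_split[OF S T(2) x, of "\<lambda>z. h (z j) * ennreal (\<pi> z)"] ST by simp
  also have "\<dots> = (\<integral>\<^sup>+ t. \<integral>\<^sup>+ g. h (t j) * ennreal (\<pi> (override ?T g (x(j := t j)))) \<partial>PiM ?T M \<partial>PiM {j} M)"
    using jI by (simp add: override_single x override_apply)
  also have "\<dots> = (\<integral>\<^sup>+ t. h (t j) * block_mass ?T (x(j := t j)) \<partial>PiM {j} M)"
  proof (rule nn_integral_cong)
    fix t assume "t \<in> space (PiM {j} M)"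
    then have "x(j := t j) \<in> space full_space"
      using upd_space[OF jI x] by (auto simp: space_PiM)
    then show "(\<integral>\<^sup>+ g. h (t j) * ennreal (\<pi> (override ?T g (x(j := t j)))) \<partial>PiM ?T M) = h (t j) * block_mass ?T (x(j := t j))"
      unfolding block_mass_def using density_measurable_override[OF T(1)] by (intro nn_integral_cmult) auto
  qed
  also have "\<dots> = (\<integral>\<^sup>+ a. h a * block_mass ?T (x(j := a)) \<partial>M j)"
    using h measurable_compose[OF upd_measurable[OF jI x] block_mass_measurable[OF T(1)]]
    by (intro nn_integral_PiM_singleton[OF jI]) auto
  finally show ?thesis .
qed

text \<open>
  The conditional law of one coordinate is a marginal of the conditional law of the block. The two can
  differ only through the set where the block mass is infinite, which is null.
\<close>

lemma coord_law_eq: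
  assumes S: "S \<subseteq> {1..n}" and j: "j \<in> S" and x: "x \<in> regular S"
  shows "coord_law j (compl S) (restrict x (compl S)) = distr (cond_ker S x) (M j) (\<lambda>z. z j)" (is ?A)
    and "\<exists>h \<in> borel_measurable (M j). (\<forall>a. 0 \<le> h a) \<and>
      coord_law j (compl S) (restrict x (compl S)) = density (M j) (\<lambda>a. ennreal (h a))" (is ?B)
proof -
  let ?T = "S - {j}"
  have jI: "j \<in> {1..n}" and T: "?T \<subseteq> {1..n}" "?T \<subseteq> S" and ST: "S - ?T = {j}" using S j by auto
  note xs = regularD(1)[OF x]
  have dm[measurable]: "(\<lambda>a. block_mass ?T (x(j := a))) \<in> borel_measurable (M j)"
    using measurable_compose[OF upd_measurable[OF jI xs] block_mass_measurable[OF T(1)]] .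
  obtain d where d: "block_mass S x = ennreal d" "d > 0"
    using regularD[OF x] by (cases "block_mass S x") auto
  have mp: "marg (compl S) (restrict x (compl S)) = d"
    using marg_eq_block_mass[OF S xs] d by simp
  define h where "h a = enn2real (block_mass ?T (x(j := a))) / d" for a
  have hm[measurable]: "h \<in> borel_measurable (M j)" unfolding h_def by measurable
  have h0: "0 \<le> h a" for a using d by (simp add: h_def)
  have "cond {j} (compl S) (restrict x (compl S)) (\<lambda>k\<in>{j}. a) = h a" if a: "a \<in> space (M j)" for a
  proof -
    have "compl S \<union> {j} = compl ?T" using j jI by auto
    moreover have "merge (compl S) {j} (restrict x (compl S), \<lambda>k\<in>{j}. a) = restrict (x(j := a)) (compl ?T)"
      using j jI by (auto simp: fun_eq_iff merge_def)
    ultimately show ?thesis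
      using marg_eq_block_mass[OF T(1) upd_space[OF jI xs a]] d by (simp add: cond_def mp h_def)
  qed
  then have eq: "ennreal (cond {j} (compl S) (restrict x (compl S)) (\<lambda>k\<in>{j}. a)) = ennreal (h a)"
    if "a \<in> space (M j)" for a using that by simp
  have cl: "coord_law j (compl S) (restrict x (compl S)) = density (M j) (\<lambda>a. ennreal (h a))"
    unfolding coord_law_def
  proof (rule density_cong)
    show m: "(\<lambda>a. ennreal (h a)) \<in> borel_measurable (M j)" by measurable
    show "(\<lambda>a. ennreal (cond {j} (compl S) (restrict x (compl S)) (\<lambda>k\<in>{j}. a))) \<in> borel_measurable (M j)"
      by (subst measurable_cong[OF eq]) (auto intro: m)
  qed (intro AE_I2 eq)
  with hm h0 show ?B by blast
  have total: "(\<integral>\<^sup>+ a. block_mass ?T (x(j := a)) \<partial>M j) = block_mass S x"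
    using nn_integral_coord[OF S j xs, of "\<lambda>_. 1"] by (simp add: block_mass_def)
  have fin: "AE a in M j. block_mass ?T (x(j := a)) \<noteq> \<infinity>"
    by (rule nn_integral_PInf_AE) (use regularD[OF x] in \<open>auto simp: total\<close>)
  have cm: "(\<lambda>z. z j) \<in> cond_ker S x \<rightarrow>\<^sub>M M j"
    using coord_measurable[OF jI] by (simp add: measurable_cong_sets[OF sets_cond_ker refl])
  show ?A
    unfolding cl
  proof (rule measure_eqI)
    fix A assume "A \<in> sets (density (M j) (\<lambda>a. ennreal (h a)))"
    then have A[measurable]: "A \<in> sets (M j)" by simp
    have Am: "(\<lambda>z. indicator A (z j) :: ennreal) \<in> borel_measurable full_space"
      by (rule measurable_compose[OF coord_measurable[OF jI]]) measurable
    have "emeasure (distr (cond_ker S x) (M j) (\<lambda>z. z j)) A = (\<integral>\<^sup>+ z. indicator A (z j) \<partial>cond_ker S x)"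
      using nn_integral_distr[OF cm, of "indicator A"] by (simp add: A)
    also have "\<dots> = (\<integral>\<^sup>+ w. indicator A (w j) * ennreal (\<pi> (override S w x)) \<partial>PiM S M) / block_mass S x"
      unfolding nn_integral_cond_ker[OF S x Am] using j by (simp add: override_apply)
    also have "\<dots> = (\<integral>\<^sup>+ a. indicator A a * block_mass ?T (x(j := a)) \<partial>M j) / block_mass S x"
      by (simp add: nn_integral_coord[OF S j xs])
    also have "\<dots> = (\<integral>\<^sup>+ a. indicator A a * block_mass ?T (x(j := a)) / block_mass S x \<partial>M j)"
      by (rule nn_integral_divide[symmetric]) measurable
    also have "\<dots> = (\<integral>\<^sup>+ a. ennreal (h a) * indicator A a \<partial>M j)"
    proof (rule nn_integral_cong_AE)
      show "AE a in M j. indicator A a * block_mass ?T (x(j := a)) / block_mass S x = ennreal (h a) * indicator A a"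
        using fin
      proof eventually_elim
        case (elim a)
        then obtain e where "block_mass ?T (x(j := a)) = ennreal e" "e \<ge> 0" by (cases "block_mass ?T (x(j := a))") auto
        then show ?case using d by (simp add: h_def divide_ennreal split: split_indicator)
      qed
    qed
    also have "\<dots> = emeasure (density (M j) (\<lambda>a. ennreal (h a))) A"
      by (simp add: emeasure_density)
    finally show "emeasure (density (M j) (\<lambda>a. ennreal (h a))) A = emeasure (distr (cond_ker S x) (M j) (\<lambda>z. z j)) A" ..
  qed simp
qed

lemma AE_coord_law_iff:
  assumes S: "S \<subseteq> {1..n}" and j: "j \<in> S" and x: "x \<in> regular S" and P: "{a \<in> space (M j). P a} \<in> sets (M j)"
  shows "(AE a in coord_law j (compl S) (restrict x (compl S)). P a) \<longleftrightarrow> (AE z in cond_ker S x. P (z j))"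
proof -
  have jI: "j \<in> {1..n}" using S j by auto
  have cm: "(\<lambda>z. z j) \<in> cond_ker S x \<rightarrow>\<^sub>M M j"
    using coord_measurable[OF jI] by (simp add: measurable_cong_sets[OF sets_cond_ker refl])
  show ?thesis
    unfolding coord_law_eq(1)[OF S j x] by (rule AE_distr_iff[OF cm P])
qed

text \<open>
  The influenced law is a conditional coordinate law with \<open>i\<close> added to the conditioning coordinates.
\<close>

lemma influenced_law_eq:
  assumes S: "S \<subseteq> {1..n}" and i: "i \<in> S" 
  shows "influenced_law (compl S) (restrict x (compl S)) i a j
      = coord_law j (compl (S - {i})) (restrict (x(i := a)) (compl (S - {i})))"
proof -
  have "insert i (compl S) = compl (S - {i})" using S i by auto
  moreover have "(restrict x (compl S))(i := a) = restrict (x(i := a)) (compl (S - {i}))"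
    using S i by (auto simp: fun_eq_iff)
  ultimately show ?thesis by (simp add: influenced_law_def)
qed

lemma AE_cond_ker_cond_ker:
  assumes S: "S \<subseteq> {1..n}" and G: "\<Gamma> \<subseteq> S" and x: "x \<in> regular S" and N: "N \<in> sets full_space"
    and AE: "AE z in cond_ker S x. z \<notin> N"
  shows "AE z in cond_ker S x. emeasure (cond_ker \<Gamma> z) N = 0"
proof -
  have GI: "\<Gamma> \<subseteq> {1..n}" using S G by auto
  have m: "(\<lambda>z. emeasure (cond_ker \<Gamma> z) N) \<in> borel_measurable full_space"
    using measurable_compose[OF cond_ker_measurable[OF GI] measurable_emeasure_subprob_algebra[OF N]] .
  have "(\<integral>\<^sup>+ z. (\<integral>\<^sup>+ z'. indicator N z' \<partial>cond_ker \<Gamma> z) \<partial>cond_ker S x) = (\<integral>\<^sup>+ z. indicator N z \<partial>cond_ker S x)"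
    using N by (intro nn_integral_cond_ker_cond_ker[OF S G x]) auto
  also have "\<dots> = (\<integral>\<^sup>+ z. 0 \<partial>cond_ker S x)"
    using AE by (intro nn_integral_cong_AE) auto
  finally have "(\<integral>\<^sup>+ z. emeasure (cond_ker \<Gamma> z) N \<partial>cond_ker S x) = 0" using N by simp
  then show ?thesis
    by (subst (asm) nn_integral_0_iff_AE) (auto simp: measurable_cong_sets[OF sets_cond_ker refl] m)
qed

end

section \<open>Growth of the powers of an influence matrix\<close>

lemma convex_bounded_decreasing:
  fixes b :: "nat \<Rightarrow> real"
  assumes conv: "\<And>t. 2 * b (Suc t) \<le> b t + b (Suc (Suc t))" and bd: "\<And>t. b t \<le> K"
  shows "b (Suc 0) \<le> b 0"
proof (rule ccontr)
  define \<delta> where "\<delta> = b (Suc 0) - b 0"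
  assume "\<not> b (Suc 0) \<le> b 0"
  then have \<delta>: "\<delta> > 0" by (simp add: \<delta>_def)
  have inc: "b (Suc t) - b t \<ge> \<delta>" for t
  proof (induction t)
    case 0 show ?case by (simp add: \<delta>_def)
  next
    case (Suc t) then show ?case using conv[of t] by linarith
  qed
  have lin: "b t \<ge> b 0 + real t * \<delta>" for t
  proof (induction t)
    case (Suc t) then show ?case using inc[of t] by (simp add: algebra_simps)
  qed simp
  obtain t :: nat where "real t > (K - b 0) / \<delta>" using reals_Archimedean2 by blast
  then have "real t * \<delta> > K - b 0" using \<delta> by (simp add: pos_divide_less_eq)
  then show False using lin[of t] bd[of t] by linarith
qed

lemma index_mat_enum:
  assumes "finite S"
  shows "bij_betw (\<lambda>a. sorted_list_of_set S ! a) {..<card S} S"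
  using assms bij_betw_nth[of "sorted_list_of_set S" "{..<card S}" S] by simp

lemma matrix_radius_nonneg:
  assumes "finite S" "S \<noteq> {}"
  shows "0 \<le> matrix_radius S \<Phi>"
proof -
  have "map_mat complex_of_real (index_mat S \<Phi>) \<in> carrier_mat (card S) (card S)"
    by (simp add: index_mat_def)
  moreover have "card S > 0" using assms by (simp add: card_gt_0_iff)
  ultimately have "matrix_radius S \<Phi> \<in> norm ` spectrum (map_mat complex_of_real (index_mat S \<Phi>))"
    unfolding matrix_radius_def by (rule spectral_radius_mem_max(1))
  then show ?thesis by auto
qed

text \<open>
  Iterating a matrix on a vector grows at most like the powers of any \<open>\<rho>\<close> above the spectral radius. The
  powers of a complex matrix of spectral radius below \<open>1\<close> are bounded; this is applied to the matrix
  divided by \<open>\<rho>\<close>.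
\<close>

lemma matrix_radius_growth:
  fixes \<Phi> :: "nat \<Rightarrow> nat \<Rightarrow> real" and h :: "nat \<Rightarrow> real"
  assumes S: "finite S" "S \<noteq> {}" and r: "matrix_radius S \<Phi> < \<rho>"
  defines "F \<equiv> \<lambda>h i. \<Sum>j\<in>S. \<Phi> i j * h j"
  shows "\<exists>C\<ge>0. \<forall>t. \<forall>i\<in>S. \<bar>(F ^^ t) h i\<bar> \<le> C * \<rho> ^ t"
proof -
  define m where "m = card S"
  have m: "m > 0" using S by (simp add: m_def card_gt_0_iff)
  define e where "e a = sorted_list_of_set S ! a" for a
  have e: "bij_betw e {0..<m} S"
    using index_mat_enum[OF S(1)] unfolding e_def m_def atLeast0LessThan .
  have \<rho>: "\<rho> > 0" using matrix_radius_nonneg[OF S] r by (rule order.strict_trans1)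
  define A where "A = map_mat complex_of_real (index_mat S \<Phi>)"
  define B where "B = Matrix.mat m m (\<lambda>(a, b). complex_of_real (\<Phi> (e a) (e b) / \<rho>))"
  have A: "A \<in> carrier_mat m m" and B: "B \<in> carrier_mat m m" by (simp_all add: A_def B_def index_mat_def m_def)
  have AB: "A $$ (a, b) = complex_of_real \<rho> * B $$ (a, b)" if "a < m" "b < m" for a b
    using that \<rho> by (simp add: A_def B_def index_mat_def m_def e_def)
  have "Spectral_Radius.spectral_radius B < 1"
  proof -
    obtain k where k: "k \<in> spectrum B" "Spectral_Radius.spectral_radius B = norm k"
      using spectral_radius_mem_max(1)[OF B m] by auto
    then obtain v where v: "v \<in> carrier_vec m" "v \<noteq> 0\<^sub>v m" "B *\<^sub>v v = k \<cdot>\<^sub>v v"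
      using B by (auto simp: spectrum_def eigenvalue_def eigenvector_def)
    have "A *\<^sub>v v = (complex_of_real \<rho> * k) \<cdot>\<^sub>v v"
    proof (rule eq_vecI)
      fix a assume "a < dim_vec ((complex_of_real \<rho> * k) \<cdot>\<^sub>v v)"
      then have a: "a < m" using v by simp
      have "(A *\<^sub>v v) $ a = (\<Sum>b = 0..<m. A $$ (a, b) * v $ b)"
        using a A v(1) by (simp add: scalar_prod_def)
      also have "\<dots> = complex_of_real \<rho> * (\<Sum>b = 0..<m. B $$ (a, b) * v $ b)"
        using a by (simp add: AB sum_distrib_left mult.assoc)
      also have "(\<Sum>b = 0..<m. B $$ (a, b) * v $ b) = (B *\<^sub>v v) $ a"
        using a B v(1) by (simp add: scalar_prod_def)
      finally show "(A *\<^sub>v v) $ a = ((complex_of_real \<rho> * k) \<cdot>\<^sub>v v) $ a"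
        using a v by simp
    qed (use A v in auto)
    then have "complex_of_real \<rho> * k \<in> spectrum A"
      using v A by (auto simp: spectrum_def eigenvalue_def eigenvector_def)
    then have "norm (complex_of_real \<rho> * k) \<le> matrix_radius S \<Phi>"
      unfolding matrix_radius_def A_def[symmetric] by (intro spectral_radius_mem_max(2)[OF A m]) auto
    then have "\<rho> * norm k \<le> matrix_radius S \<Phi>" using \<rho> by (simp add: norm_mult)
    then have "\<rho> * norm k < \<rho> * 1" using r by linarith
    then show ?thesis using k \<rho> mult_less_cancel_left_pos[of \<rho> "norm k" 1] by metis
  qed
  from spectral_radius_jnf_norm_bound_less_1_upper_triangular[OF B this]
  obtain c where c: "\<And>t. norm_bound (B ^\<^sub>m t) c" by auto
  define w where "w t = Matrix.vec m (\<lambda>a. complex_of_real ((F ^^ t) h (e a) / \<rho> ^ t))" for t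
  have w: "w t \<in> carrier_vec m" for t by (simp add: w_def)
  have w_Suc: "w (Suc t) = B *\<^sub>v w t" for t
  proof (rule eq_vecI)
    fix a assume "a < dim_vec (B *\<^sub>v w t)"
    then have a: "a < m" using B by simp
    have "(B *\<^sub>v w t) $ a = (\<Sum>b = 0..<m. B $$ (a, b) * w t $ b)"
      using a B w[of t] by (simp add: scalar_prod_def)
    also have "\<dots> = complex_of_real ((\<Sum>b = 0..<m. \<Phi> (e a) (e b) * (F ^^ t) h (e b)) / \<rho> ^ Suc t)"
      using a by (simp add: B_def w_def sum_divide_distrib)
    also have "(\<Sum>b = 0..<m. \<Phi> (e a) (e b) * (F ^^ t) h (e b)) = (F ^^ Suc t) h (e a)"
      using sum.reindex_bij_betw[OF e, of "\<lambda>j. \<Phi> (e a) j * (F ^^ t) h j"] by (simp add: F_def)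
    finally show "w (Suc t) $ a = (B *\<^sub>v w t) $ a" using a by (simp add: w_def)
  qed (use B w in \<open>auto simp: w_def\<close>)
  have comm: "B * B ^\<^sub>m t = B ^\<^sub>m t * B" for t
  proof (induction t)
    case 0 then show ?case using B by simp
  next
    case (Suc t)
    have "B * (B ^\<^sub>m t * B) = (B * B ^\<^sub>m t) * B"
      using B by (intro assoc_mult_mat[symmetric]) auto
    then show ?case using Suc by simp
  qed
  have w_pow: "w t = B ^\<^sub>m t *\<^sub>v w 0" for t
  proof (induction t)
    case 0 then show ?case using B w[of 0] by simp
  next
    case (Suc t)
    have "w (Suc t) = (B * B ^\<^sub>m t) *\<^sub>v w 0"
      unfolding w_Suc Suc using B w by (intro assoc_mult_mat_vec[symmetric]) auto
    then show ?case by (simp add: comm)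
  qed
  define W where "W = (\<Sum>b = 0..<m. norm (w 0 $ b))"
  have W: "W \<ge> 0" by (simp add: W_def sum_nonneg)
  have bound: "norm (w t $ a) \<le> \<bar>c\<bar> * W" if a: "a < m" for t a
  proof -
    have "norm (w t $ a) = norm (\<Sum>b = 0..<m. (B ^\<^sub>m t) $$ (a, b) * w 0 $ b)"
      unfolding w_pow[of t] using a B w[of 0] by (simp add: scalar_prod_def)
    also have "\<dots> \<le> (\<Sum>b = 0..<m. norm ((B ^\<^sub>m t) $$ (a, b)) * norm (w 0 $ b))"
      by (rule order_trans[OF norm_sum]) (simp add: norm_mult)
    also have "\<dots> \<le> (\<Sum>b = 0..<m. \<bar>c\<bar> * norm (w 0 $ b))"
    proof (intro sum_mono mult_right_mono)
      fix b assume "b \<in> {0..<m}"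
      then have "norm ((B ^\<^sub>m t) $$ (a, b)) \<le> c"
        using c[of t, unfolded norm_bound_def, rule_format, of a b] a B by simp
      then show "norm ((B ^\<^sub>m t) $$ (a, b)) \<le> \<bar>c\<bar>" by linarith
    qed simp
    finally show ?thesis by (simp add: W_def sum_distrib_left)
  qed
  show ?thesis
  proof (intro exI[of _ "\<bar>c\<bar> * W"] conjI allI ballI)
    show "\<bar>c\<bar> * W \<ge> 0" using W by simp
    fix t i assume "i \<in> S"
    then obtain a where a: "a < m" "i = e a" using e by (auto simp: bij_betw_def)
    then show "\<bar>(F ^^ t) h i\<bar> \<le> \<bar>c\<bar> * W * \<rho> ^ t"
      using bound[OF a(1), of t] \<rho> by (simp add: w_def norm_divide norm_power pos_divide_le_eq del: of_real_divide of_real_power)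
  qed
qed

context gibbs_setting
begin

section \<open>The influence operator\<close>

text \<open>
  Bounded measurable functions of the single coordinate \<open>i\<close>.
\<close>

definition coord_bdd :: "nat \<Rightarrow> ('a \<Rightarrow> real) \<Rightarrow> bool" where
  "coord_bdd i v \<longleftrightarrow> v \<in> borel_measurable (M i) \<and> (\<exists>B. \<forall>a \<in> space (M i). \<bar>v a\<bar> \<le> B)"

lemma bdd_meas_lift: "i \<in> {1..n} \<Longrightarrow> coord_bdd i v \<Longrightarrow> bdd_meas (\<lambda>z. v (z i))"
proof -
  assume i: "i \<in> {1..n}" and v: "coord_bdd i v"
  then obtain B where B: "\<And>a. a \<in> space (M i) \<Longrightarrow> \<bar>v a\<bar> \<le> B" and vm: "v \<in> borel_measurable (M i)"
    unfolding coord_bdd_def by blast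
  show ?thesis
    by (rule bdd_measI[of _ B, OF measurable_compose[OF coord_measurable[OF i] vm]])
      (intro B measurable_space[OF coord_measurable[OF i]])
qed

lemma coord_bdd_sum: "(\<And>k. k \<in> K \<Longrightarrow> coord_bdd i (v k)) \<Longrightarrow> coord_bdd i (\<lambda>a. \<Sum>k\<in>K. v k a)"
proof -
  assume v: "\<And>k. k \<in> K \<Longrightarrow> coord_bdd i (v k)"
  then obtain B where B: "\<And>k a. k \<in> K \<Longrightarrow> a \<in> space (M i) \<Longrightarrow> \<bar>v k a\<bar> \<le> B k"
    unfolding coord_bdd_def by metis
  have "\<bar>\<Sum>k\<in>K. v k a\<bar> \<le> (\<Sum>k\<in>K. B k)" if "a \<in> space (M i)" for a
    by (rule order_trans[OF sum_abs sum_mono]) (rule B[OF _ that])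
  moreover have "(\<lambda>a. \<Sum>k\<in>K. v k a) \<in> borel_measurable (M i)"
    using v by (intro borel_measurable_sum) (simp add: coord_bdd_def)
  ultimately show ?thesis unfolding coord_bdd_def by blast
qed

lemma bdd_meas_imp_coord_bdd_upd:
  assumes "i \<in> {1..n}" "x \<in> space full_space" "bdd_meas F"
  shows "coord_bdd i (\<lambda>a. F (x(i := a)))"
proof -
  obtain B where B: "\<And>z. z \<in> space full_space \<Longrightarrow> \<bar>F z\<bar> \<le> B" using bdd_meas_bound[OF assms(3)] by metis
  have "\<forall>a \<in> space (M i). \<bar>F (x(i := a))\<bar> \<le> B"
    by (intro ballI B upd_space assms(1,2))
  then show ?thesis
    unfolding coord_bdd_def using measurable_compose[OF upd_measurable[OF assms(1,2)] bdd_measD[OF assms(3)]] by blast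
qed

lemma ae_pairs_sum:
  assumes "finite K" "\<And>k. k \<in> K \<Longrightarrow> ae_pairs \<nu> (\<lambda>a b. P k a b)"
  shows "ae_pairs \<nu> (\<lambda>a b. \<forall>k\<in>K. P k a b)"
proof -
  from assms(2) have "\<forall>k\<in>K. \<exists>N\<in>null_sets \<nu>. \<forall>a \<in> space \<nu> - N. \<forall>b \<in> space \<nu> - N. P k a b"
    by (auto simp: ae_pairs_def)
  then obtain N where N: "\<And>k. k \<in> K \<Longrightarrow> N k \<in> null_sets \<nu>"
      "\<And>k a b. k \<in> K \<Longrightarrow> a \<in> space \<nu> - N k \<Longrightarrow> b \<in> space \<nu> - N k \<Longrightarrow> P k a b"
    by metis
  have "(\<Union>k\<in>K. N k) \<in> null_sets \<nu>"
    using assms(1) N(1) by (intro null_sets.finite_UN) auto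
  then show ?thesis
    unfolding ae_pairs_def using N(2) by (intro bexI[of _ "\<Union>k\<in>K. N k"]) auto
qed

text \<open>
  From here on \<open>S\<close> is the set of free coordinates and \<open>x\<close> is a regular point whose coordinates outside
  \<open>S\<close> are the condition. \<open>law i\<close> is the conditional law of \<open>X\<^sub>i\<close>, and \<open>infl i a j\<close> that of \<open>X\<^sub>j\<close> if moreover
  \<open>X\<^sub>i = a\<close>.
\<close>

context
  fixes S :: "nat set" and x :: "nat \<Rightarrow> 'a"
  assumes S: "S \<subseteq> {1..n}" and x: "x \<in> regular S"
begin

abbreviation law :: "nat \<Rightarrow> 'a measure" where
  "law i \<equiv> coord_law i (compl S) (restrict x (compl S))"

abbreviation infl :: "nat \<Rightarrow> 'a \<Rightarrow> nat \<Rightarrow> 'a measure" where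
  "infl i a j \<equiv> influenced_law (compl S) (restrict x (compl S)) i a j"

text \<open>
  The conditional expectation of \<open>v(X\<^sub>j)\<close> given \<open>X\<^sub>i = a\<close>. It is defined through \<open>cexp\<close>, which is measurable
  in \<open>a\<close>, and agrees with the integral against \<open>infl i a j\<close> for almost every \<open>a\<close>.
\<close>

definition infl_op :: "nat \<Rightarrow> nat \<Rightarrow> ('a \<Rightarrow> real) \<Rightarrow> 'a \<Rightarrow> real" where
  "infl_op i j v a = cexp (S - {i}) (\<lambda>z. v (z j)) (x(i := a))"

lemma base_in_space: "x \<in> space full_space" using regularD(1)[OF x] .

lemma index_in: "i \<in> S \<Longrightarrow> i \<in> {1..n}" using S by auto

lemma minus_subset: "S - {i} \<subseteq> {1..n}" "S - {i} \<subseteq> S" using S by auto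

lemma coord_bdd_infl_op:
  assumes "i \<in> S" "j \<in> S" "coord_bdd j v" shows "coord_bdd i (infl_op i j v)"
  unfolding infl_op_def[abs_def] using assms
  by (intro bdd_meas_imp_coord_bdd_upd index_in base_in_space bdd_meas_cexp minus_subset bdd_meas_lift)

text \<open>
  Under the conditional law the coordinates outside \<open>S\<close> are those of \<open>x\<close>, so a conditional expectation
  given the coordinates outside \<open>S - {i}\<close> is a function of the coordinate \<open>i\<close> alone.
\<close>

lemma AE_upd:
  assumes i: "i \<in> S" and F: "bdd_meas F"
  shows "AE z in cond_ker S x. z \<in> regular (S - {i}) \<and> x(i := z i) \<in> regular (S - {i}) \<and>
    cexp (S - {i}) F (x(i := z i)) = cexp (S - {i}) F z"
proof -
  let ?T = "S - {i}"
  let ?P = "\<lambda>z. z \<in> regular ?T \<longrightarrow> x(i := z i) \<in> regular ?T \<and> cexp ?T F (x(i := z i)) = cexp ?T F z"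
  have um[measurable]: "(\<lambda>z. x(i := z i)) \<in> full_space \<rightarrow>\<^sub>M full_space"
    using measurable_compose[OF coord_measurable upd_measurable] index_in[OF i] base_in_space by blast
  have c[measurable]: "cexp ?T F \<in> borel_measurable full_space"
    by (rule cexp_measurable[OF minus_subset(1) bdd_measD[OF F]])
  define g where "g = cexp ?T F"
  have [measurable]: "g \<in> borel_measurable full_space" unfolding g_def by (rule c)
  define f where "f z = g (x(i := z i))" for z
  have [measurable]: "f \<in> borel_measurable full_space"
    unfolding f_def g_def by (rule measurable_compose[OF um c])
  have "{z \<in> space full_space. f z = g z} \<in> sets full_space"
    by (rule borel_measurable_eq) measurable
  then have [measurable]: "Measurable.pred full_space (\<lambda>z. f z = g z)"
    by (simp add: pred_def)
  note [measurable] = regular_sets[OF minus_subset(1), of i]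
  have "AE z in cond_ker S x. ?P z"
  proof (rule AE_cond_ker_off[OF S x])
    fix w assume w: "w \<in> space (PiM S M)"
    let ?z = "override S w x"
    have z: "?z \<in> space full_space" using override_space[OF S w base_in_space] .
    have xz: "x(i := ?z i) \<in> space full_space" using measurable_space[OF um z] .
    have "(x(i := ?z i)) k = ?z k" if "k \<in> compl ?T" for k
      using that by (auto simp: override_apply)
    then show "?P ?z" using regular_cong[of ?z ?T "x(i := ?z i)"] xz by (auto simp: cexp_def)
  next
    show "Measurable.pred full_space ?P"
      unfolding g_def[symmetric] unfolding f_def[symmetric] by measurable
  qed
  with AE_cond_ker_regular[OF S minus_subset(2)[of i] x] show ?thesis by eventually_elim auto
qed

lemma AE_infl_op:
  assumes "i \<in> S" "j \<in> S" "coord_bdd j v"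
  shows "AE z in cond_ker S x. infl_op i j v (z i) = cexp (S - {i}) (\<lambda>z. v (z j)) z"
  using AE_upd[OF assms(1) bdd_meas_lift[OF index_in[OF assms(2)] assms(3)]]
  by eventually_elim (simp add: infl_op_def)

text \<open>
  This identity makes the influence operator symmetric.
\<close>

lemma infl_op_inner:
  assumes i: "i \<in> S" and j: "j \<in> S" and w: "coord_bdd i w" and v: "coord_bdd j v"
  shows "cexp S (\<lambda>z. w (z i) * infl_op i j v (z i)) x = cexp S (\<lambda>z. w (z i) * v (z j)) x"
proof -
  let ?T = "S - {i}"
  note bw = bdd_meas_lift[OF index_in[OF i] w] and bv = bdd_meas_lift[OF index_in[OF j] v]
    and bA = bdd_meas_lift[OF index_in[OF i] coord_bdd_infl_op[OF i j v]]
  have "cexp S (\<lambda>z. w (z i) * v (z j)) x = cexp S (cexp ?T (\<lambda>z. w (z i) * v (z j))) x"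
    by (intro cexp_tower[symmetric] S minus_subset x bdd_meas_intros bw bv)
  also have "\<dots> = cexp S (\<lambda>z. w (z i) * infl_op i j v (z i)) x"
  proof (intro cexp_cong_AE bdd_meas_cexp bdd_meas_intros minus_subset bw bv bA)
    show "AE z in cond_ker S x. cexp ?T (\<lambda>z. w (z i) * v (z j)) z = w (z i) * infl_op i j v (z i)"
      using AE_infl_op[OF i j v] AE_cond_ker_regular[OF S minus_subset(2)[of i] x]
    proof eventually_elim
      case (elim z)
      have "cexp ?T (\<lambda>z. w (z i) * v (z j)) z = w (z i) * cexp ?T (\<lambda>z. v (z j)) z"
        by (rule cexp_pull_out[OF minus_subset(1) elim(2) bv bw]) (use index_in[OF i] in \<open>simp add: override_apply\<close>)
      then show ?case using elim by simp
    qed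
  qed
  finally show ?thesis ..
qed

lemma infl_eq:
  assumes i: "i \<in> S" and j: "j \<in> S" "i \<noteq> j" and r: "x(i := a) \<in> regular (S - {i})"
  shows "infl i a j = distr (cond_ker (S - {i}) (x(i := a))) (M j) (\<lambda>z. z j)"
    and "\<exists>h \<in> borel_measurable (M j). (\<forall>a. 0 \<le> h a) \<and> infl i a j = density (M j) (\<lambda>a. ennreal (h a))"
  using coord_law_eq[OF minus_subset(1) _ r, of j] j unfolding influenced_law_eq[OF S i] by auto

lemma prob_infl:
  assumes i: "i \<in> S" and j: "j \<in> S" "i \<noteq> j" and r: "x(i := a) \<in> regular (S - {i})"
  shows "prob_space (infl i a j)"
proof -
  interpret prob_space "cond_ker (S - {i}) (x(i := a))" using prob_space_cond_ker[OF minus_subset(1) regularD(1)[OF r]] .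
  show ?thesis
    unfolding infl_eq(1)[OF assms] 
    by (rule prob_space_distr) (use coord_measurable[OF index_in[OF j(1)]] in \<open>simp add: measurable_cong_sets[OF sets_cond_ker refl]\<close>)
qed

lemma infl_op_integral:
  assumes i: "i \<in> S" and j: "j \<in> S" "i \<noteq> j" and r: "x(i := a) \<in> regular (S - {i})" and v: "coord_bdd j v"
  shows "infl_op i j v a = (\<integral> b. v b \<partial>infl i a j)"
  unfolding infl_eq(1)[OF i j r] infl_op_def cexp_def
  by (rule integral_distr[symmetric])
    (use coord_measurable[OF index_in[OF j(1)]] v in \<open>auto simp: measurable_cong_sets[OF sets_cond_ker refl] coord_bdd_def\<close>)

lemma sets_law: "i \<in> S \<Longrightarrow> sets (law i) = sets (M i)" "i \<in> S \<Longrightarrow> space (law i) = space (M i)"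
  by (simp_all add: coord_law_def)

lemma prob_law: assumes i: "i \<in> S" shows "prob_space (law i)"
proof -
  interpret prob_space "cond_ker S x" using prob_space_cond_ker[OF S base_in_space] .
  show ?thesis
    unfolding coord_law_eq(1)[OF S i x]
    by (rule prob_space_distr) (use coord_measurable[OF index_in[OF i]] in \<open>simp add: measurable_cong_sets[OF sets_cond_ker refl]\<close>)
qed

lemma AE_law_regular:
  assumes i: "i \<in> S" shows "AE a in law i. x(i := a) \<in> regular (S - {i})"
proof -
  have "{a \<in> space (M i). x(i := a) \<in> regular (S - {i})} \<in> sets (M i)"
    using measurable_sets[OF upd_measurable[OF index_in[OF i] base_in_space] regular_sets[OF minus_subset(1), of i]]
    by (simp add: vimage_def Int_def conj_commute)
  then show ?thesis
    using AE_upd[OF i bdd_meas_const[of 0]] by (subst AE_coord_law_iff[OF S i x]) auto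
qed

lemma ae_pairsI_AE:
  assumes "i \<in> S" "AE a in law i. Q a" "ae_pairs (law i) P"
    "\<And>a b. a \<in> space (M i) \<Longrightarrow> b \<in> space (M i) \<Longrightarrow> Q a \<Longrightarrow> Q b \<Longrightarrow> P a b \<Longrightarrow> R a b"
  shows "ae_pairs (law i) R"
proof -
  obtain N1 where N1: "N1 \<in> null_sets (law i)" "\<And>a. a \<in> space (law i) - N1 \<Longrightarrow> Q a"
    using AE_E3[OF assms(2)] by blast
  obtain N2 where N2: "N2 \<in> null_sets (law i)" "\<forall>a \<in> space (law i) - N2. \<forall>b \<in> space (law i) - N2. P a b"
    using assms(3) unfolding ae_pairs_def by blast
  have "N1 \<union> N2 \<in> null_sets (law i)" using N1 N2 by auto
  then show ?thesis
    unfolding ae_pairs_def using N1 N2 assms(4) sets_law(2)[OF assms(1)]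
    by (intro bexI[of _ "N1 \<union> N2"]) auto
qed

text \<open>
  The image of a bounded function is Lipschitz. The absolute value is there because \<open>k\<close> may be negative.
\<close>

lemma infl_op_lip_bounded:
  assumes i: "i \<in> S" and j: "j \<in> S" "i \<noteq> j" and v: "coord_bdd j v" and B: "\<And>a. a \<in> space (M j) \<Longrightarrow> \<bar>v a\<bar> \<le> B" "B \<ge> 0"
    and tv: "ae_pairs (law i) (\<lambda>a b. tv_dist (infl i a j) (infl i b j) \<le> k * d a b)"
    and d0: "\<And>a b. a \<in> space (M i) \<Longrightarrow> b \<in> space (M i) \<Longrightarrow> 0 \<le> d a b"
  shows "ae_pairs (law i) (\<lambda>a b. \<bar>infl_op i j v a - infl_op i j v b\<bar> \<le> 2 * B * \<bar>k\<bar> * d a b)"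
proof (rule ae_pairsI_AE[OF i AE_law_regular[OF i] tv])
  fix a b assume ab: "a \<in> space (M i)" "b \<in> space (M i)" and r: "x(i := a) \<in> regular (S - {i})" "x(i := b) \<in> regular (S - {i})"
    and t: "tv_dist (infl i a j) (infl i b j) \<le> k * d a b"
  obtain f g where f: "f \<in> borel_measurable (M j)" "\<And>a. 0 \<le> f a" "infl i a j = density (M j) (\<lambda>a. ennreal (f a))"
    and g: "g \<in> borel_measurable (M j)" "\<And>a. 0 \<le> g a" "infl i b j = density (M j) (\<lambda>a. ennreal (g a))"
    using infl_eq(2)[OF i j r(1)] infl_eq(2)[OF i j r(2)] by auto
  have "\<bar>infl_op i j v a - infl_op i j v b\<bar> \<le> 2 * B * tv_dist (infl i a j) (infl i b j)"
    unfolding infl_op_integral[OF i j r(1) v] infl_op_integral[OF i j r(2) v] f(3) g(3)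
    using v f g B prob_infl[OF i j r(1)] prob_infl[OF i j r(2)]
    by (intro tv_integral_bound) (auto simp: coord_bdd_def)
  also have "\<dots> \<le> 2 * B * (\<bar>k\<bar> * d a b)"
  proof (intro mult_left_mono)
    have "k * d a b \<le> \<bar>k\<bar> * d a b" using d0[OF ab] by (intro mult_right_mono) auto
    with t show "tv_dist (infl i a j) (infl i b j) \<le> \<bar>k\<bar> * d a b" by simp
  qed (use B in auto)
  finally show "\<bar>infl_op i j v a - infl_op i j v b\<bar> \<le> 2 * B * \<bar>k\<bar> * d a b" by simp
qed

text \<open>
  The image of a Lipschitz function is Lipschitz with constant multiplied by the contraction
  coefficient. The Lipschitz bound for \<open>v\<close> may fail on a null set \<open>Z\<close>; for almost every \<open>a\<close> the law
  \<open>infl i a j\<close> does not charge \<open>Z\<close>, hence neither does a coupling of two such laws.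
\<close>

lemma infl_op_lip_contraction:
  assumes i: "i \<in> S" and j: "j \<in> S" "i \<noteq> j" and v: "coord_bdd j v" and L: "L \<ge> 0" and \<phi>: "\<phi> \<ge> 0"
    and lip: "ae_pairs (law j) (\<lambda>a b. \<bar>v a - v b\<bar> \<le> L * d j a b)"
    and con: "contraction (compl S) (restrict x (compl S)) d i j \<phi>"
    and d0: "\<And>a b. a \<in> space (M i) \<Longrightarrow> b \<in> space (M i) \<Longrightarrow> 0 \<le> d i a b"
    and dj: "\<And>a b. a \<in> space (M j) \<Longrightarrow> b \<in> space (M j) \<Longrightarrow> 0 \<le> d j a b"
    and dm: "case_prod (d j) \<in> borel_measurable (M j \<Otimes>\<^sub>M M j)"
  shows "ae_pairs (law i) (\<lambda>a b. \<bar>infl_op i j v a - infl_op i j v b\<bar> \<le> \<phi> * L * d i a b)"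
proof -
  let ?T = "S - {i}"
  obtain Z where Z: "Z \<in> null_sets (law j)" "\<And>a b. a \<in> space (M j) - Z \<Longrightarrow> b \<in> space (M j) - Z \<Longrightarrow> \<bar>v a - v b\<bar> \<le> L * d j a b"
    using lip sets_law(2)[OF j(1)] by (auto simp: ae_pairs_def)
  have ZM: "Z \<in> sets (M j)" using Z(1) sets_law(1)[OF j(1)] by auto
  have vm: "v \<in> borel_measurable (M j)" using v by (simp add: coord_bdd_def)
  obtain B where B: "\<And>a. a \<in> space (M j) \<Longrightarrow> \<bar>v a\<bar> \<le> B" using v by (auto simp: coord_bdd_def)
  define N where "N = {z \<in> space full_space. z j \<in> Z}"
  have N: "N \<in> sets full_space"
    using measurable_sets[OF coord_measurable[OF index_in[OF j(1)]] ZM] by (simp add: N_def vimage_def Int_def conj_commute)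
  have "AE a in law j. a \<notin> Z" by (rule AE_not_in[OF Z(1)])
  moreover have "{a \<in> space (M j). a \<notin> Z} \<in> sets (M j)" using ZM by measurable
  ultimately have "AE z in cond_ker S x. z j \<notin> Z"
    using AE_coord_law_iff[OF S j(1) x, of "\<lambda>a. a \<notin> Z"] by simp
  then have "AE z in cond_ker S x. z \<notin> N" by eventually_elim (auto simp: N_def)
  then have AE0: "AE z in cond_ker S x. emeasure (cond_ker ?T z) N = 0"
    by (rule AE_cond_ker_cond_ker[OF S minus_subset(2) x N])
  have bN: "bdd_meas (indicat_real N)" using N by (intro bdd_measI[of _ 1]) (auto split: split_indicator)
  have cN: "cexp ?T (indicat_real N) z = measure (cond_ker ?T z) N" if "z \<in> space full_space" for z
    using N by (simp add: cexp_def)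
  have "{a \<in> space (M i). cexp ?T (indicat_real N) (x(i := a)) = 0} \<in> sets (M i)"
    using measurable_compose[OF upd_measurable[OF index_in[OF i] base_in_space] cexp_measurable[OF minus_subset(1) bdd_measD[OF bN]]] by measurable
  moreover have "AE z in cond_ker S x. cexp ?T (indicat_real N) (x(i := z i)) = 0"
    using AE_upd[OF i bN] AE0
  proof eventually_elim
    case (elim z)
    then have "cexp ?T (indicat_real N) z = 0" using cN[of z] regularD(1)[of z ?T] by (simp add: measure_def)
    then show ?case using elim by simp
  qed
  ultimately have "AE a in law i. cexp ?T (indicat_real N) (x(i := a)) = 0"
    by (subst AE_coord_law_iff[OF S i x])
  with AE_law_regular[OF i]
  have AEq: "AE a in law i. x(i := a) \<in> regular ?T \<and> cexp ?T (indicat_real N) (x(i := a)) = 0"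
    by eventually_elim simp
  have nullZ: "AE b in infl i a j. b \<notin> Z"
    if "x(i := a) \<in> regular ?T" "cexp ?T (indicat_real N) (x(i := a)) = 0" for a
  proof -
    interpret prob_space "cond_ker ?T (x(i := a))" using prob_space_cond_ker[OF minus_subset(1) regularD(1)[OF that(1)]] .
    have "emeasure (cond_ker ?T (x(i := a))) N = 0"
      using that(2) cN[OF regularD(1)[OF that(1)]] by (simp add: emeasure_eq_measure)
    then have "AE z in cond_ker ?T (x(i := a)). z \<notin> N"
      using N by (intro AE_not_in) auto
    then have "AE z in cond_ker ?T (x(i := a)). z j \<notin> Z"
      using AE_space by eventually_elim (auto simp: N_def)
    moreover have "(\<lambda>z. z j) \<in> cond_ker ?T (x(i := a)) \<rightarrow>\<^sub>M M j"
      using coord_measurable[OF index_in[OF j(1)]] by (simp add: measurable_cong_sets[OF sets_cond_ker refl])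
    moreover have "{a \<in> space (M j). a \<notin> Z} \<in> sets (M j)" using ZM by measurable
    ultimately show ?thesis
      unfolding infl_eq(1)[OF i j that(1)] by (subst AE_distr_iff)
  qed
  obtain K where K: "coupling_kernel (compl S) (restrict x (compl S)) i j K"
    and Kae: "ae_pairs (law i) (\<lambda>a b. (\<integral>\<^sup>+ p. ennreal (d j (fst p) (snd p)) \<partial>K (a, b)) \<le> ennreal (\<phi> * d i a b))"
    using con by (auto simp: contraction_def)
  show ?thesis
  proof (rule ae_pairsI_AE[OF i AEq Kae])
    fix a b assume ab: "a \<in> space (M i)" "b \<in> space (M i)"
      and ra: "x(i := a) \<in> regular ?T \<and> cexp ?T (indicat_real N) (x(i := a)) = 0"
      and rb: "x(i := b) \<in> regular ?T \<and> cexp ?T (indicat_real N) (x(i := b)) = 0"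
      and Kab: "(\<integral>\<^sup>+ p. ennreal (d j (fst p) (snd p)) \<partial>K (a, b)) \<le> ennreal (\<phi> * d i a b)"
    let ?\<kappa> = "K (a, b)"
    have coup: "coupling ?\<kappa> (infl i a j) (infl i b j)"
      using K ab by (auto simp: coupling_kernel_def)
    have si: "sets (infl i c j) = sets (M j)" for c by (simp add: influenced_law_def coord_law_def)
    have s\<kappa>: "sets ?\<kappa> = sets (M j \<Otimes>\<^sub>M M j)"
      using coup unfolding coupling_def by (simp add: sets_pair_measure_cong[OF si si])
    have sp: "space ?\<kappa> = space (M j) \<times> space (M j)"
      using sets_eq_imp_space_eq[OF s\<kappa>] by (simp add: space_pair_measure)
    have d1: "infl i a j = distr ?\<kappa> (M j) fst" and d2: "infl i b j = distr ?\<kappa> (M j) snd"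
      using coup unfolding coupling_def by (metis distr_cong si)+
    have fm: "fst \<in> ?\<kappa> \<rightarrow>\<^sub>M M j" and sm: "snd \<in> ?\<kappa> \<rightarrow>\<^sub>M M j"
      by (simp_all add: measurable_cong_sets[OF s\<kappa> refl])
    have p\<kappa>: "prob_space ?\<kappa>"
      using prob_infl[OF i j conjunct1[OF ra]] unfolding d1 by (rule prob_space_distrD[OF fm])
    interpret prob_space ?\<kappa> by (rule p\<kappa>)
    have int1: "integrable ?\<kappa> (\<lambda>p. v (fst p))" and int2: "integrable ?\<kappa> (\<lambda>p. v (snd p))"
      by (rule integrable_const_bound[of _ B]; use B sp measurable_compose[OF fm vm] measurable_compose[OF sm vm] in auto)+
    have AEp: "AE p in ?\<kappa>. fst p \<notin> Z \<and> snd p \<notin> Z"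
      using AE_distrD[OF fm nullZ[of a, unfolded d1]] AE_distrD[OF sm nullZ[of b, unfolded d2]] ra rb by simp
    have "infl_op i j v a - infl_op i j v b = (\<integral> p. v (fst p) \<partial>?\<kappa>) - (\<integral> p. v (snd p) \<partial>?\<kappa>)"
      using ra rb unfolding infl_op_integral[OF i j conjunct1[OF ra] v] infl_op_integral[OF i j conjunct1[OF rb] v] d1 d2
      by (simp add: integral_distr[OF fm vm] integral_distr[OF sm vm])
    also have "\<dots> = (\<integral> p. v (fst p) - v (snd p) \<partial>?\<kappa>)"
      using int1 int2 by simp
    finally have "ennreal \<bar>infl_op i j v a - infl_op i j v b\<bar> \<le> (\<integral>\<^sup>+ p. ennreal \<bar>v (fst p) - v (snd p)\<bar> \<partial>?\<kappa>)"
      using integral_norm_bound_ennreal[of ?\<kappa> "\<lambda>p. v (fst p) - v (snd p)"] int1 int2 by simp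
    also have "\<dots> \<le> (\<integral>\<^sup>+ p. ennreal L * ennreal (d j (fst p) (snd p)) \<partial>?\<kappa>)"
    proof (rule nn_integral_mono_AE)
      show "AE p in ?\<kappa>. ennreal \<bar>v (fst p) - v (snd p)\<bar> \<le> ennreal L * ennreal (d j (fst p) (snd p))"
        using AEp AE_space
      proof eventually_elim
        case (elim p)
        then have p: "fst p \<in> space (M j) - Z" "snd p \<in> space (M j) - Z" by (auto simp: sp)
        have "ennreal \<bar>v (fst p) - v (snd p)\<bar> \<le> ennreal (L * d j (fst p) (snd p))"
          by (intro ennreal_leI Z(2) p)
        also have "\<dots> = ennreal L * ennreal (d j (fst p) (snd p))"
          using p L by (intro ennreal_mult dj) auto
        finally show ?case .
      qed
    qed
    also have "\<dots> = ennreal L * (\<integral>\<^sup>+ p. ennreal (d j (fst p) (snd p)) \<partial>?\<kappa>)"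
    proof (rule nn_integral_cmult)
      have "(\<lambda>p. d j (fst p) (snd p)) \<in> borel_measurable ?\<kappa>"
        using dm by (simp add: measurable_cong_sets[OF s\<kappa> refl] split_beta')
      then show "(\<lambda>p. ennreal (d j (fst p) (snd p))) \<in> borel_measurable ?\<kappa>" by simp
    qed
    also have "\<dots> \<le> ennreal L * ennreal (\<phi> * d i a b)"
      by (intro mult_left_mono Kab) simp
    also have "\<dots> = ennreal (\<phi> * L * d i a b)"
      using L \<phi> d0[OF ab] by (simp add: ennreal_mult[symmetric] mult_ac)
    finally show "\<bar>infl_op i j v a - infl_op i j v b\<bar> \<le> \<phi> * L * d i a b"
      using L \<phi> d0[OF ab] by (simp add: ennreal_le_iff)
  qed
qed

text \<open>
  A centred Lipschitz function is the integral of its own differences, so the moment condition bounds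
  its norm in \<open>L\<^sup>2\<close>.
\<close>

lemma lip_L2_bound:
  assumes i: "i \<in> S" and v: "coord_bdd i v" and L: "L \<ge> 0"
    and lip: "ae_pairs (law i) (\<lambda>a b. \<bar>v a - v b\<bar> \<le> L * d i a b)"
    and mean: "cexp S (\<lambda>z. v (z i)) x = 0"
    and d0: "\<And>a b. a \<in> space (M i) \<Longrightarrow> b \<in> space (M i) \<Longrightarrow> 0 \<le> d i a b \<and> d i a b = d i b a"
    and dm: "case_prod (d i) \<in> borel_measurable (M i \<Otimes>\<^sub>M M i)"
    and fin: "(\<integral>\<^sup>+ b. (\<integral>\<^sup>+ a. ennreal (d i a b) \<partial>law i)\<^sup>2 \<partial>law i) < \<infinity>"
  shows "cexp S (\<lambda>z. (v (z i))\<^sup>2) x \<le> L\<^sup>2 * enn2real (\<integral>\<^sup>+ b. (\<integral>\<^sup>+ a. ennreal (d i a b) \<partial>law i)\<^sup>2 \<partial>law i)"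
proof -
  interpret prob_space "law i" by (rule prob_law[OF i])
  note iI = index_in[OF i]
  have vm: "v \<in> borel_measurable (M i)" using v by (simp add: coord_bdd_def)
  have vml: "v \<in> borel_measurable (law i)" using vm by (simp add: measurable_cong_sets[OF sets_law(1)[OF i] refl])
  obtain B where B: "\<And>a. a \<in> space (M i) \<Longrightarrow> \<bar>v a\<bar> \<le> B" using v by (auto simp: coord_bdd_def)
  have vint: "integrable (law i) v"
    by (rule integrable_const_bound[of _ B]) (use B sets_law(2)[OF i] vml in auto)
  have cm: "(\<lambda>z. z i) \<in> cond_ker S x \<rightarrow>\<^sub>M M i"
    using coord_measurable[OF iI] by (simp add: measurable_cong_sets[OF sets_cond_ker refl])
  have mean': "(\<integral> a. v a \<partial>law i) = 0"
    using mean unfolding coord_law_eq(1)[OF S i x] cexp_def by (simp add: integral_distr[OF cm vm])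
  obtain Z where Z: "Z \<in> null_sets (law i)" "\<And>a b. a \<in> space (M i) - Z \<Longrightarrow> b \<in> space (M i) - Z \<Longrightarrow> \<bar>v a - v b\<bar> \<le> L * d i a b"
    using lip sets_law(2)[OF i] by (auto simp: ae_pairs_def)
  have dmb: "(\<lambda>a. d i a b) \<in> borel_measurable (law i)" if "b \<in> space (M i)" for b
    using measurable_compose[OF measurable_Pair2'[OF that] dm] by (simp add: measurable_cong_sets[OF sets_law(1)[OF i] refl])
  let ?I = "\<lambda>b. \<integral>\<^sup>+ a. ennreal (d i a b) \<partial>law i"
  have pt: "ennreal ((v b)\<^sup>2) \<le> ennreal (L\<^sup>2) * (?I b)\<^sup>2" if b: "b \<in> space (M i) - Z" for b
  proof -
    have "v b = (\<integral> a. v b - v a \<partial>law i)"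
      using vint mean' by (simp add: prob_space)
    then have "ennreal \<bar>v b\<bar> \<le> (\<integral>\<^sup>+ a. ennreal \<bar>v b - v a\<bar> \<partial>law i)"
      using integral_norm_bound_ennreal[of "law i" "\<lambda>a. v b - v a"] vint by simp
    also have "\<dots> \<le> (\<integral>\<^sup>+ a. ennreal L * ennreal (d i a b) \<partial>law i)"
    proof (rule nn_integral_mono_AE)
      show "AE a in law i. ennreal \<bar>v b - v a\<bar> \<le> ennreal L * ennreal (d i a b)"
        using AE_not_in[OF Z(1)] AE_space
      proof eventually_elim
        case (elim a)
        then have a: "a \<in> space (M i) - Z" using sets_law(2)[OF i] by simp
        have d: "d i a b = d i b a" "0 \<le> d i a b" using d0[of a b] a b by auto
        have "ennreal \<bar>v b - v a\<bar> \<le> ennreal (L * d i b a)"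
          by (intro ennreal_leI Z(2) a b)
        also have "\<dots> = ennreal L * ennreal (d i a b)"
          unfolding d(1)[symmetric] using L d(2) by (rule ennreal_mult)
        finally show ?case .
      qed
    qed
    also have "\<dots> = ennreal L * ?I b"
      using dmb[of b] b by (intro nn_integral_cmult) auto
    finally have "ennreal \<bar>v b\<bar> \<le> ennreal L * ?I b" .
    then have "(ennreal \<bar>v b\<bar>)\<^sup>2 \<le> (ennreal L * ?I b)\<^sup>2" by (rule power_mono) simp
    then show ?thesis using L by (simp add: power_mult_distrib ennreal_power)
  qed
  define D where "D = (\<integral>\<^sup>+ b. (?I b)\<^sup>2 \<partial>law i)"
  have "ennreal (cexp S (\<lambda>z. (v (z i))\<^sup>2) x) = (\<integral>\<^sup>+ z. ennreal ((v (z i))\<^sup>2) \<partial>cond_ker S x)"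
    by (intro nn_integral_cond_ker_bdd_meas[symmetric] S base_in_space bdd_meas_intros bdd_meas_lift iI v) auto
  also have "\<dots> = (\<integral>\<^sup>+ b. ennreal ((v b)\<^sup>2) \<partial>law i)"
    unfolding coord_law_eq(1)[OF S i x] using vm by (subst nn_integral_distr[OF cm]) auto
  also have "\<dots> \<le> (\<integral>\<^sup>+ b. ennreal (L\<^sup>2) * (?I b)\<^sup>2 \<partial>law i)"
  proof (rule nn_integral_mono_AE)
    show "AE b in law i. ennreal ((v b)\<^sup>2) \<le> ennreal (L\<^sup>2) * (?I b)\<^sup>2"
      using AE_not_in[OF Z(1)] AE_space by eventually_elim (use pt sets_law(2)[OF i] in auto)
  qed
  also have "\<dots> = ennreal (L\<^sup>2) * D"
    unfolding D_def
  proof (rule nn_integral_cmult)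
    have "(\<lambda>(b, a). ennreal (d i a b)) \<in> borel_measurable (M i \<Otimes>\<^sub>M law i)"
      using measurable_compose[OF measurable_pair_swap' dm]
      by (simp add: measurable_cong_sets[OF sets_pair_measure_cong[OF refl sets_law(1)[OF i]] refl] split_beta')
    then have "?I \<in> borel_measurable (M i)"
      by (intro borel_measurable_nn_integral) auto
    then show "(\<lambda>b. (?I b)\<^sup>2) \<in> borel_measurable (law i)"
      by (simp add: measurable_cong_sets[OF sets_law(1)[OF i] refl])
  qed
  also have "\<dots> = ennreal (L\<^sup>2 * enn2real D)"
    using fin by (simp add: ennreal_mult D_def)
  finally show ?thesis
    unfolding D_def[symmetric] by (subst (asm) ennreal_le_iff) auto
qed

end

lemma lip_sum:
  fixes f :: "nat \<Rightarrow> 'a \<Rightarrow> real"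
  assumes K: "finite K" and f: "\<And>j. j \<in> K \<Longrightarrow> ae_pairs \<nu> (\<lambda>a b. \<bar>f j a - f j b\<bar> \<le> c j * d a b)"
  shows "ae_pairs \<nu> (\<lambda>a b. \<bar>(\<Sum>j\<in>K. f j a) - (\<Sum>j\<in>K. f j b)\<bar> \<le> (\<Sum>j\<in>K. c j) * d a b)"
proof -
  have *: "\<bar>(\<Sum>j\<in>K. f j a) - (\<Sum>j\<in>K. f j b)\<bar> \<le> (\<Sum>j\<in>K. c j) * d a b"
    if "\<forall>j\<in>K. \<bar>f j a - f j b\<bar> \<le> c j * d a b" for a b
  proof -
    have "\<bar>(\<Sum>j\<in>K. f j a) - (\<Sum>j\<in>K. f j b)\<bar> \<le> (\<Sum>j\<in>K. \<bar>f j a - f j b\<bar>)"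
      unfolding sum_subtractf[symmetric] by (rule sum_abs)
    also have "\<dots> \<le> (\<Sum>j\<in>K. c j * d a b)" using that by (intro sum_mono) auto
    finally show ?thesis by (simp add: sum_distrib_right)
  qed
  obtain N where N: "N \<in> null_sets \<nu>"
      "\<And>a b. a \<in> space \<nu> - N \<Longrightarrow> b \<in> space \<nu> - N \<Longrightarrow> \<forall>j\<in>K. \<bar>f j a - f j b\<bar> \<le> c j * d a b"
    using ae_pairs_sum[OF K, of \<nu> "\<lambda>j a b. \<bar>f j a - f j b\<bar> \<le> c j * d a b", OF f]
    unfolding ae_pairs_def by blast
  show ?thesis
    unfolding ae_pairs_def by (intro bexI[OF _ N(1)] ballI * N(2))
qed

section \<open>The quadratic form of the influence operator\<close>

text \<open>
  The quadratic form of the influence operator on centred families \<open>u\<close> is bounded by \<open>\<eta>\<close>, stated as a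
  bound on the variance of \<open>\<Sum> u\<^sub>i(X\<^sub>i)\<close>. In the proof \<open>ip\<close> is the inner product of families, \<open>adm\<close> says
  that a family is bounded and centred, and \<open>U t\<close> is the \<open>t\<close>-th iterate, whose Lipschitz constants for
  \<open>t > 0\<close> are obtained from those of \<open>U 1\<close> by applying \<open>\<Phi>\<close>.
\<close>

lemma influence_quadratic:
  assumes S: "S \<subseteq> {1..n}" and x: "x \<in> regular S" and ne: "S \<noteq> {}"
    and inf: "influence_matrix (compl S) (restrict x (compl S)) \<Phi>" and r: "matrix_radius S \<Phi> \<le> \<eta>"
    and u: "\<And>i. i \<in> S \<Longrightarrow> coord_bdd i (u i)" and mean: "\<And>i. i \<in> S \<Longrightarrow> cexp S (\<lambda>z. u i (z i)) x = 0"
  shows "cexp S (\<lambda>z. (\<Sum>i\<in>S. u i (z i))\<^sup>2) x \<le> (1 + \<eta>) * (\<Sum>i\<in>S. cexp S (\<lambda>z. (u i (z i))\<^sup>2) x)"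
proof -
  have xs: "x \<in> space full_space" using regularD(1)[OF x] .
  have fS: "finite S" using finite_index_subset[OF S] .
  have SI: "i \<in> {1..n}" if "i \<in> S" for i using that S by auto
  note lift = bdd_meas_lift[OF SI]
  define A where "A w i a = (\<Sum>j\<in>S - {i}. infl_op S x i j (w j) a)" for w i a
  define ip where "ip w v = (\<Sum>i\<in>S. cexp S (\<lambda>z. w i (z i) * v i (z i)) x)" for w v
  define adm where "adm w \<longleftrightarrow> (\<forall>i\<in>S. coord_bdd i (w i) \<and> cexp S (\<lambda>z. w i (z i)) x = 0)" for w
  have coord_bdd1: "coord_bdd i (\<lambda>_. 1)" for i by (auto simp: coord_bdd_def intro: exI[of _ 1])
  have cA: "coord_bdd i (A w i)" if "adm w" "i \<in> S" for w i
    unfolding A_def[abs_def] using that by (intro coord_bdd_sum coord_bdd_infl_op[OF S x]) (auto simp: adm_def)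
  have inner: "cexp S (\<lambda>z. w (z i) * A v i (z i)) x = (\<Sum>j\<in>S - {i}. cexp S (\<lambda>z. w (z i) * v j (z j)) x)"
    if i: "i \<in> S" and w: "coord_bdd i w" and v: "adm v" for w v i
  proof -
    have "cexp S (\<lambda>z. w (z i) * A v i (z i)) x = cexp S (\<lambda>z. \<Sum>j\<in>S - {i}. w (z i) * infl_op S x i j (v j) (z i)) x"
      by (simp add: A_def sum_distrib_left)
    also have "\<dots> = (\<Sum>j\<in>S - {i}. cexp S (\<lambda>z. w (z i) * infl_op S x i j (v j) (z i)) x)"
      using v i w by (intro cexp_sum S xs bdd_meas_mult lift coord_bdd_infl_op[OF S x]) (auto simp: adm_def)
    also have "\<dots> = (\<Sum>j\<in>S - {i}. cexp S (\<lambda>z. w (z i) * v j (z j)) x)"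
      using v i w by (intro sum.cong refl infl_op_inner[OF S x]) (auto simp: adm_def)
    finally show ?thesis .
  qed
  have adm_A: "adm (A w)" if w: "adm w" for w
    unfolding adm_def
  proof (intro ballI conjI)
    fix i assume i: "i \<in> S"
    show "coord_bdd i (A w i)" by (rule cA[OF w i])
    show "cexp S (\<lambda>z. A w i (z i)) x = 0"
      using inner[OF i coord_bdd1 w] w by (simp add: adm_def)
  qed
  have ip_A: "ip w (A v) = (\<Sum>i\<in>S. \<Sum>j\<in>S - {i}. cexp S (\<lambda>z. w i (z i) * v j (z j)) x)"
    if "adm w" "adm v" for w v
    unfolding ip_def using that by (intro sum.cong refl inner) (auto simp: adm_def)
  have ip_sym: "ip w (A v) = ip (A w) v" if w: "adm w" and v: "adm v" for w v
  proof -
    have "ip w (A v) = (\<Sum>i\<in>S. \<Sum>j\<in>{j\<in>S. i \<noteq> j}. cexp S (\<lambda>z. w i (z i) * v j (z j)) x)"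
      unfolding ip_A[OF w v] by (intro sum.cong refl) auto
    also have "\<dots> = (\<Sum>j\<in>S. \<Sum>i\<in>{i\<in>S. i \<noteq> j}. cexp S (\<lambda>z. w i (z i) * v j (z j)) x)"
      by (rule sum.swap_restrict[OF fS fS])
    also have "\<dots> = (\<Sum>i\<in>S. \<Sum>j\<in>S - {i}. cexp S (\<lambda>z. v i (z i) * w j (z j)) x)"
      by (intro sum.cong refl) (auto simp: mult.commute)
    also have "\<dots> = ip v (A w)" by (rule ip_A[OF v w, symmetric])
    also have "\<dots> = ip (A w) v" by (simp add: ip_def mult.commute)
    finally show ?thesis .
  qed
  have ip_nonneg: "0 \<le> ip w w" for w
    unfolding ip_def by (intro sum_nonneg cexp_nonneg) simp
  have amgm: "2 * ip w v \<le> s * ip w w + ip v v / s" if w: "adm w" and v: "adm v" and s: "s > 0" for w v s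
  proof -
    have "2 * cexp S (\<lambda>z. w i (z i) * v i (z i)) x
       \<le> s * cexp S (\<lambda>z. w i (z i) * w i (z i)) x + (1/s) * cexp S (\<lambda>z. v i (z i) * v i (z i)) x" if i: "i \<in> S" for i
    proof -
      have b: "bdd_meas (\<lambda>z. w i (z i))" "bdd_meas (\<lambda>z. v i (z i))" using i w v by (auto simp: adm_def intro: lift)
      have "2 * cexp S (\<lambda>z. w i (z i) * v i (z i)) x = cexp S (\<lambda>z. 2 * (w i (z i) * v i (z i))) x"
        by (simp only: cexp_cmult)
      also have "\<dots> \<le> cexp S (\<lambda>z. s * (w i (z i) * w i (z i)) + (1/s) * (v i (z i) * v i (z i))) x"
        using weighted_am_gm[OF s] unfolding power2_eq_square
        by (intro cexp_mono_AE S xs bdd_meas_intros b AE_I2)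
      also have "\<dots> = s * cexp S (\<lambda>z. w i (z i) * w i (z i)) x + (1/s) * cexp S (\<lambda>z. v i (z i) * v i (z i)) x"
        by (subst cexp_add[OF S xs]) (auto simp only: cexp_cmult intro!: bdd_meas_intros b)
      finally show ?thesis .
    qed
    then have "(\<Sum>i\<in>S. 2 * cexp S (\<lambda>z. w i (z i) * v i (z i)) x) \<le> (\<Sum>i\<in>S. s * cexp S (\<lambda>z. w i (z i) * w i (z i)) x + (1/s) * cexp S (\<lambda>z. v i (z i) * v i (z i)) x)"
      by (rule sum_mono)
    then show ?thesis by (simp add: ip_def sum_distrib_left sum.distrib sum_divide_distrib)
  qed
  have adm_u: "adm u" using u mean by (simp add: adm_def)
  obtain d where df: "dist_family (compl S) (restrict x (compl S)) d"
    and \<Phi>0: "\<And>i. i \<in> S \<Longrightarrow> \<Phi> i i = 0"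
    and con: "\<And>i j. i \<in> S \<Longrightarrow> j \<in> S \<Longrightarrow> i \<noteq> j \<Longrightarrow> 0 \<le> \<Phi> i j \<and> contraction (compl S) (restrict x (compl S)) d i j (\<Phi> i j)"
    using inf unfolding influence_matrix_def compl_compl[OF S] by blast
  have dm: "case_prod (d i) \<in> borel_measurable (M i \<Otimes>\<^sub>M M i)"
    and d0: "\<And>a b. a \<in> space (M i) \<Longrightarrow> b \<in> space (M i) \<Longrightarrow> 0 \<le> d i a b \<and> d i a b = d i b a"
    and dfin: "(\<integral>\<^sup>+ b. (\<integral>\<^sup>+ a. ennreal (d i a b) \<partial>law S x i)\<^sup>2 \<partial>law S x i) < \<infinity>" if "i \<in> S" for i
    using df that unfolding dist_family_def compl_compl[OF S] by blast+
  from df[unfolded dist_family_def compl_compl[OF S], THEN conjunct2]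
  obtain k where k: "\<forall>i\<in>S. \<forall>j\<in>S. i \<noteq> j \<longrightarrow>
      ae_pairs (law S x i) (\<lambda>a b. tv_dist (infl S x i a j) (infl S x i b j) \<le> k * d i a b)"
    by (rule exE)
  have tv: "ae_pairs (law S x i) (\<lambda>a b. tv_dist (infl S x i a j) (infl S x i b j) \<le> k * d i a b)"
    if "i \<in> S" "j \<in> S" "i \<noteq> j" for i j
    using k[rule_format, OF that] .
  define D where "D i = enn2real (\<integral>\<^sup>+ b. (\<integral>\<^sup>+ a. ennreal (d i a b) \<partial>law S x i)\<^sup>2 \<partial>law S x i)" for i
  have "\<forall>i\<in>S. \<exists>B\<ge>0. \<forall>a\<in>space (M i). \<bar>u i a\<bar> \<le> B"
  proof
    fix i assume "i \<in> S"
    then obtain B where "\<forall>a\<in>space (M i). \<bar>u i a\<bar> \<le> B" using u by (auto simp: coord_bdd_def)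
    then show "\<exists>B\<ge>0. \<forall>a\<in>space (M i). \<bar>u i a\<bar> \<le> B"
      by (intro exI[of _ "max B 0"]) (auto simp: le_max_iff_disj)
  qed
  then obtain B where B: "\<And>i. i \<in> S \<Longrightarrow> B i \<ge> 0" "\<And>i a. i \<in> S \<Longrightarrow> a \<in> space (M i) \<Longrightarrow> \<bar>u i a\<bar> \<le> B i"
    by metis
  define F where "F h i = (\<Sum>j\<in>S. \<Phi> i j * h j)" for h :: "nat \<Rightarrow> real" and i
  define L0 where "L0 i = (\<Sum>j\<in>S - {i}. 2 * B j * \<bar>k\<bar>)" for i
  define U where "U t = (A ^^ t) u" for t
  have U_Suc: "U (Suc t) = A (U t)" for t by (simp add: U_def)
  have adm_U: "adm (U t)" for t
    by (induction t) (auto simp: U_def adm_u adm_A)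
  have F: "F h i = (\<Sum>j\<in>S - {i}. \<Phi> i j * h j)" if "i \<in> S" for h i
    using that fS \<Phi>0 by (simp add: F_def sum.remove)
  have lip: "\<forall>i\<in>S. 0 \<le> (F ^^ t) L0 i \<and>
      ae_pairs (law S x i) (\<lambda>a b. \<bar>U (Suc t) i a - U (Suc t) i b\<bar> \<le> (F ^^ t) L0 i * d i a b)" for t
  proof (induction t)
    case 0
    show ?case
    proof
      fix i assume i: "i \<in> S"
      have "ae_pairs (law S x i) (\<lambda>a b. \<bar>(\<Sum>j\<in>S - {i}. infl_op S x i j (u j) a) - (\<Sum>j\<in>S - {i}. infl_op S x i j (u j) b)\<bar>
          \<le> (\<Sum>j\<in>S - {i}. 2 * B j * \<bar>k\<bar>) * d i a b)"
        using i u B tv d0[OF i] fS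
        by (intro lip_sum infl_op_lip_bounded[OF S x]) auto
      then show "0 \<le> (F ^^ 0) L0 i \<and> ae_pairs (law S x i) (\<lambda>a b. \<bar>U (Suc 0) i a - U (Suc 0) i b\<bar> \<le> (F ^^ 0) L0 i * d i a b)"
        using B by (auto simp: U_def A_def L0_def intro!: sum_nonneg)
    qed
  next
    case (Suc t)
    show ?case
    proof
      fix i assume i: "i \<in> S"
      have "ae_pairs (law S x i) (\<lambda>a b. \<bar>(\<Sum>j\<in>S - {i}. infl_op S x i j (U (Suc t) j) a) - (\<Sum>j\<in>S - {i}. infl_op S x i j (U (Suc t) j) b)\<bar>
          \<le> (\<Sum>j\<in>S - {i}. \<Phi> i j * (F ^^ t) L0 j) * d i a b)"
      proof (rule lip_sum)
        fix j assume "j \<in> S - {i}"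
        then have j: "j \<in> S" "i \<noteq> j" by auto
        show "ae_pairs (law S x i) (\<lambda>a b. \<bar>infl_op S x i j (U (Suc t) j) a - infl_op S x i j (U (Suc t) j) b\<bar> \<le> \<Phi> i j * (F ^^ t) L0 j * d i a b)"
        proof (rule infl_op_lip_contraction[OF S x i j, where d=d])
          show "coord_bdd j (U (Suc t) j)" using adm_U[of "Suc t"] j by (simp add: adm_def)
          show "0 \<le> (F ^^ t) L0 j"
            "ae_pairs (law S x j) (\<lambda>a b. \<bar>U (Suc t) j a - U (Suc t) j b\<bar> \<le> (F ^^ t) L0 j * d j a b)"
            by (rule bspec[OF Suc j(1), THEN conjunct1], rule bspec[OF Suc j(1), THEN conjunct2])
          show "0 \<le> \<Phi> i j" "contraction (compl S) (restrict x (compl S)) d i j (\<Phi> i j)"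
            using con[OF i j] by auto
          show "0 \<le> d i a b" if "a \<in> space (M i)" "b \<in> space (M i)" for a b
            using d0[OF i that] by simp
          show "0 \<le> d j a b" if "a \<in> space (M j)" "b \<in> space (M j)" for a b
            using d0[OF j(1) that] by simp
          show "case_prod (d j) \<in> borel_measurable (M j \<Otimes>\<^sub>M M j)" by (rule dm[OF j(1)])
        qed
      qed (use fS in auto)
      moreover have "0 \<le> (F ^^ Suc t) L0 i"
      proof -
        have "0 \<le> \<Phi> i j * (F ^^ t) L0 j" if "j \<in> S - {i}" for j
          using con[of i j] bspec[OF Suc, of j] i that by (intro mult_nonneg_nonneg) auto
        then have "0 \<le> (\<Sum>j\<in>S - {i}. \<Phi> i j * (F ^^ t) L0 j)" by (rule sum_nonneg)
        then show ?thesis by (simp only: F[OF i] funpow.simps comp_apply)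
      qed
      ultimately show "0 \<le> (F ^^ Suc t) L0 i \<and> ae_pairs (law S x i) (\<lambda>a b. \<bar>U (Suc (Suc t)) i a - U (Suc (Suc t)) i b\<bar> \<le> (F ^^ Suc t) L0 i * d i a b)"
        by (simp only: F[OF i] U_Suc[of "Suc t"] A_def funpow.simps comp_apply)
    qed
  qed
  have contr: "ip (A u) (A u) \<le> \<rho>\<^sup>2 * ip u u" if \<rho>: "matrix_radius S \<Phi> < \<rho>" for \<rho>
  proof -
    have \<rho>0: "\<rho> > 0" using matrix_radius_nonneg[OF fS ne] \<rho> by (rule order.strict_trans1)
    obtain C where C: "C \<ge> 0" "\<And>t i. i \<in> S \<Longrightarrow> \<bar>(F ^^ t) L0 i\<bar> \<le> C * \<rho> ^ t"
      using matrix_radius_growth[OF fS ne \<rho>, of L0] unfolding F_def by blast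
    define E where "E = (\<Sum>i\<in>S. C\<^sup>2 * D i)"
    define b where "b t = ip (U t) (U t) / (\<rho>\<^sup>2) ^ t" for t
    have bound: "ip (U (Suc t)) (U (Suc t)) \<le> E * (\<rho>\<^sup>2) ^ t" for t
    proof -
      have "ip (U (Suc t)) (U (Suc t)) = (\<Sum>i\<in>S. cexp S (\<lambda>z. (U (Suc t) i (z i))\<^sup>2) x)"
        by (simp add: ip_def power2_eq_square)
      also have "\<dots> \<le> (\<Sum>i\<in>S. ((F ^^ t) L0 i)\<^sup>2 * D i)"
        unfolding D_def using lip[of t] adm_U[of "Suc t"] d0 dm dfin
        by (intro sum_mono lip_L2_bound[OF S x]) (auto simp: adm_def)
      also have "\<dots> \<le> (\<Sum>i\<in>S. (C * \<rho> ^ t)\<^sup>2 * D i)"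
      proof (intro sum_mono mult_right_mono)
        fix i assume "i \<in> S"
        then show "((F ^^ t) L0 i)\<^sup>2 \<le> (C * \<rho> ^ t)\<^sup>2"
          using power_mono[OF C(2), of i t 2] by simp
      qed (simp add: D_def)
      also have "\<dots> = E * (\<rho>\<^sup>2) ^ t"
        by (simp add: E_def sum_distrib_right sum_distrib_left power_mult_distrib mult_ac power_mult[symmetric])
      finally show ?thesis .
    qed
    \<comment> \<open>Symmetry gives \<open>\<parallel>U (t + 1)\<parallel>\<^sup>2 = \<langle>U t, U (t + 2)\<rangle>\<close>; the weight \<open>\<rho>\<^sup>2\<close> turns this into convexity of \<open>b\<close>.\<close>
    have "b (Suc 0) \<le> b 0"
    proof (rule convex_bounded_decreasing)
      fix t
      have "2 * ip (U (Suc t)) (U (Suc t)) = 2 * ip (U t) (U (Suc (Suc t)))"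
        using ip_sym[OF adm_U[of t] adm_U[of "Suc t"]] by (simp add: U_Suc)
      also have "\<dots> \<le> \<rho>\<^sup>2 * ip (U t) (U t) + ip (U (Suc (Suc t))) (U (Suc (Suc t))) / \<rho>\<^sup>2"
        using \<rho>0 by (intro amgm adm_U) auto
      finally have "(2 * ip (U (Suc t)) (U (Suc t))) / (\<rho>\<^sup>2) ^ Suc t
          \<le> (\<rho>\<^sup>2 * ip (U t) (U t) + ip (U (Suc (Suc t))) (U (Suc (Suc t))) / \<rho>\<^sup>2) / (\<rho>\<^sup>2) ^ Suc t"
        using \<rho>0 by (intro divide_right_mono) auto
      also have "\<dots> = b t + b (Suc (Suc t))"
        using \<rho>0 by (simp add: b_def field_simps)
      finally show "2 * b (Suc t) \<le> b t + b (Suc (Suc t))" by (simp add: b_def)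
    next
      fix t show "b t \<le> max (b 0) (E / \<rho>\<^sup>2)"
      proof (cases t)
        case (Suc t')
        have "b t \<le> E * (\<rho>\<^sup>2) ^ t' / (\<rho>\<^sup>2) ^ t"
          unfolding b_def Suc using bound \<rho>0 by (intro divide_right_mono) auto
        also have "\<dots> = E / \<rho>\<^sup>2" using \<rho>0 by (simp add: Suc)
        finally show ?thesis by simp
      qed simp
    qed
    then show ?thesis using \<rho>0 by (simp add: b_def U_def pos_divide_le_eq mult.commute)
  qed
  have expand: "cexp S (\<lambda>z. (\<Sum>i\<in>S. u i (z i))\<^sup>2) x = ip u u + ip u (A u)"
  proof -
    have b: "bdd_meas (\<lambda>z. u i (z i) * u j (z j))" if "i \<in> S" "j \<in> S" for i j
      using that u by (intro bdd_meas_mult lift) auto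
    have "cexp S (\<lambda>z. (\<Sum>i\<in>S. u i (z i))\<^sup>2) x = cexp S (\<lambda>z. \<Sum>i\<in>S. \<Sum>j\<in>S. u i (z i) * u j (z j)) x"
      by (simp add: power2_eq_square sum_product)
    also have "\<dots> = (\<Sum>i\<in>S. cexp S (\<lambda>z. \<Sum>j\<in>S. u i (z i) * u j (z j)) x)"
      by (intro cexp_sum S xs bdd_meas_sum b)
    also have "\<dots> = (\<Sum>i\<in>S. \<Sum>j\<in>S. cexp S (\<lambda>z. u i (z i) * u j (z j)) x)"
      by (intro sum.cong refl cexp_sum S xs b)
    also have "\<dots> = (\<Sum>i\<in>S. cexp S (\<lambda>z. u i (z i) * u i (z i)) x + (\<Sum>j\<in>S - {i}. cexp S (\<lambda>z. u i (z i) * u j (z j)) x))"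
      using fS by (intro sum.cong refl sum.remove) auto
    finally show ?thesis by (simp add: sum.distrib ip_def[of u u] ip_A[OF adm_u adm_u])
  qed
  have quad: "ip u (A u) \<le> \<rho> * ip u u" if \<rho>: "matrix_radius S \<Phi> < \<rho>" for \<rho>
  proof -
    have \<rho>0: "\<rho> > 0" using matrix_radius_nonneg[OF fS ne] \<rho> by (rule order.strict_trans1)
    have "2 * ip u (A u) \<le> \<rho> * ip u u + ip (A u) (A u) / \<rho>"
      by (intro amgm adm_u adm_A \<rho>0)
    also have "ip (A u) (A u) / \<rho> \<le> (\<rho>\<^sup>2 * ip u u) / \<rho>"
      using contr[OF \<rho>] \<rho>0 by (intro divide_right_mono) auto
    also have "\<dots> = \<rho> * ip u u" using \<rho>0 by (simp add: power2_eq_square)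
    finally show ?thesis by simp
  qed
  have "ip u (A u) \<le> \<eta> * ip u u"
  proof (rule field_le_epsilon)
    fix e :: real assume e: "e > 0"
    define \<delta> where "\<delta> = e / (ip u u + 1)"
    have p: "ip u u + 1 > 0" using ip_nonneg[of u] by simp
    have \<delta>: "\<delta> > 0" using e p by (simp add: \<delta>_def)
    have "ip u (A u) \<le> (\<eta> + \<delta>) * ip u u" using r \<delta> by (intro quad) simp
    also have "\<dots> = \<eta> * ip u u + \<delta> * ip u u" by (simp add: distrib_right)
    also have "\<delta> * ip u u \<le> \<delta> * (ip u u + 1)" using \<delta> by (intro mult_left_mono) auto
    also have "\<dots> = e" using p by (simp add: \<delta>_def)
    finally show "ip u (A u) \<le> \<eta> * ip u u + e" by simp
  qed
  then show ?thesis
    unfolding expand by (simp add: ip_def power2_eq_square distrib_right)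
qed

section \<open>Spectral gap bounds from influence matrices\<close>

text \<open>
  With \<open>G i = E\<^bsub>S-{i}\<^esub> F - \<mu>\<close> and \<open>N = \<Sum> \<parallel>G i\<parallel>\<^sup>2\<close>, the bound on the influence operator gives
  \<open>\<parallel>\<Sum> G i\<parallel>\<^sup>2 \<le> (1 + \<eta>) N\<close>. Since \<open>N = \<langle>F - \<mu>, \<Sum> G i\<rangle>\<close>, duality yields \<open>N \<le> (1 + \<eta>) Var F\<close>, and the right-hand
  side of the Poincare inequality is \<open>m Var F - N\<close>.
\<close>

lemma poincare_influence:
  assumes m: "0 < m" and \<eta>: "0 \<le> \<eta>"
    and inf: "\<And>S x. S \<subseteq> {1..n} \<Longrightarrow> card S = m \<Longrightarrow> x \<in> regular S \<Longrightarrow>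
      \<exists>\<Phi>. influence_matrix (compl S) (restrict x (compl S)) \<Phi> \<and> matrix_radius S \<Phi> \<le> \<eta>"
  shows "poincare m (m - 1) ((real m - 1) / real m - \<eta> / real m)"
  unfolding poincare_def
proof (intro allI impI, elim conjE)
  fix S x F assume S: "S \<subseteq> {1..n}" and cS: "card S = m" and x: "x \<in> regular S" and F: "bdd_meas F"
  have xs: "x \<in> space full_space" using regularD(1)[OF x] .
  have fS: "finite S" using finite_index_subset[OF S] .
  have ne: "S \<noteq> {}" using m cS by auto
  have T: "S - {i} \<subseteq> {1..n}" "S - {i} \<subseteq> S" for i using S by auto
  define \<mu> where "\<mu> = cexp S F x"
  define G where "G i z = cexp (S - {i}) F z - \<mu>" for i z
  define u where "u i a = G i (x(i := a))" for i a
  define V where "V = cexp S (\<lambda>z. (F z)\<^sup>2) x - \<mu>\<^sup>2"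
  have bG: "bdd_meas (G i)" for i unfolding G_def by (intro bdd_meas_intros bdd_meas_cexp T F)
  have cu: "coord_bdd i (u i)" if "i \<in> S" for i
    unfolding u_def[abs_def] using that S by (intro bdd_meas_imp_coord_bdd_upd xs bG) auto
  have bu: "bdd_meas (\<lambda>z. u i (z i))" if "i \<in> S" for i
    using that S by (intro bdd_meas_lift cu) auto
  have AEu: "AE z in cond_ker S x. u i (z i) = G i z" if "i \<in> S" for i
    using AE_upd[OF S x that F] by eventually_elim (simp add: u_def G_def)
  have mG: "cexp S (G i) x = 0" for i
    unfolding G_def using cexp_tower[OF S T(2) x F] F T S xs
    by (simp add: cexp_diff bdd_meas_cexp bdd_meas_const cexp_const \<mu>_def)
  have mu: "cexp S (\<lambda>z. u i (z i)) x = 0" if "i \<in> S" for i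
    using cexp_cong_AE[OF bu[OF that] bG AEu[OF that]] mG by simp
  obtain \<Phi> where \<Phi>: "influence_matrix (compl S) (restrict x (compl S)) \<Phi>" "matrix_radius S \<Phi> \<le> \<eta>"
    using inf[OF S cS x] by auto
  define N where "N = (\<Sum>i\<in>S. cexp S (\<lambda>z. (G i z)\<^sup>2) x)"
  have sumG: "cexp S (\<lambda>z. (\<Sum>i\<in>S. G i z)\<^sup>2) x \<le> (1 + \<eta>) * N"
  proof -
    have "cexp S (\<lambda>z. (\<Sum>i\<in>S. G i z)\<^sup>2) x = cexp S (\<lambda>z. (\<Sum>i\<in>S. u i (z i))\<^sup>2) x"
    proof (intro cexp_cong_AE bdd_meas_intros bG bu)
      have "AE z in cond_ker S x. \<forall>i\<in>S. u i (z i) = G i z"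
        by (intro AE_finite_allI fS AEu)
      then show "AE z in cond_ker S x. (\<Sum>i\<in>S. G i z)\<^sup>2 = (\<Sum>i\<in>S. u i (z i))\<^sup>2"
        by eventually_elim simp
    qed
    also have "\<dots> \<le> (1 + \<eta>) * (\<Sum>i\<in>S. cexp S (\<lambda>z. (u i (z i))\<^sup>2) x)"
      by (rule influence_quadratic[OF S x ne \<Phi> cu mu])
    also have "(\<Sum>i\<in>S. cexp S (\<lambda>z. (u i (z i))\<^sup>2) x) = N"
      unfolding N_def
    proof (intro sum.cong refl cexp_cong_AE bdd_meas_intros bG bu)
      fix i assume "i \<in> S"
      then show "AE z in cond_ker S x. (u i (z i))\<^sup>2 = (G i z)\<^sup>2"
        using AEu by fastforce
    qed
    finally show ?thesis .
  qed
  define H where "H z = F z - \<mu>" for z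
  have bH: "bdd_meas H" unfolding H_def by (intro bdd_meas_intros F)
  have GH: "G i z = cexp (S - {i}) H z" if "z \<in> space full_space" for i z
    unfolding G_def H_def using that by (simp add: cexp_diff[OF T(1) that F bdd_meas_const] cexp_const[OF T(1) that])
  have sq: "cexp S (\<lambda>z. (Q z - \<mu>)\<^sup>2) x = cexp S (\<lambda>z. (Q z)\<^sup>2) x - \<mu>\<^sup>2" if Q: "bdd_meas Q" "cexp S Q x = \<mu>" for Q
  proof -
    have "cexp S (\<lambda>z. (Q z - \<mu>)\<^sup>2) x = cexp S (\<lambda>z. ((Q z)\<^sup>2 - (2 * \<mu>) * Q z) - (- \<mu>\<^sup>2)) x"
      by (intro cexp_cong_space) (simp add: power2_eq_square algebra_simps)
    also have "\<dots> = cexp S (\<lambda>z. (Q z)\<^sup>2) x - 2 * \<mu> * \<mu> + \<mu>\<^sup>2"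
      using Q by (simp only: cexp_diff[OF S xs] bdd_meas_intros cexp_const[OF S xs] cexp_cmult)
    finally show ?thesis by (simp add: power2_eq_square)
  qed
  have V: "cexp S (\<lambda>z. (H z)\<^sup>2) x = V"
    unfolding H_def V_def by (rule sq[OF F]) (simp add: \<mu>_def)
  have NV: "cexp S (\<lambda>z. (F z)\<^sup>2 - (cexp (S - {i}) F z)\<^sup>2) x = V - cexp S (\<lambda>z. (G i z)\<^sup>2) x" for i
  proof -
    have "cexp S (\<lambda>z. (F z)\<^sup>2 - (cexp (S - {i}) F z)\<^sup>2) x = cexp S (\<lambda>z. (F z)\<^sup>2) x - cexp S (\<lambda>z. (cexp (S - {i}) F z)\<^sup>2) x"
      by (intro cexp_diff S xs bdd_meas_intros bdd_meas_cexp T F)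
    also have "cexp S (\<lambda>z. (cexp (S - {i}) F z)\<^sup>2) x = cexp S (\<lambda>z. (G i z)\<^sup>2) x + \<mu>\<^sup>2"
      using sq[OF bdd_meas_cexp[OF T(1)[of i] F]] cexp_tower[OF S T(2) x F] by (simp add: G_def \<mu>_def)
    finally show ?thesis by (simp add: V_def)
  qed
  have "2 * N \<le> (1 + \<eta>) * V + (1 / (1 + \<eta>)) * cexp S (\<lambda>z. (\<Sum>i\<in>S. G i z)\<^sup>2) x"
  proof -
    have "N = (\<Sum>i\<in>S. cexp S (\<lambda>z. H z * G i z) x)"
      unfolding N_def
    proof (intro sum.cong refl)
      fix i
      have "cexp S (\<lambda>z. (G i z)\<^sup>2) x = cexp S (\<lambda>z. cexp (S - {i}) H z * cexp (S - {i}) H z) x"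
        by (intro cexp_cong_space) (simp add: GH power2_eq_square)
      also have "\<dots> = cexp S (\<lambda>z. H z * cexp (S - {i}) H z) x"
        by (rule cexp_selfadj[OF S T(2) x bH bH, symmetric])
      also have "\<dots> = cexp S (\<lambda>z. H z * G i z) x"
        by (intro cexp_cong_space) (simp add: GH)
      finally show "cexp S (\<lambda>z. (G i z)\<^sup>2) x = cexp S (\<lambda>z. H z * G i z) x" .
    qed
    also have "\<dots> = cexp S (\<lambda>z. \<Sum>i\<in>S. H z * G i z) x"
      by (intro cexp_sum[symmetric] S xs bdd_meas_intros bH bG)
    finally have "2 * N = cexp S (\<lambda>z. 2 * (\<Sum>i\<in>S. H z * G i z)) x" by (simp only: cexp_cmult)
    also have "\<dots> \<le> cexp S (\<lambda>z. (1 + \<eta>) * (H z)\<^sup>2 + (1 / (1 + \<eta>)) * (\<Sum>i\<in>S. G i z)\<^sup>2) x"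
      using \<eta> by (intro cexp_mono_AE S xs bdd_meas_intros bH bG AE_I2)
        (simp only: sum_distrib_left[symmetric], rule weighted_am_gm, simp)
    also have "\<dots> = (1 + \<eta>) * cexp S (\<lambda>z. (H z)\<^sup>2) x + (1 / (1 + \<eta>)) * cexp S (\<lambda>z. (\<Sum>i\<in>S. G i z)\<^sup>2) x"
      by (subst cexp_add[OF S xs]) (auto simp only: cexp_cmult intro!: bdd_meas_intros bH bG)
    finally show ?thesis by (simp add: V)
  qed
  also have "(1 / (1 + \<eta>)) * cexp S (\<lambda>z. (\<Sum>i\<in>S. G i z)\<^sup>2) x \<le> (1 / (1 + \<eta>)) * ((1 + \<eta>) * N)"
    using sumG \<eta> by (intro mult_left_mono) auto
  also have "\<dots> = N" using \<eta> by simp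
  finally have NV': "N \<le> (1 + \<eta>) * V" by simp
  have "(\<Sum>\<Gamma>\<in>blocks S (m - 1). cexp S (\<lambda>z. (F z)\<^sup>2 - (cexp \<Gamma> F z)\<^sup>2) x) = (\<Sum>i\<in>S. V - cexp S (\<lambda>z. (G i z)\<^sup>2) x)"
    using blocks_card_minus_1[OF fS ne, of "\<lambda>\<Gamma>. cexp S (\<lambda>z. (F z)\<^sup>2 - (cexp \<Gamma> F z)\<^sup>2) x"] by (simp add: NV cS)
  also have "\<dots> = real m * V - N" by (simp add: sum_subtractf N_def cS)
  finally have rhs: "(\<Sum>\<Gamma>\<in>blocks S (m - 1). cexp S (\<lambda>z. (F z)\<^sup>2 - (cexp \<Gamma> F z)\<^sup>2) x) = real m * V - N" .
  have ch: "m choose (m - 1) = m" using m binomial_symmetric[of "m - 1" m] by (simp add: choose_one)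
  have "((real m - 1) / real m - \<eta> / real m) * V * real m = (real m - 1 - \<eta>) * V"
    using m by (simp add: field_simps)
  then show "((real m - 1) / real m - \<eta> / real m) * (cexp S (\<lambda>z. (F z)\<^sup>2) x - (cexp S F x)\<^sup>2) * real (m choose (m - 1))
      \<le> (\<Sum>\<Gamma>\<in>blocks S (m - 1). cexp S (\<lambda>z. (F z)\<^sup>2 - (cexp \<Gamma> F z)\<^sup>2) x)"
    using NV' unfolding rhs ch V_def[symmetric] \<mu>_def[symmetric] by (simp add: algebra_simps)
qed

lemma regular_nonempty:
  assumes S: "S \<subseteq> {1..n}" shows "regular S \<noteq> {}"
proof
  assume e: "regular S = {}"
  obtain x where x: "x \<in> space full_space"
    using prob_space.not_empty[OF density_prob] by force
  have "block_mass {1..n} x = (\<integral>\<^sup>+ w. ennreal (\<pi> w) \<partial>full_space)"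
    unfolding block_mass_def
    by (intro nn_integral_cong arg_cong[where f="\<lambda>z. ennreal (\<pi> z)"])
      (auto simp: fun_eq_iff override_apply space_PiM PiE_def extensional_def)
  also have "\<dots> = 1"
  proof -
    have "emeasure (density full_space (\<lambda>w. ennreal (\<pi> w))) (space full_space) = (\<integral>\<^sup>+ w. ennreal (\<pi> w) * indicator (space full_space) w \<partial>full_space)"
      using density_measurable by (intro emeasure_density) auto
    also have "\<dots> = (\<integral>\<^sup>+ w. ennreal (\<pi> w) \<partial>full_space)" by (rule nn_integral_cong) simp
    finally show ?thesis using prob_space.emeasure_space_1[OF density_prob] by simp
  qed
  finally have r: "x \<in> regular {1..n}" using x by (simp add: regular_def)
  interpret prob_space "cond_ker {1..n} x" using prob_space_cond_ker[OF order_refl x] .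
  have "AE z in cond_ker {1..n} x. False"
    using AE_cond_ker_regular[OF order_refl S r] e by simp
  then show False by simp
qed

text \<open>
  The hypothesis forces \<open>\<eta> \<ge> 0\<close>, because regular points exist and a spectral radius is nonnegative.
  Therefore the constant obtained is at most \<open>1\<close>, as the spectral gap bound requires.
\<close>

lemma influence_hyp:
  assumes m: "m \<in> {1..n}"
    and h: "\<And>\<Lambda> y. \<Lambda> \<subseteq> {1..n} \<Longrightarrow> card \<Lambda> = n - m \<Longrightarrow> y \<in> pos_points \<Lambda> \<Longrightarrow>
      \<exists>\<Phi>. influence_matrix \<Lambda> y \<Phi> \<and> matrix_radius (compl \<Lambda>) \<Phi> \<le> \<eta>"
  shows "0 \<le> \<eta>" and "poincare m (m - 1) ((real m - 1) / real m - \<eta> / real m)"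
proof -
  have inf: "\<exists>\<Phi>. influence_matrix (compl S) (restrict x (compl S)) \<Phi> \<and> matrix_radius S \<Phi> \<le> \<eta>"
    if S: "S \<subseteq> {1..n}" "card S = m" and x: "x \<in> regular S" for S x
  proof -
    have "card (compl S) = n - m" using S finite_index_subset[OF S(1)] by (simp add: card_Diff_subset)
    moreover have "restrict x (compl S) \<in> pos_points (compl S)"
      using regular_iff_marg[OF S(1) regularD(1)[OF x]] x regularD(1)[OF x]
      by (auto simp: pos_points_def space_PiM PiE_def)
    ultimately show ?thesis
      using h[of "compl S" "restrict x (compl S)"] compl_compl[OF S(1)] by auto
  qed
  have S: "{1..m} \<subseteq> {1..n}" "card {1..m} = m" using m by auto
  obtain x where "x \<in> regular {1..m}" using regular_nonempty[OF S(1)] by auto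
  from inf[OF S this] obtain \<Phi> where "matrix_radius {1..m} \<Phi> \<le> \<eta>" by auto
  then show \<eta>: "0 \<le> \<eta>" using matrix_radius_nonneg[of "{1..m}" \<Phi>] m by auto
  show "poincare m (m - 1) ((real m - 1) / real m - \<eta> / real m)"
    using m by (intro poincare_influence \<eta> inf) auto
qed

lemma Gap_level:
  assumes m: "m \<in> {2..n}" and h: "\<And>\<Lambda> y. \<Lambda> \<subseteq> {1..n} \<Longrightarrow> n - card \<Lambda> = m \<Longrightarrow> y \<in> pos_points \<Lambda> \<Longrightarrow>
      \<exists>\<Phi>. influence_matrix \<Lambda> y \<Phi> \<and> matrix_radius (compl \<Lambda>) \<Phi> \<le> \<eta>"
  shows "Gap m (m - 1) \<ge> ereal ((real m - 1) / real m - \<eta> / real m)"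
proof -
  have h': "\<exists>\<Phi>. influence_matrix \<Lambda> y \<Phi> \<and> matrix_radius (compl \<Lambda>) \<Phi> \<le> \<eta>"
    if "\<Lambda> \<subseteq> {1..n}" "card \<Lambda> = n - m" "y \<in> pos_points \<Lambda>" for \<Lambda> y
    using that m by (intro h) auto
  have mI: "m \<in> {1..n}" using m by auto
  note P = influence_hyp[OF mI h']
  have "(real m - 1) / real m - \<eta> / real m \<le> 1"
    using P(1) m by (simp add: field_simps)
  then show ?thesis
    using P(2) m by (intro Gap_ge) auto
qed

text \<open>
  Starting from block size \<open>l = m\<close>, each additional free coordinate \<open>k\<close> contributes the factor for block size
  \<open>k - 1\<close>.
\<close>

lemma poincare_product:
  assumes l: "1 \<le> l" and m: "l \<le> m" "m \<le> n"
    and \<eta>: "\<And>k. k \<in> {l+1..n} \<Longrightarrow> \<eta> k < real k - 1" and si: "spectrally_independent l \<eta>"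
  shows "poincare m l (\<Prod>k=l+1..m. (real k - 1) / real k - \<eta> k / real k) \<and>
    0 \<le> (\<Prod>k=l+1..m. (real k - 1) / real k - \<eta> k / real k) \<and>
    (\<Prod>k=l+1..m. (real k - 1) / real k - \<eta> k / real k) \<le> 1"
  using m
proof (induction m rule: dec_induct)
  case base
  then show ?case using poincare_refl by simp
next
  case (step m)
  define g where "g k = (real k - 1) / real k - \<eta> k / real k" for k
  have k: "Suc m \<in> {l+1..n}" "Suc m \<in> {1..n}" using step by auto
  have "\<exists>\<Phi>. influence_matrix \<Lambda> y \<Phi> \<and> matrix_radius (compl \<Lambda>) \<Phi> \<le> \<eta> (Suc m)"
    if "\<Lambda> \<subseteq> {1..n}" "card \<Lambda> = n - Suc m" "y \<in> pos_points \<Lambda>" for \<Lambda> y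
    using si k that unfolding spectrally_independent_def by blast
  note P = influence_hyp[OF k(2) this]
  have g: "0 \<le> g (Suc m)" "g (Suc m) \<le> 1"
    using \<eta>[OF k(1)] P(1) unfolding g_def diff_divide_distrib[symmetric]
    by (simp_all add: divide_le_eq_1)
  have IH: "poincare m l (\<Prod>k=l+1..m. g k)" "0 \<le> (\<Prod>k=l+1..m. g k)" "(\<Prod>k=l+1..m. g k) \<le> 1"
    using step by (auto simp: g_def)
  have lm: "l \<le> m" by (rule step.hyps(1))
  have prod: "(\<Prod>k=l+1..Suc m. g k) = (\<Prod>k=l+1..m. g k) * g (Suc m)"
    using lm by simp
  have "poincare (Suc m) l ((\<Prod>k=l+1..m. g k) * g (Suc m))"
    using P(2) IH(1,2) lm unfolding g_def[of "Suc m", symmetric] by (intro poincare_step) simp_all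
  moreover have "0 \<le> (\<Prod>k=l+1..m. g k) * g (Suc m)" "(\<Prod>k=l+1..m. g k) * g (Suc m) \<le> 1"
    by (rule mult_nonneg_nonneg[OF IH(2) g(1)], rule mult_le_one[OF IH(3) g])
  ultimately have "poincare (Suc m) l (\<Prod>k=l+1..Suc m. g k) \<and> 0 \<le> (\<Prod>k=l+1..Suc m. g k) \<and> (\<Prod>k=l+1..Suc m. g k) \<le> 1"
    unfolding prod by blast
  then show ?case unfolding g_def .
qed

end

lemma product_identity:
  fixes \<eta> :: "nat \<Rightarrow> real"
  assumes "1 \<le> l" "l \<le> n"
  shows "(\<Prod>k=l+1..n. (real k - 1) / real k - \<eta> k / real k)
    = real l / real n * (\<Prod>k=l+1..n. 1 - \<eta> k / (real k - 1))"
  using assms(2)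
proof (induction n rule: dec_induct)
  case base
  then show ?case using assms(1) by simp
next
  case (step m)
  have m: "real m > 0" using assms step by simp
  let ?P = "\<Prod>k=l+1..m. 1 - \<eta> k / (real k - 1)"
  have "(\<Prod>k=l+1..Suc m. (real k - 1) / real k - \<eta> k / real k)
      = real l / real m * ?P * (real m / real (Suc m) - \<eta> (Suc m) / real (Suc m))"
    using step by simp
  also have "\<dots> = real l / real (Suc m) * (?P * (1 - \<eta> (Suc m) / real m))"
  proof -
    have "real l / real m * p * (real m / real (Suc m) - e / real (Suc m)) = real l / real (Suc m) * (p * (1 - e / real m))"
      for p e :: real
    proof -
      have "real m / real (Suc m) - e / real (Suc m) = real m * (1 - e / real m) / real (Suc m)"
        using m by (simp add: right_diff_distrib diff_divide_distrib)
      then show ?thesis using m by simp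
    qed
    then show ?thesis .
  qed
  also have "\<dots> = real l / real (Suc m) * (\<Prod>k=l+1..Suc m. 1 - \<eta> k / (real k - 1))"
    using step by simp
  finally show ?case .
qed

theorem corollary5:
  fixes n :: nat
    and M :: "nat \<Rightarrow> 'a measure"
    and \<pi> :: "(nat \<Rightarrow> 'a) \<Rightarrow> real"
    and q :: "nat set \<Rightarrow> nat set \<Rightarrow> (nat \<Rightarrow> 'a) \<Rightarrow> (nat \<Rightarrow> 'a) \<Rightarrow> real"
  assumes "gibbs_setting n M \<pi> q"
  shows
    "(\<forall>m \<in> {2..n}. \<forall>\<eta> :: real.
        \<eta> < real m - 1 \<and>
        (\<forall>\<Lambda>. \<Lambda> \<subseteq> {1..n} \<and> n - card \<Lambda> = m \<longrightarrow>
          (\<forall>y \<in> gibbs_setting.pos_points n M \<pi> \<Lambda>.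
            \<exists>\<Phi>. gibbs_setting.influence_matrix n M \<pi> q \<Lambda> y \<Phi> \<and>
                 matrix_radius ({1..n} - \<Lambda>) \<Phi> \<le> \<eta>)) \<longrightarrow>
        gibbs_setting.Gap n M \<pi> q m (m - 1) \<ge> ereal ((real m - 1) / real m - \<eta> / real m)) \<and>
     (\<forall>l \<in> {1..n-1}. \<forall>\<eta> :: nat \<Rightarrow> real.
        (\<forall>m \<in> {l+1..n}. \<eta> m < real m - 1) \<and>
        gibbs_setting.spectrally_independent n M \<pi> q l \<eta> \<longrightarrow>
        gibbs_setting.Gap n M \<pi> q n l
          \<ge> ereal (\<Prod>k=l+1..n. (real k - 1) / real k - \<eta> k / real k) \<and>
        (\<Prod>k=l+1..n. (real k - 1) / real k - \<eta> k / real k)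
          = real l / real n * (\<Prod>k=l+1..n. 1 - \<eta> k / (real k - 1)))"
proof -
  interpret gibbs_setting n M \<pi> q by (rule assms)
  show ?thesis
  proof (intro conjI ballI allI impI; (elim conjE)?)
    fix m :: nat and \<eta> :: real
    assume m: "m \<in> {2..n}"
      and h: "\<forall>\<Lambda>. \<Lambda> \<subseteq> {1..n} \<and> n - card \<Lambda> = m \<longrightarrow>
          (\<forall>y \<in> pos_points \<Lambda>. \<exists>\<Phi>. influence_matrix \<Lambda> y \<Phi> \<and> matrix_radius ({1..n} - \<Lambda>) \<Phi> \<le> \<eta>)"
    show "ereal ((real m - 1) / real m - \<eta> / real m) \<le> Gap m (m - 1)"
      by (rule Gap_level[OF m]) (use h in blast)
  next
    fix l and \<eta> :: "nat \<Rightarrow> real"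
    assume l: "l \<in> {1..n-1}" and \<eta>: "\<forall>m \<in> {l+1..n}. \<eta> m < real m - 1" and si: "spectrally_independent l \<eta>"
    have l': "1 \<le> l" "l \<le> n" using l by auto
    have "poincare n l (\<Prod>k=l+1..n. (real k - 1) / real k - \<eta> k / real k) \<and>
      0 \<le> (\<Prod>k=l+1..n. (real k - 1) / real k - \<eta> k / real k) \<and>
      (\<Prod>k=l+1..n. (real k - 1) / real k - \<eta> k / real k) \<le> 1"
      using \<eta> si by (intro poincare_product[OF l' order_refl]) auto
    then show "ereal (\<Prod>k=l+1..n. (real k - 1) / real k - \<eta> k / real k) \<le> Gap n l"
      using l' by (intro Gap_ge) auto
  next
    fix l and \<eta> :: "nat \<Rightarrow> real"
    assume l: "l \<in> {1..n-1}"
    show "(\<Prod>k=l+1..n. (real k - 1) / real k - \<eta> k / real k)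
          = real l / real n * (\<Prod>k=l+1..n. 1 - \<eta> k / (real k - 1))"
      using l by (intro product_identity) auto
  qed
qed

end
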